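(* Let $\xi\to X$ be a complex vector bundle over a space $X$ and take homology with coefficients in a commutative ring. There is a split short exact sequence of abelian groups \[0\to H_\ast(X)\to H_\ast(\xi^{\mathrm{P}})\to H_{\ast-1}(\mathbb{S}\xi)\to 0.\] Moreover, since each of $X$, $\xi^{\mathrm{P}}$ and $\mathbb{S}\xi$ has a projection map to $X$, each of the groups in this sequence is naturally an $H^\ast(X)$-module, and the sequence is in fact a split short exact sequence of $H^\ast(X)$-modules.
   Context: $\xi$ is given a Hermitian metric, $\mathbb{S}\xi$ is its unit sphere bundle. The spherical compactification of $\xi$ is $\xi^{\mathrm{S}}=\mathbb{S}(\xi\oplus\mathbb{R})$. The pinched compactification $\xi^{\mathrm{P}}$ is the quotient of $\xi^{\mathrm{S}}$ by identifying, for each $x\in X$, the two points $(0,\pm1)$ in the fibre over $x$. The map $\xi\to\xi^{\mathrm{P}}$ is the composite of $v\mapsto\left(\frac{2v}{\|v\|^2+1},\frac{\|v\|^2-1}{\|v\|^2+1}\right)$ with the quotient map; it gives in particular the zero section $X\hookrightarrow\xi^{\mathrm{P}}$. The maps of the sequence: $H_\ast(X)\to H_\ast(\xi^{\mathrm{P}})$ is induced by the zero section, and $H_\ast(\xi^{\mathrm{P}})\to H_{\ast-1}(\mathbb{S}\xi)$ is the composite of $H_\ast(\xi^{\mathrm{P}})\to H_\ast(\xi^{\mathrm{P}},X)$ with the zig-zag of isomorphisms \[H_\ast(\xi^{\mathrm{P}},X)\xrightarrow{\cong}H_\ast(\xi^{\mathrm{P}},\xi^{\mathrm{P}}\setminus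 A)\xleftarrow{\cong}H_\ast((I,\partial I)\times\mathbb{S}\xi)\xrightarrow{\Theta}H_{\ast-1}(\mathbb{S}\xi),\] where $I=[\tfrac12,1]$, $A\subset\xi^{\mathrm{P}}$ is the set of vectors of length in $(\tfrac12,1)$, $I\times\mathbb{S}\xi\to\xi^{\mathrm{P}}$ is $(r,v)\mapsto rv$, and $\Theta$ is $\partial_\ast$ followed by projection onto the summand of $H_{\ast-1}(\partial I\times\mathbb{S}\xi)$ corresponding to $1\in\partial I$. For a space $Y$ with a map $\pi\colon Y\to X$, $\alpha\in H^\ast(X)$ acts on $H_\ast(Y)$ by $y\mapsto\pi^\ast\alpha\cap y$; the sign convention for cap and cross products is such that $(1\times\beta)\cap(a\times y)=a\times(\beta\cap y)$. *)

theory Defs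
  imports "HOL-Homology.Homology" "HOL-Algebra.QuotRing"
begin

section \<open>Singular homology and cohomology with coefficients in a commutative ring\<close>

text \<open>
  HOL-Homology treats integer coefficients, one degree at a time.  Here the whole singular complex
  \<open>C\<^sub>*(X; R) = \<Oplus>\<^sub>n C\<^sub>n(X; R)\<close> is one free module, whose basis elements are pairs \<open>(n, \<sigma>)\<close> of a degree and
  a singular \<open>n\<close>-simplex, and \<open>H\<^sub>*\<close> is the homology of the total complex.  Its degree \<open>n\<close> summand is
  \<open>homology_degree\<close> below.

  The coefficient ring is the type \<open>'r\<close>.  The sort \<open>{comm_ring, comm_monoid_mult}\<close> is that of
  commutative rings with unit; unlike \<open>comm_ring_1\<close> it does not exclude the zero ring.
  Constants taking an argument of type \<open>'r itself\<close> use it only to fix the coefficients.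
\<close>

type_synonym 'a tagged_simplex = "nat \<times> ((nat \<Rightarrow> real) \<Rightarrow> 'a)"
type_synonym ('a, 'r) chains = "'a tagged_simplex \<Rightarrow>\<^sub>0 'r"
type_synonym ('a, 'r) cochain = "'a tagged_simplex \<Rightarrow> 'r"

definition chain_extend ::
    "('a tagged_simplex \<Rightarrow> ('b, 'r) chains) \<Rightarrow> ('a, 'r::{comm_ring,comm_monoid_mult}) chains \<Rightarrow> ('b, 'r) chains"
  where "chain_extend g c =
    (\<Sum>s\<in>Poly_Mapping.keys c. Poly_Mapping.map (\<lambda>r. Poly_Mapping.lookup c s * r) (g s))"

definition chains_of :: "'a topology \<Rightarrow> ('a, 'r::{comm_ring,comm_monoid_mult}) chains set"
  where "chains_of Y = {c. \<forall>(n, \<sigma>)\<in>Poly_Mapping.keys c. singular_simplex n Y \<sigma>}"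

definition boundary :: "('a, 'r::{comm_ring,comm_monoid_mult}) chains \<Rightarrow> ('a, 'r) chains"
  where "boundary = chain_extend (\<lambda>(n, \<sigma>). if n = 0 then 0
    else \<Sum>k\<le>n. Poly_Mapping.single (n - 1, singular_face n k \<sigma>) ((-1) ^ k))"

definition push_chain ::
    "('a \<Rightarrow> 'b) \<Rightarrow> ('a, 'r::{comm_ring,comm_monoid_mult}) chains \<Rightarrow> ('b, 'r) chains"
  where "push_chain f = chain_extend (\<lambda>(n, \<sigma>). Poly_Mapping.single (n, simplex_map n f \<sigma>) 1)"

text \<open>
  Relative homology \<open>H\<^sub>*(Y, B; R)\<close>, for \<open>B\<close> a subset of \<open>Y\<close>: relative cycles modulo relative boundaries.
  A chain of \<open>subtopology Y {}\<close> is zero, so absolute homology is the case \<open>B = {}\<close>.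
\<close>

definition rel_cycles :: "'a topology \<Rightarrow> 'a set \<Rightarrow> ('a, 'r::{comm_ring,comm_monoid_mult}) chains set"
  where "rel_cycles Y B = {c \<in> chains_of Y. boundary c \<in> chains_of (subtopology Y B)}"

definition rel_boundaries :: "'a topology \<Rightarrow> 'a set \<Rightarrow> ('a, 'r::{comm_ring,comm_monoid_mult}) chains set"
  where "rel_boundaries Y B =
    {boundary d + b |d b. d \<in> chains_of Y \<and> b \<in> chains_of (subtopology Y B)}"

definition rel_cycle_group ::
    "'r::{comm_ring,comm_monoid_mult} itself \<Rightarrow> 'a topology \<Rightarrow> 'a set \<Rightarrow> ('a, 'r) chains monoid"
  where "rel_cycle_group R Y B = \<lparr>carrier = rel_cycles Y B, mult = (+), one = 0\<rparr>"

definition rel_homology ::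
    "'r::{comm_ring,comm_monoid_mult} itself \<Rightarrow> 'a topology \<Rightarrow> 'a set \<Rightarrow> ('a, 'r) chains set monoid"
  where "rel_homology R Y B = rel_cycle_group R Y B Mod rel_boundaries Y B"

abbreviation homology ::
    "'r::{comm_ring,comm_monoid_mult} itself \<Rightarrow> 'a topology \<Rightarrow> ('a, 'r) chains set monoid"
  where "homology R Y \<equiv> rel_homology R Y {}"

definition homology_class ::
    "'a topology \<Rightarrow> 'a set \<Rightarrow> ('a, 'r::{comm_ring,comm_monoid_mult}) chains \<Rightarrow> ('a, 'r) chains set"
  where "homology_class Y B c = rel_boundaries Y B #>\<^bsub>rel_cycle_group TYPE('r) Y B\<^esub> c"

definition homology_degree ::
    "'r::{comm_ring,comm_monoid_mult} itself \<Rightarrow> 'a topology \<Rightarrow> nat \<Rightarrow> ('a, 'r) chains set set"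
  where "homology_degree R Y n =
    homology_class Y {} ` {c \<in> rel_cycles Y {}. \<forall>s\<in>Poly_Mapping.keys c. fst s = n}"

text \<open>
  Maps between homology groups are given on representatives; the union over all representatives of a
  class is then a union of equal cosets.  The arguments \<open>Y'\<close>, \<open>B'\<close> are the target pair.
\<close>

definition induced_map ::
    "'b topology \<Rightarrow> 'b set \<Rightarrow> ('a \<Rightarrow> 'b) \<Rightarrow> ('a, 'r::{comm_ring,comm_monoid_mult}) chains set \<Rightarrow>
     ('b, 'r) chains set"
  where "induced_map Y' B' f C = (\<Union>c\<in>C. homology_class Y' B' (push_chain f c))"

definition connecting_map ::
    "'a topology \<Rightarrow> 'a set \<Rightarrow> ('a, 'r::{comm_ring,comm_monoid_mult}) chains set \<Rightarrow> ('a, 'r) chains set"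
  where "connecting_map Y B C = (\<Union>c\<in>C. homology_class (subtopology Y B) {} (boundary c))"

text \<open>
  \<open>front_face p \<sigma>\<close> is \<open>\<sigma>\<close> restricted to the first \<open>p + 1\<close> vertices, \<open>back_face n k \<sigma>\<close> is the \<open>n\<close>-simplex \<open>\<sigma>\<close>
  restricted to the last \<open>k + 1\<close> vertices.
\<close>

definition front_face :: "nat \<Rightarrow> ((nat \<Rightarrow> real) \<Rightarrow> 'a) \<Rightarrow> (nat \<Rightarrow> real) \<Rightarrow> 'a"
  where "front_face p \<sigma> = restrict \<sigma> (standard_simplex p)"

definition back_face :: "nat \<Rightarrow> nat \<Rightarrow> ((nat \<Rightarrow> real) \<Rightarrow> 'a) \<Rightarrow> (nat \<Rightarrow> real) \<Rightarrow> 'a"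
  where "back_face n k \<sigma> =
    restrict (\<lambda>x. \<sigma> (\<lambda>i. if i < n - k then 0 else x (i - (n - k)))) (standard_simplex k)"

text \<open>
  A cochain is a function on singular simplices of bounded degree, set to zero outside the singular
  simplices of \<open>X\<close>, so that \<open>H\<^sup>*(X; R) = \<Oplus>\<^sub>k H\<^sup>k(X; R)\<close>.
\<close>

definition cochains :: "'a topology \<Rightarrow> ('a, 'r::{comm_ring,comm_monoid_mult}) cochain set"
  where "cochains X = {\<phi>. (\<forall>n \<sigma>. \<not> singular_simplex n X \<sigma> \<longrightarrow> \<phi> (n, \<sigma>) = 0) \<and>
                           (\<exists>N. \<forall>n>N. \<forall>\<sigma>. \<phi> (n, \<sigma>) = 0)}"

definition coboundary ::
    "'a topology \<Rightarrow> ('a, 'r::{comm_ring,comm_monoid_mult}) cochain \<Rightarrow> ('a, 'r) cochain"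
  where "coboundary X \<phi> = (\<lambda>(n, \<sigma>). if n > 0 \<and> singular_simplex n X \<sigma>
    then \<Sum>k\<le>n. (-1) ^ k * \<phi> (n - 1, singular_face n k \<sigma>) else 0)"

definition cup ::
    "'a topology \<Rightarrow> ('a, 'r::{comm_ring,comm_monoid_mult}) cochain \<Rightarrow> ('a, 'r) cochain \<Rightarrow> ('a, 'r) cochain"
  where "cup X \<phi> \<psi> = (\<lambda>(n, \<sigma>). if singular_simplex n X \<sigma>
    then \<Sum>i\<le>n. \<phi> (i, front_face i \<sigma>) * \<psi> (n - i, back_face n (n - i) \<sigma>) else 0)"

definition unit_cochain :: "'a topology \<Rightarrow> ('a, 'r::{comm_ring,comm_monoid_mult}) cochain"
  where "unit_cochain X = (\<lambda>(n, \<sigma>). if n = 0 \<and> singular_simplex n X \<sigma> then 1 else 0)"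

definition cocycle_ring ::
    "'r::{comm_ring,comm_monoid_mult} itself \<Rightarrow> 'a topology \<Rightarrow> ('a, 'r) cochain ring"
  where "cocycle_ring R X =
    \<lparr>carrier = {\<phi> \<in> cochains X. coboundary X \<phi> = (\<lambda>_. 0)}, mult = cup X, one = unit_cochain X,
     zero = (\<lambda>_. 0), add = (\<lambda>\<phi> \<psi> s. \<phi> s + \<psi> s)\<rparr>"

definition cohomology ::
    "'r::{comm_ring,comm_monoid_mult} itself \<Rightarrow> 'a topology \<Rightarrow> ('a, 'r) cochain set ring"
  where "cohomology R X = cocycle_ring R X Quot (coboundary X ` cochains X)"

definition pull_cochain ::
    "'a topology \<Rightarrow> ('a \<Rightarrow> 'b) \<Rightarrow> ('b, 'r::{comm_ring,comm_monoid_mult}) cochain \<Rightarrow> ('a, 'r) cochain"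
  where "pull_cochain Y f \<phi> =
    (\<lambda>(n, \<sigma>). if singular_simplex n Y \<sigma> then \<phi> (n, simplex_map n f \<sigma>) else 0)"

definition cohomology_map ::
    "'a topology \<Rightarrow> ('a \<Rightarrow> 'b) \<Rightarrow> ('b, 'r::{comm_ring,comm_monoid_mult}) cochain set \<Rightarrow> ('a, 'r) cochain set"
  where "cohomology_map Y f A =
    (\<Union>\<phi>\<in>A. (coboundary Y ` cochains Y) +>\<^bsub>cocycle_ring TYPE('r) Y\<^esub> pull_cochain Y f \<phi>)"

text \<open>
  The cap product evaluates the cochain on the back face and introduces no sign.  If \<open>\<phi>\<close> is a
  cocycle then \<open>\<partial>(\<phi> \<inter> c) = \<phi> \<inter> \<partial>c\<close>, and \<open>(\<phi> \<union> \<psi>) \<inter> c = \<phi> \<inter> (\<psi> \<inter> c)\<close>.  On products, with the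
  Alexander-Whitney and Eilenberg-Zilber maps, \<open>(1 \<times> \<beta>) \<inter> (a \<times> y) = a \<times> (\<beta> \<inter> y)\<close>: only front faces
  in the direction of \<open>a\<close> survive.  (Evaluating on front faces, or inserting the Koszul sign, would
  give this formula only up to a sign depending on degrees.)
\<close>

definition cap ::
    "('a, 'r::{comm_ring,comm_monoid_mult}) cochain \<Rightarrow> ('a, 'r) chains \<Rightarrow> ('a, 'r) chains"
  where "cap \<phi> = chain_extend (\<lambda>(n, \<sigma>).
    \<Sum>k\<le>n. Poly_Mapping.single (n - k, front_face (n - k) \<sigma>) (\<phi> (k, back_face n k \<sigma>)))"

definition cap_class ::
    "'a topology \<Rightarrow> ('a, 'r::{comm_ring,comm_monoid_mult}) cochain set \<Rightarrow> ('a, 'r) chains set \<Rightarrow>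
     ('a, 'r) chains set"
  where "cap_class Y A C = (\<Union>\<phi>\<in>A. \<Union>c\<in>C. homology_class Y {} (cap \<phi> c))"

text \<open>The action of \<open>H\<^sup>*(X; R)\<close> on \<open>H\<^sub>*(Y; R)\<close> for a space \<open>Y\<close> with a map \<open>\<pi>\<close> to \<open>X\<close>.\<close>

definition homology_action ::
    "'b topology \<Rightarrow> ('b \<Rightarrow> 'a) \<Rightarrow> ('a, 'r::{comm_ring,comm_monoid_mult}) cochain set \<Rightarrow>
     ('b, 'r) chains set \<Rightarrow> ('b, 'r) chains set"
  where "homology_action Y \<pi> \<alpha> y = cap_class Y (cohomology_map Y \<pi> \<alpha>) y"


section \<open>Modules over a non-commutative ring and split short exact sequences\<close>

text \<open>
  \<open>H\<^sup>*(X; R)\<close> is only graded commutative, and the library's \<open>module\<close> asks for a commutative ring.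
  The library's \<open>short_exact_sequence\<close> asks for its groups to have the same type.  The abelian groups
  below are written multiplicatively, as the homology groups of HOL-Homology are.
\<close>

locale left_module = ring A + M: comm_group M
  for A :: "('s, 'y) ring_scheme" (structure)
    and M :: "('m, 'x) monoid_scheme"
    and act :: "'s \<Rightarrow> 'm \<Rightarrow> 'm" +
  assumes act_closed: "\<lbrakk>a \<in> carrier A; x \<in> carrier M\<rbrakk> \<Longrightarrow> act a x \<in> carrier M"
    and act_add_left: "\<lbrakk>a \<in> carrier A; b \<in> carrier A; x \<in> carrier M\<rbrakk>
      \<Longrightarrow> act (a \<oplus> b) x = act a x \<otimes>\<^bsub>M\<^esub> act b x"
    and act_add_right: "\<lbrakk>a \<in> carrier A; x \<in> carrier M; y \<in> carrier M\<rbrakk>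
      \<Longrightarrow> act a (x \<otimes>\<^bsub>M\<^esub> y) = act a x \<otimes>\<^bsub>M\<^esub> act a y"
    and act_mult: "\<lbrakk>a \<in> carrier A; b \<in> carrier A; x \<in> carrier M\<rbrakk>
      \<Longrightarrow> act (a \<otimes> b) x = act a (act b x)"
    and act_one: "x \<in> carrier M \<Longrightarrow> act \<one> x = x"

definition linear_hom ::
    "('s, 'y) ring_scheme \<Rightarrow> ('m, 'x) monoid_scheme \<Rightarrow> ('s \<Rightarrow> 'm \<Rightarrow> 'm) \<Rightarrow>
     ('n, 'z) monoid_scheme \<Rightarrow> ('s \<Rightarrow> 'n \<Rightarrow> 'n) \<Rightarrow> ('m \<Rightarrow> 'n) set"
  where "linear_hom A M actM N actN =
    {f \<in> hom M N. \<forall>a\<in>carrier A. \<forall>x\<in>carrier M. f (actM a x) = actN a (f x)}"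

definition short_exact ::
    "('l, 'x) monoid_scheme \<Rightarrow> ('m, 'y) monoid_scheme \<Rightarrow> ('n, 'z) monoid_scheme \<Rightarrow>
     ('l \<Rightarrow> 'm) \<Rightarrow> ('m \<Rightarrow> 'n) \<Rightarrow> bool"
  where "short_exact L M N f g \<longleftrightarrow>
    f \<in> mon L M \<and> g \<in> epi M N \<and> f ` carrier L = kernel M N g"

definition splits :: "('n, 'z) monoid_scheme \<Rightarrow> ('m \<Rightarrow> 'n) \<Rightarrow> ('n \<Rightarrow> 'm) \<Rightarrow> bool"
  where "splits N g s \<longleftrightarrow> (\<forall>y\<in>carrier N. g (s y) = y)"


section \<open>Hermitian vector bundles and the pinched compactification\<close>

record ('a, 'e) vbundle =
  total :: "'e topology"
  bproj :: "'e \<Rightarrow> 'a"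
  vadd :: "'e \<Rightarrow> 'e \<Rightarrow> 'e"
  vscale :: "complex \<Rightarrow> 'e \<Rightarrow> 'e"
  vzero :: "'a \<Rightarrow> 'e"

text \<open>\<open>\<complex>\<^sup>n\<close>, in the style of the library's \<open>Euclidean_space\<close>.\<close>

definition complex_space :: "nat \<Rightarrow> (nat \<Rightarrow> complex) topology"
  where "complex_space n =
    subtopology (product_topology (\<lambda>_. euclidean) UNIV) {z. \<forall>i\<ge>n. z i = 0}"

text \<open>
  A local trivialisation \<open>\<Phi>\<close> of rank \<open>n\<close> over \<open>U\<close> carries the vector space structure of \<open>\<complex>\<^sup>n\<close> to the
  operations of each fibre over \<open>U\<close>; in particular the vector space axioms hold in these fibres.
\<close>

definition local_trivialisation ::
    "'a topology \<Rightarrow> ('a, 'e) vbundle \<Rightarrow> 'a set \<Rightarrow> nat \<Rightarrow> ('a \<times> (nat \<Rightarrow> complex) \<Rightarrow> 'e) \<Rightarrow> bool"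
  where "local_trivialisation X \<xi> U n \<Phi> \<longleftrightarrow>
    homeomorphic_map (prod_topology (subtopology X U) (complex_space n))
      (subtopology (total \<xi>) {v. bproj \<xi> v \<in> U}) \<Phi> \<and>
    (\<forall>x\<in>topspace X \<inter> U. \<forall>z\<in>topspace (complex_space n).
      bproj \<xi> (\<Phi> (x, z)) = x \<and>
      vzero \<xi> x = \<Phi> (x, \<lambda>_. 0) \<and>
      (\<forall>c. vscale \<xi> c (\<Phi> (x, z)) = \<Phi> (x, \<lambda>i. c * z i)) \<and>
      (\<forall>w\<in>topspace (complex_space n).
        vadd \<xi> (\<Phi> (x, z)) (\<Phi> (x, w)) = \<Phi> (x, \<lambda>i. z i + w i)))"

definition complex_vector_bundle :: "'a topology \<Rightarrow> ('a, 'e) vbundle \<Rightarrow> bool"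
  where "complex_vector_bundle X \<xi> \<longleftrightarrow>
    continuous_map (total \<xi>) X (bproj \<xi>) \<and>
    (\<forall>x\<in>topspace X. \<exists>U n \<Phi>. openin X U \<and> x \<in> U \<and> local_trivialisation X \<xi> U n \<Phi>)"

definition hermitian_metric :: "('a, 'e) vbundle \<Rightarrow> ('e \<Rightarrow> 'e \<Rightarrow> complex) \<Rightarrow> bool"
  where "hermitian_metric \<xi> h \<longleftrightarrow>
    continuous_map
      (subtopology (prod_topology (total \<xi>) (total \<xi>)) {(v, w). bproj \<xi> v = bproj \<xi> w})
      euclidean (\<lambda>(v, w). h v w) \<and>
    (\<forall>u\<in>topspace (total \<xi>). \<forall>v\<in>topspace (total \<xi>). bproj \<xi> u = bproj \<xi> v \<longrightarrow>
      h v u = cnj (h u v) \<and>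
      (\<forall>c. h u (vscale \<xi> c v) = c * h u v) \<and>
      (\<forall>w\<in>topspace (total \<xi>). bproj \<xi> w = bproj \<xi> u \<longrightarrow>
        h u (vadd \<xi> v w) = h u v + h u w)) \<and>
    (\<forall>v\<in>topspace (total \<xi>). v \<noteq> vzero \<xi> (bproj \<xi> v) \<longrightarrow> Re (h v v) > 0)"

definition vnorm :: "('e \<Rightarrow> 'e \<Rightarrow> complex) \<Rightarrow> 'e \<Rightarrow> real"
  where "vnorm h v = sqrt (Re (h v v))"

definition sphere_bundle :: "('a, 'e) vbundle \<Rightarrow> ('e \<Rightarrow> 'e \<Rightarrow> complex) \<Rightarrow> 'e topology"
  where "sphere_bundle \<xi> h = subtopology (total \<xi>) {v. vnorm h v = 1}"

text \<open>The total space of \<open>\<xi> \<oplus> \<real>\<close> is the product of that of \<open>\<xi>\<close> with the real line.\<close>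

definition spherical_compactification ::
    "('a, 'e) vbundle \<Rightarrow> ('e \<Rightarrow> 'e \<Rightarrow> complex) \<Rightarrow> ('e \<times> real) topology"
  where "spherical_compactification \<xi> h =
    subtopology (prod_topology (total \<xi>) euclideanreal) {(v, t). (vnorm h v)\<^sup>2 + t\<^sup>2 = 1}"

definition quotient_topology :: "'a topology \<Rightarrow> ('a \<Rightarrow> 'b) \<Rightarrow> 'b topology"
  where "quotient_topology T q =
    topology (\<lambda>U. U \<subseteq> q ` topspace T \<and> openin T {x \<in> topspace T. q x \<in> U})"

lemma openin_quotient_topology:
  "openin (quotient_topology T q) U \<longleftrightarrow>
    U \<subseteq> q ` topspace T \<and> openin T {x \<in> topspace T. q x \<in> U}"
proof -
  have "istopology (\<lambda>U. U \<subseteq> q ` topspace T \<and> openin T {x \<in> topspace T. q x \<in> U})"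
    unfolding istopology_def
  proof (intro conjI allI impI)
    fix U V
    assume "U \<subseteq> q ` topspace T \<and> openin T {x \<in> topspace T. q x \<in> U}"
      and "V \<subseteq> q ` topspace T \<and> openin T {x \<in> topspace T. q x \<in> V}"
    moreover have "{x \<in> topspace T. q x \<in> U \<inter> V} =
        {x \<in> topspace T. q x \<in> U} \<inter> {x \<in> topspace T. q x \<in> V}"
      by blast
    ultimately show "U \<inter> V \<subseteq> q ` topspace T" "openin T {x \<in> topspace T. q x \<in> U \<inter> V}"
      by auto
  next
    fix K
    assume K: "\<forall>U\<in>K. U \<subseteq> q ` topspace T \<and> openin T {x \<in> topspace T. q x \<in> U}"
    then show "\<Union> K \<subseteq> q ` topspace T" by blast
    have "{x \<in> topspace T. q x \<in> \<Union> K} = (\<Union>U\<in>K. {x \<in> topspace T. q x \<in> U})"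
      by blast
    then show "openin T {x \<in> topspace T. q x \<in> \<Union> K}"
      using K by auto
  qed
  then show ?thesis
    by (simp add: quotient_topology_def topology_inverse')
qed

lemma topspace_quotient_topology: "topspace (quotient_topology T q) = q ` topspace T"
proof -
  have "{x \<in> topspace T. q x \<in> q ` topspace T} = topspace T"
    by blast
  then have "openin (quotient_topology T q) (q ` topspace T)"
    by (simp add: openin_quotient_topology)
  then show ?thesis
    by (meson openin_quotient_topology openin_subset openin_topspace subset_antisym)
qed

lemma quotient_map_quotient_topology: "quotient_map T (quotient_topology T q) q"
  by (auto simp: quotient_map_def topspace_quotient_topology openin_quotient_topology)

text \<open>The points of \<open>\<xi>\<^sup>P\<close> are the classes of the relation \<open>(0\<^sub>x, 1) \<sim> (0\<^sub>x, -1)\<close>.\<close>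

definition pinch :: "('a, 'e) vbundle \<Rightarrow> 'e \<times> real \<Rightarrow> ('e \<times> real) set"
  where "pinch \<xi> = (\<lambda>(v, t). if v = vzero \<xi> (bproj \<xi> v) then {(v, 1), (v, -1)} else {(v, t)})"

definition pinched ::
    "('a, 'e) vbundle \<Rightarrow> ('e \<Rightarrow> 'e \<Rightarrow> complex) \<Rightarrow> ('e \<times> real) set topology"
  where "pinched \<xi> h = quotient_topology (spherical_compactification \<xi> h) (pinch \<xi>)"

definition pinched_proj :: "('a, 'e) vbundle \<Rightarrow> ('e \<times> real) set \<Rightarrow> 'a"
  where "pinched_proj \<xi> p = (THE x. \<forall>(v, t)\<in>p. bproj \<xi> v = x)"

definition pinched_incl ::
    "('a, 'e) vbundle \<Rightarrow> ('e \<Rightarrow> 'e \<Rightarrow> complex) \<Rightarrow> 'e \<Rightarrow> ('e \<times> real) set"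
  where "pinched_incl \<xi> h v = pinch \<xi>
    (vscale \<xi> (complex_of_real (2 / ((vnorm h v)\<^sup>2 + 1))) v,
     ((vnorm h v)\<^sup>2 - 1) / ((vnorm h v)\<^sup>2 + 1))"

definition zero_section ::
    "('a, 'e) vbundle \<Rightarrow> ('e \<Rightarrow> 'e \<Rightarrow> complex) \<Rightarrow> 'a \<Rightarrow> ('e \<times> real) set"
  where "zero_section \<xi> h x = pinched_incl \<xi> h (vzero \<xi> x)"


section \<open>The maps of the sequence\<close>

definition annulus :: "('a, 'e) vbundle \<Rightarrow> ('e \<Rightarrow> 'e \<Rightarrow> complex) \<Rightarrow> ('e \<times> real) set set"
  where "annulus \<xi> h =
    pinched_incl \<xi> h ` {v \<in> topspace (total \<xi>). 1/2 < vnorm h v \<and> vnorm h v < 1}"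

definition annulus_compl :: "('a, 'e) vbundle \<Rightarrow> ('e \<Rightarrow> 'e \<Rightarrow> complex) \<Rightarrow> ('e \<times> real) set set"
  where "annulus_compl \<xi> h = topspace (pinched \<xi> h) - annulus \<xi> h"

text \<open>\<open>cylinder\<close> is \<open>I \<times> S\<close> with \<open>I = [1/2, 1]\<close>, and \<open>cylinder_ends\<close> is \<open>\<partial>I \<times> S\<close>.\<close>

definition cylinder :: "'e topology \<Rightarrow> (real \<times> 'e) topology"
  where "cylinder S = prod_topology (top_of_set {1/2..1}) S"

definition cylinder_ends :: "'e topology \<Rightarrow> (real \<times> 'e) set"
  where "cylinder_ends S = {1/2, 1} \<times> topspace S"

definition zero_section_map ::
    "('a, 'e) vbundle \<Rightarrow> ('e \<Rightarrow> 'e \<Rightarrow> complex) \<Rightarrow>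
     ('a, 'r::{comm_ring,comm_monoid_mult}) chains set \<Rightarrow> (('e \<times> real) set, 'r) chains set"
  where "zero_section_map \<xi> h = induced_map (pinched \<xi> h) {} (zero_section \<xi> h)"

text \<open>\<open>H\<^sub>*(\<xi>\<^sup>P, X) \<rightarrow> H\<^sub>*(\<xi>\<^sup>P, \<xi>\<^sup>P - A)\<close>, and then \<open>H\<^sub>*((I, \<partial>I) \<times> S\<xi>) \<rightarrow> H\<^sub>*(\<xi>\<^sup>P, \<xi>\<^sup>P - A)\<close>.\<close>

definition enlarge_map ::
    "('a, 'e) vbundle \<Rightarrow> ('e \<Rightarrow> 'e \<Rightarrow> complex) \<Rightarrow>
     (('e \<times> real) set, 'r::{comm_ring,comm_monoid_mult}) chains set \<Rightarrow> (('e \<times> real) set, 'r) chains set"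
  where "enlarge_map \<xi> h = induced_map (pinched \<xi> h) (annulus_compl \<xi> h) id"

definition cylinder_map ::
    "('a, 'e) vbundle \<Rightarrow> ('e \<Rightarrow> 'e \<Rightarrow> complex) \<Rightarrow>
     (real \<times> 'e, 'r::{comm_ring,comm_monoid_mult}) chains set \<Rightarrow> (('e \<times> real) set, 'r) chains set"
  where "cylinder_map \<xi> h = induced_map (pinched \<xi> h) (annulus_compl \<xi> h)
    (\<lambda>(r, v). pinched_incl \<xi> h (vscale \<xi> (complex_of_real r) v))"

text \<open>
  The projection of \<open>H\<^sub>*(\<partial>I \<times> S) = H\<^sub>*(S) \<oplus> H\<^sub>*(S)\<close> onto the summand corresponding to \<open>1\<close>.
\<close>

definition end_projection ::
    "'e topology \<Rightarrow> (real \<times> 'e, 'r::{comm_ring,comm_monoid_mult}) chains set \<Rightarrow> ('e, 'r) chains set"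
  where "end_projection S w =
    (let D = subtopology (cylinder S) (cylinder_ends S) in
     THE y. y \<in> carrier (homology TYPE('r) S) \<and>
       (\<exists>z\<in>carrier (homology TYPE('r) S).
          w = induced_map D {} (Pair (1/2)) z \<otimes>\<^bsub>homology TYPE('r) D\<^esub> induced_map D {} (Pair 1) y))"

definition theta_map ::
    "'e topology \<Rightarrow> (real \<times> 'e, 'r::{comm_ring,comm_monoid_mult}) chains set \<Rightarrow> ('e, 'r) chains set"
  where "theta_map S = end_projection S \<circ> connecting_map (cylinder S) (cylinder_ends S)"

definition residue_map ::
    "('a, 'e) vbundle \<Rightarrow> ('e \<Rightarrow> 'e \<Rightarrow> complex) \<Rightarrow> 'a topology \<Rightarrow>
     (('e \<times> real) set, 'r::{comm_ring,comm_monoid_mult}) chains set \<Rightarrow> ('e, 'r) chains set"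
  where "residue_map \<xi> h X =
    theta_map (sphere_bundle \<xi> h)
    \<circ> inv_into
        (carrier (rel_homology TYPE('r) (cylinder (sphere_bundle \<xi> h))
                    (cylinder_ends (sphere_bundle \<xi> h))))
        (cylinder_map \<xi> h)
    \<circ> enlarge_map \<xi> h
    \<circ> induced_map (pinched \<xi> h) (zero_section \<xi> h ` topspace X) id"

end

theory Submission
  imports Defs "HOL-Analysis.Abstract_Topological_Spaces"
begin

text \<open>
  Radially, \<open>\<xi>\<^sup>P\<close> is the cylinder on \<open>S\<xi>\<close> with both ends glued to \<open>X\<close>.  Stretching the annulus
  retracts \<open>\<xi>\<^sup>P - A\<close> into the zero section through maps of pairs; excising the zero section leaves
  \<open>(0, \<infinity>) \<times> S\<xi>\<close>, which is clamped onto \<open>I \<times> S\<xi>\<close>.  So the arrows of the zig-zag are isomorphisms,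
  and since the projection \<open>\<xi>\<^sup>P \<rightarrow> X\<close> retracts the zero section, the sequence is short exact and
  split by \<open>g m \<mapsto> m - z p m\<close>, where \<open>z\<close> and \<open>p\<close> are induced by zero section and projection.

  The residue of a cycle \<open>c\<close> of \<open>\<xi>\<^sup>P\<close> is the end \<open>1\<close> part of \<open>\<partial>e\<close> for any relative cycle \<open>e\<close> of the
  cylinder that becomes homologous to \<open>c\<close> modulo \<open>\<xi>\<^sup>P - A\<close>.  Applying to \<open>c\<close> and \<open>e\<close> a natural
  operation of chains, such as the cap product with a cocycle of \<open>X\<close> or the projection to one degree,
  shows that the residue commutes with it.

  Homotopy and subdivision operators with coefficients are obtained from the integral ones, simplex by
  simplex.
\<close>

section \<open>Chains with coefficients\<close>

text \<open>Pinching is what makes the first arrow of the zig-zag invertible: vectors of length at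
  most 1/2 contract to zero, those of length at least 1 expand to infinity, and in
  \<open>\<xi>\<^sup>P\<close> the two limits are the same copy of \<open>X\<close>. In return, a
  function on \<open>\<xi>\<^sup>P\<close> has to agree at the two poles of each fibre, which
  dictates the auxiliary functions used to show that the zero section is closed and interior to the
  complement of the annulus. As the homotopy must reach both limits at its final time, radial
  scaling is written in homogeneous parameters. The lengths 1/2 and 1 become the heights -3/5 and 0
  on the sphere; these and their slope 5/3 are the constants of the geometric part.

  Classes may mix degrees, so a sign depending on the degree cannot be pulled out of a formula; it
  is carried by an operator on chains. The residue is linear without any sign because, in the chosen
  convention, capping with a cocycle commutes with the boundary.\<close>

definition smul :: "'r::{comm_ring,comm_monoid_mult} \<Rightarrow> ('x \<Rightarrow>\<^sub>0 'r) \<Rightarrow> ('x \<Rightarrow>\<^sub>0 'r)"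
  where "smul r c = Poly_Mapping.map (\<lambda>x. r * x) c"

lemma lookup_smul [simp]: "Poly_Mapping.lookup (smul r c) t = r * Poly_Mapping.lookup c t"
  by (simp add: smul_def Poly_Mapping.map.rep_eq when_def)

lemma smul_single [simp]: "smul r (Poly_Mapping.single s x) = Poly_Mapping.single s (r * x)"
  by (rule poly_mapping_eqI) (simp add: lookup_single when_def)

lemma smul_zero_left [simp]: "smul 0 c = 0"
  and smul_zero_right [simp]: "smul r 0 = 0"
  and smul_one [simp]: "smul 1 c = c"
  and smul_minus_one [simp]: "smul (- 1) c = - c"
  and smul_add_left: "smul (r + r') c = smul r c + smul r' c"
  and smul_add_right: "smul r (c + d) = smul r c + smul r d"
  and smul_uminus_left: "smul (- r) c = - smul r c"
  and smul_uminus_right: "smul r (- c) = - smul r c"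
  and smul_smul: "smul r (smul r' c) = smul (r * r') c"
  by (rule poly_mapping_eqI; simp add: lookup_add lookup_minus algebra_simps)+

lemma smul_sum: "smul r (sum f A) = (\<Sum>a\<in>A. smul r (f a))"
  by (rule poly_mapping_eqI) (simp add: lookup_sum sum_distrib_left)

lemma keys_smul: "Poly_Mapping.keys (smul r c) \<subseteq> Poly_Mapping.keys c"
  by (auto simp: in_keys_iff)

lemma chain_extend_eq: "chain_extend g c = (\<Sum>s\<in>Poly_Mapping.keys c. smul (Poly_Mapping.lookup c s) (g s))"
  by (simp add: chain_extend_def smul_def)

text \<open>The keys of \<open>c + d\<close> depend on cancellation, so additivity is proved by
  summing over a common finite superset of the keys.\<close>

lemma chain_extend_superset:
  assumes "finite A" "Poly_Mapping.keys c \<subseteq> A"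
  shows "chain_extend g c = (\<Sum>s\<in>A. smul (Poly_Mapping.lookup c s) (g s))"
  unfolding chain_extend_eq
  by (rule sum.mono_neutral_left) (use assms in \<open>auto simp: in_keys_iff\<close>)

lemma chain_extend_0 [simp]: "chain_extend g 0 = 0"
  by (simp add: chain_extend_eq)

lemma chain_extend_add: "chain_extend g (c + d) = chain_extend g c + chain_extend g d"
proof -
  let ?A = "Poly_Mapping.keys c \<union> Poly_Mapping.keys d"
  have "finite ?A" "Poly_Mapping.keys (c + d) \<subseteq> ?A"
    using keys_add[of c d] by auto
  then show ?thesis
    by (simp add: chain_extend_superset[of ?A] lookup_add smul_add_left sum.distrib)
qed

lemma chain_extend_smul: "chain_extend g (smul r c) = smul r (chain_extend g c)"
  by (simp add: chain_extend_superset[OF _ keys_smul] chain_extend_eq[of g c] smul_sum smul_smul)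

lemma chain_extend_uminus: "chain_extend g (- c) = - chain_extend g c"
  using chain_extend_smul[of g "-1" c] by simp

lemma chain_extend_diff: "chain_extend g (c - d) = chain_extend g c - chain_extend g d"
  using chain_extend_add[of g c "- d"] by (simp add: chain_extend_uminus)

lemma chain_extend_sum: "chain_extend g (sum f A) = (\<Sum>a\<in>A. chain_extend g (f a))"
  by (induction A rule: infinite_finite_induct) (simp_all add: chain_extend_add)

lemma chain_extend_single [simp]: "chain_extend g (Poly_Mapping.single s r) = smul r (g s)"
  by (simp add: chain_extend_superset[of "{s}"])

lemma chain_extend_chain_extend:
  "chain_extend g (chain_extend f c) = chain_extend (\<lambda>s. chain_extend g (f s)) c"
  by (simp add: chain_extend_eq[of f] chain_extend_eq[of "\<lambda>s. chain_extend g (f s)"] chain_extend_sum chain_extend_smul)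

lemma chain_extend_id: "chain_extend (\<lambda>s. Poly_Mapping.single s 1) c = c"
proof (rule poly_mapping_eqI)
  fix t
  show "Poly_Mapping.lookup (chain_extend (\<lambda>s. Poly_Mapping.single s 1) c) t = Poly_Mapping.lookup c t"
    by (auto simp: chain_extend_eq lookup_sum lookup_single when_def in_keys_iff if_distrib cong: if_cong)
qed

text \<open>The \<open>R\<close>-linear maps between the free modules on all pairs, described by
  their values on the basis instead of by additivity and homogeneity. Closure under sums and
  composition is then visible, and identities reduce to single simplices.\<close>

definition chain_linear ::
    "(('a, 'r::{comm_ring,comm_monoid_mult}) chains \<Rightarrow> ('b, 'r) chains) \<Rightarrow> bool"
  where "chain_linear T \<longleftrightarrow> (\<exists>g. T = chain_extend g)"

lemma chain_linear_extend [simp, intro]: "chain_linear (chain_extend g)"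
  by (auto simp: chain_linear_def)

lemma chain_linear_iff: "chain_linear T \<longleftrightarrow> T = chain_extend (\<lambda>s. T (Poly_Mapping.single s 1))"
proof
  assume "chain_linear T"
  then obtain g where "T = chain_extend g" by (auto simp: chain_linear_def)
  then show "T = chain_extend (\<lambda>s. T (Poly_Mapping.single s 1))" by simp
qed (auto simp: chain_linear_def)

lemma chain_linear_0: "chain_linear T \<Longrightarrow> T 0 = 0"
  and chain_linear_add: "chain_linear T \<Longrightarrow> T (c + d) = T c + T d"
  and chain_linear_diff: "chain_linear T \<Longrightarrow> T (c - d) = T c - T d"
  and chain_linear_uminus: "chain_linear T \<Longrightarrow> T (- c) = - T c"
  and chain_linear_smul: "chain_linear T \<Longrightarrow> T (smul r c) = smul r (T c)"
  and chain_linear_sum: "chain_linear T \<Longrightarrow> T (sum f A) = (\<Sum>a\<in>A. T (f a))"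
  by (auto simp: chain_linear_def chain_extend_add chain_extend_diff chain_extend_uminus
      chain_extend_smul chain_extend_sum)

lemma chain_linear_id [simp, intro]: "chain_linear id" "chain_linear (\<lambda>c. c)"
  by (auto simp: chain_linear_iff chain_extend_id fun_eq_iff)

lemma chain_linear_compose:
  assumes "chain_linear T" "chain_linear U" shows "chain_linear (\<lambda>c. T (U c))"
  using assms by (auto simp: chain_linear_def chain_extend_chain_extend)

lemma chain_linear_plus:
  assumes "chain_linear T" "chain_linear U" shows "chain_linear (\<lambda>c. T c + U c)"
proof -
  obtain f g where fg: "T = chain_extend f" "U = chain_extend g"
    using assms by (auto simp: chain_linear_def)
  have "(\<lambda>c. T c + U c) = chain_extend (\<lambda>s. f s + g s)"
    by (auto simp: fg chain_extend_eq smul_add_right sum.distrib)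
  then show ?thesis by (auto simp: chain_linear_def)
qed

lemma chain_linear_neg:
  assumes "chain_linear T" shows "chain_linear (\<lambda>c. - T c)"
proof -
  obtain f where f: "T = chain_extend f"
    using assms by (auto simp: chain_linear_def)
  have "(\<lambda>c. - T c) = chain_extend (\<lambda>s. - f s)"
    by (auto simp: f chain_extend_eq smul_uminus_right sum_negf)
  then show ?thesis by (auto simp: chain_linear_def)
qed

lemma chain_linear_minus:
  assumes "chain_linear T" "chain_linear U" shows "chain_linear (\<lambda>c. T c - U c)"
  using chain_linear_plus[OF assms(1) chain_linear_neg[OF assms(2)]] by simp

lemma chain_linear_zero [simp, intro]: "chain_linear (\<lambda>c. 0)"
  by (auto simp: chain_linear_def chain_extend_eq fun_eq_iff intro!: exI[of _ "\<lambda>_. 0"])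

section \<open>Supports of chains\<close>

lemma chains_of_iff: "c \<in> chains_of Y \<longleftrightarrow> (\<forall>n \<sigma>. (n, \<sigma>) \<in> Poly_Mapping.keys c \<longrightarrow> singular_simplex n Y \<sigma>)"
  by (auto simp: chains_of_def)

lemma chains_of_0 [simp]: "0 \<in> chains_of Y"
  by (simp add: chains_of_iff)

lemma chains_of_add: "\<lbrakk>c \<in> chains_of Y; d \<in> chains_of Y\<rbrakk> \<Longrightarrow> c + d \<in> chains_of Y"
  using keys_add[of c d] by (fastforce simp: chains_of_iff)

lemma chains_of_smul: "c \<in> chains_of Y \<Longrightarrow> smul r c \<in> chains_of Y"
  using keys_smul[of r c] by (auto simp: chains_of_iff)

lemma chains_of_uminus: "c \<in> chains_of Y \<Longrightarrow> - c \<in> chains_of Y"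
  using chains_of_smul[of c Y "- 1"] by simp

lemma chains_of_uminus_iff [simp]: "- c \<in> chains_of Y \<longleftrightarrow> c \<in> chains_of Y"
  using chains_of_uminus[of c Y] chains_of_uminus[of "- c" Y] by auto

lemma chains_of_diff: "\<lbrakk>c \<in> chains_of Y; d \<in> chains_of Y\<rbrakk> \<Longrightarrow> c - d \<in> chains_of Y"
  using chains_of_add[of c Y "- d"] chains_of_uminus[of d Y] by simp

lemma chains_of_sum: "(\<And>a. a \<in> A \<Longrightarrow> f a \<in> chains_of Y) \<Longrightarrow> sum f A \<in> chains_of Y"
  by (induction A rule: infinite_finite_induct) (auto simp: chains_of_add)

lemma chains_of_single: "singular_simplex n Y \<sigma> \<Longrightarrow> Poly_Mapping.single (n, \<sigma>) r \<in> chains_of Y"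
  by (auto simp: chains_of_iff split: if_splits)

lemma chain_extend_in_chains_of:
  assumes "\<And>n \<sigma>. (n, \<sigma>) \<in> Poly_Mapping.keys c \<Longrightarrow> g (n, \<sigma>) \<in> chains_of Z"
  shows "chain_extend g c \<in> chains_of Z"
  unfolding chain_extend_eq using assms by (auto intro!: chains_of_sum chains_of_smul)

text \<open>Linearity leaves only generators to check, and the support of \<open>c\<close> restricts
  these to actual simplices of \<open>Y\<close>; the values of \<open>T\<close> on other pairs are
  irrelevant.\<close>

lemma chain_linear_closed:
  assumes "chain_linear T" "c \<in> chains_of Y"
    and "\<And>n \<sigma>. singular_simplex n Y \<sigma> \<Longrightarrow> T (Poly_Mapping.single (n, \<sigma>) 1) \<in> chains_of Z"
  shows "T c \<in> chains_of Z"
proof -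
  have "T c = chain_extend (\<lambda>s. T (Poly_Mapping.single s 1)) c"
    using assms(1) by (metis chain_linear_iff)
  moreover have "chain_extend (\<lambda>s. T (Poly_Mapping.single s 1)) c \<in> chains_of Z"
    using assms(2,3) by (intro chain_extend_in_chains_of) (auto simp: chains_of_iff[of c])
  ultimately show ?thesis by simp
qed

text \<open>Identities such as \<open>push_id\<close> rely on simplices being extensional and
  continuous, so operators are compared on chains of a space and not on the whole free
  module.\<close>

lemma chain_linear_eqI:
  assumes "chain_linear T" "chain_linear U" "c \<in> chains_of Y"
    and "\<And>n \<sigma>. singular_simplex n Y \<sigma> \<Longrightarrow>
      T (Poly_Mapping.single (n, \<sigma>) 1) = U (Poly_Mapping.single (n, \<sigma>) 1)"
  shows "T c = U c"
proof -
  have "smul (Poly_Mapping.lookup c s) (T (Poly_Mapping.single s 1)) =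
      smul (Poly_Mapping.lookup c s) (U (Poly_Mapping.single s 1))" if "s \<in> Poly_Mapping.keys c" for s
    using that assms(3,4) by (cases s) (auto simp: chains_of_iff)
  then have "chain_extend (\<lambda>s. T (Poly_Mapping.single s 1)) c = chain_extend (\<lambda>s. U (Poly_Mapping.single s 1)) c"
    by (simp add: chain_extend_eq)
  then show ?thesis
    using assms(1,2) by (metis chain_linear_iff)
qed

lemma chains_of_subtopology:
  "c \<in> chains_of (subtopology Y B) \<longleftrightarrow>
    c \<in> chains_of Y \<and> (\<forall>n \<sigma>. (n, \<sigma>) \<in> Poly_Mapping.keys c \<longrightarrow> \<sigma> ` standard_simplex n \<subseteq> B)"
  unfolding chains_of_iff singular_simplex_subtopology by blast

lemma chains_of_subtopology_mono:
  "\<lbrakk>c \<in> chains_of (subtopology Y B); B \<subseteq> C\<rbrakk> \<Longrightarrow> c \<in> chains_of (subtopology Y C)"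
  unfolding chains_of_subtopology by blast

lemma chains_of_subtopology_subset: "c \<in> chains_of (subtopology Y B) \<Longrightarrow> c \<in> chains_of Y"
  by (simp add: chains_of_subtopology)

lemma chains_of_trivial_topology [simp]: "c \<in> chains_of trivial_topology \<longleftrightarrow> c = 0"
proof
  assume "c \<in> chains_of trivial_topology"
  then have "s \<notin> Poly_Mapping.keys c" for s
    by (cases s) (auto simp: chains_of_iff singular_simplex_empty)
  then show "c = 0" by (auto simp flip: keys_eq_empty)
qed auto

text \<open>Prepares excision, where every small simplex lies in one of two subspaces. A simplex
  lying in both is given to the first, so that each key is counted once.\<close>

lemma chains_of_split:
  assumes "\<And>n \<sigma>. (n, \<sigma>) \<in> Poly_Mapping.keys c \<Longrightarrow> singular_simplex n Y \<sigma> \<or> singular_simplex n Z \<sigma>"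
  obtains c1 c2 where "c1 \<in> chains_of Y" "c2 \<in> chains_of Z" "c = c1 + c2"
proof -
  define T where "T = chain_extend (\<lambda>(n, \<sigma>). if singular_simplex n Y \<sigma> then Poly_Mapping.single (n, \<sigma>) (1::'b) else 0)"
  define U where "U = chain_extend (\<lambda>(n, \<sigma>). if singular_simplex n Y \<sigma> then 0 else Poly_Mapping.single (n, \<sigma>) (1::'b))"
  have "chain_linear (\<lambda>c. T c + U c)"
    unfolding T_def U_def by (rule chain_linear_plus[OF chain_linear_extend chain_linear_extend])
  moreover have "T (Poly_Mapping.single s 1) + U (Poly_Mapping.single s 1) = Poly_Mapping.single s 1" for s
    by (cases s) (simp add: T_def U_def)
  ultimately have "(\<lambda>c. T c + U c) = (\<lambda>c. c)"
    by (simp add: chain_linear_iff chain_extend_id fun_eq_iff)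
  then have "c = T c + U c" by metis
  moreover have "T c \<in> chains_of Y"
    unfolding T_def by (intro chain_extend_in_chains_of) (auto intro: chains_of_single)
  moreover have "U c \<in> chains_of Z"
    unfolding U_def using assms by (intro chain_extend_in_chains_of) (auto intro: chains_of_single)
  ultimately show thesis using that by blast
qed

subsection \<open>Base change from integral chains\<close>

text \<open>\<open>of_int\<close> is not available, as its class excludes the zero ring.\<close>

definition unit_mult :: "int \<Rightarrow> 'r::{comm_ring,comm_monoid_mult}"
  where "unit_mult k = (if 0 \<le> k then ((+) 1 ^^ nat k) 0 else - ((+) 1 ^^ nat (- k)) 0)"

lemma unit_mult_Suc: "unit_mult (k + 1) = unit_mult k + (1::'r::{comm_ring,comm_monoid_mult})"
proof (cases "0 \<le> k")
  case True
  then have "nat (k + 1) = Suc (nat k)" by simp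
  with True show ?thesis by (simp add: unit_mult_def add.commute)
next
  case False
  then have "nat (- k) = Suc (nat (- (k + 1)))" by simp
  with False show ?thesis by (auto simp: unit_mult_def add.commute)
qed

lemma unit_mult_0 [simp]: "unit_mult 0 = 0"
  by (simp add: unit_mult_def)

lemma unit_mult_1 [simp]: "unit_mult 1 = 1"
  using unit_mult_Suc[of 0] by simp

lemma unit_mult_add: "unit_mult (j + k) = unit_mult j + (unit_mult k :: 'r::{comm_ring,comm_monoid_mult})"
proof (induction k rule: int_induct[of _ 0])
  case (step1 i)
  then show ?case
    using unit_mult_Suc[of "j + i", where 'r='r] unit_mult_Suc[of i, where 'r='r] by (simp add: ac_simps)
next
  case (step2 i)
  then show ?case
    using unit_mult_Suc[of "j + (i - 1)", where 'r='r] unit_mult_Suc[of "i - 1", where 'r='r]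
    by (simp add: algebra_simps)
qed simp

text \<open>Base change from integral chains of degree \<open>n\<close> to coefficients in the ring.
  An integral chain does not record its degree, so \<open>n\<close> is supplied to form the tagged
  generators.\<close>

definition of_frag :: "nat \<Rightarrow> 'a chain \<Rightarrow> ('a, 'r::{comm_ring,comm_monoid_mult}) chains"
  where "of_frag n c = (\<Sum>\<sigma>\<in>Poly_Mapping.keys c. Poly_Mapping.single (n, \<sigma>) (unit_mult (Poly_Mapping.lookup c \<sigma>)))"

lemma of_frag_superset:
  assumes "finite A" "Poly_Mapping.keys c \<subseteq> A"
  shows "of_frag n c = (\<Sum>\<sigma>\<in>A. Poly_Mapping.single (n, \<sigma>) (unit_mult (Poly_Mapping.lookup c \<sigma>)))"
  unfolding of_frag_def
  by (rule sum.mono_neutral_left) (use assms in \<open>auto simp: in_keys_iff\<close>)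

lemma of_frag_0 [simp]: "of_frag n 0 = 0"
  by (simp add: of_frag_def)

lemma of_frag_of [simp]: "of_frag n (frag_of \<sigma>) = Poly_Mapping.single (n, \<sigma>) 1"
  by (simp add: of_frag_def)

lemma of_frag_add: "of_frag n (c + d) = of_frag n c + of_frag n d"
proof -
  let ?A = "Poly_Mapping.keys c \<union> Poly_Mapping.keys d"
  have "finite ?A" "Poly_Mapping.keys (c + d) \<subseteq> ?A"
    using keys_add[of c d] by auto
  then show ?thesis
    by (simp add: of_frag_superset[of ?A] lookup_add unit_mult_add single_add sum.distrib)
qed

lemma of_frag_uminus: "of_frag n (- c) = - of_frag n c"
  using of_frag_add[of n c "- c"] by (simp add: eq_neg_iff_add_eq_0 add.commute)

lemma of_frag_diff: "of_frag n (c - d) = of_frag n c - of_frag n d"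
  using of_frag_add[of n c "- d"] by (simp add: of_frag_uminus)

lemma of_frag_sum: "of_frag n (sum f A) = (\<Sum>a\<in>A. of_frag n (f a))"
  by (induction A rule: infinite_finite_induct) (simp_all add: of_frag_add)

text \<open>The alternating signs are the integral scalars in the boundary formula; they pass
  through base change by induction on the exponent.\<close>

lemma of_frag_sign: "of_frag n (frag_cmul ((-1) ^ k) c) = smul ((-1) ^ k) (of_frag n c)"
  by (induction k arbitrary: c) (simp_all add: of_frag_uminus smul_uminus_left flip: minus_frag_cmul)

lemma of_frag_in_chains_of: "singular_chain n Y c \<Longrightarrow> of_frag n c \<in> chains_of Y"
  unfolding of_frag_def by (auto simp: singular_chain_def intro!: chains_of_sum chains_of_single)

text \<open>The bridge from integral operators to operators with coefficients: if \<open>g\<close>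
  and \<open>f\<close> correspond on the simplices of \<open>c\<close>, they correspond on
  \<open>c\<close>. Differences appear in the premises because integral chains are generated by
  \<open>frag_induction\<close> through differences.\<close>

lemma chain_extend_of_frag:
  assumes "\<And>\<sigma>. \<sigma> \<in> Poly_Mapping.keys c \<Longrightarrow> g (n, \<sigma>) = of_frag m (f (frag_of \<sigma>))"
    and "f 0 = 0" and "\<And>a b. f (a - b) = f a - f b"
  shows "chain_extend g (of_frag n c) = of_frag m (f c)"
proof -
  define S where "S = Poly_Mapping.keys c"
  have "Poly_Mapping.keys c \<subseteq> S" by (simp add: S_def)
  then show ?thesis
    by (induction rule: frag_induction)
      (use assms in \<open>simp_all add: S_def of_frag_diff chain_extend_diff\<close>)
qed

subsection \<open>Boundary and induced chain maps\<close>

lemma chain_linear_boundary [simp, intro]: "chain_linear boundary"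
  and chain_linear_push [simp, intro]: "chain_linear (push_chain f)"
  by (simp_all add: boundary_def push_chain_def)

lemmas boundary_0 [simp] = chain_linear_0[OF chain_linear_boundary]
  and boundary_add = chain_linear_add[OF chain_linear_boundary]
  and boundary_diff = chain_linear_diff[OF chain_linear_boundary]
  and boundary_uminus = chain_linear_uminus[OF chain_linear_boundary]
  and push_0 [simp] = chain_linear_0[OF chain_linear_push]
  and push_add = chain_linear_add[OF chain_linear_push]
  and push_diff = chain_linear_diff[OF chain_linear_push]

text \<open>In degree 0 the truncated \<open>n - 1\<close> does no harm, since
  \<open>chain_boundary 0\<close> is zero and so is the left side.\<close>

lemma boundary_single:
  "boundary (Poly_Mapping.single (n, \<sigma>) 1) = of_frag (n - 1) (chain_boundary n (frag_of \<sigma>))"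
  by (auto simp: boundary_def chain_boundary_of of_frag_sum of_frag_sign)

lemma push_single: "push_chain f (Poly_Mapping.single (n, \<sigma>) r) = Poly_Mapping.single (n, simplex_map n f \<sigma>) r"
  by (simp add: push_chain_def)

lemma boundary_of_frag: "boundary (of_frag n c) = of_frag (n - 1) (chain_boundary n c)"
  unfolding boundary_def
  by (rule chain_extend_of_frag)
    (auto simp: chain_boundary_diff chain_boundary_of of_frag_sum of_frag_sign)

lemma push_of_frag: "push_chain f (of_frag n c) = of_frag n (chain_map n f c)"
  unfolding push_chain_def
  by (rule chain_extend_of_frag) (auto simp: chain_map_diff)

lemma boundary_in_chains_of: "c \<in> chains_of Y \<Longrightarrow> boundary c \<in> chains_of Y"
  by (rule chain_linear_closed[OF chain_linear_boundary])
    (auto simp: boundary_single singular_chain_of intro!: of_frag_in_chains_of singular_chain_boundary)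

lemma boundary_boundary:
  assumes "c \<in> chains_of Y" shows "boundary (boundary c) = 0"
proof (rule chain_linear_eqI[OF chain_linear_compose[OF chain_linear_boundary chain_linear_boundary] chain_linear_zero assms])
  fix n \<sigma> assume "singular_simplex n Y \<sigma>"
  then have "chain_boundary (n - Suc 0) (chain_boundary n (frag_of \<sigma>)) = 0"
    by (intro chain_boundary_boundary) (simp add: singular_chain_of)
  then show "boundary (boundary (Poly_Mapping.single (n, \<sigma>) 1)) = 0"
    by (simp add: boundary_single boundary_of_frag)
qed

lemma push_in_chains_of:
  "\<lbrakk>continuous_map Y Z f; c \<in> chains_of Y\<rbrakk> \<Longrightarrow> push_chain f c \<in> chains_of Z"
  by (rule chain_linear_closed[OF chain_linear_push])
    (auto simp: push_single intro!: chains_of_single singular_simplex_simplex_map)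

lemma boundary_push:
  assumes "c \<in> chains_of Y" shows "boundary (push_chain f c) = push_chain f (boundary c)"
proof (rule chain_linear_eqI[OF chain_linear_compose[OF chain_linear_boundary chain_linear_push]
      chain_linear_compose[OF chain_linear_push chain_linear_boundary] assms])
  fix n \<sigma> assume "singular_simplex n Y \<sigma>"
  then have "chain_boundary n (chain_map n f (frag_of \<sigma>)) = chain_map (n - Suc 0) f (chain_boundary n (frag_of \<sigma>))"
    by (intro chain_boundary_chain_map) (simp add: singular_chain_of)
  then show "boundary (push_chain f (Poly_Mapping.single (n, \<sigma>) 1)) = push_chain f (boundary (Poly_Mapping.single (n, \<sigma>) 1))"
    by (simp add: boundary_single push_single push_of_frag)
qed

lemma push_cong:
  assumes "c \<in> chains_of Y" "\<And>x. x \<in> topspace Y \<Longrightarrow> f x = g x"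
  shows "push_chain f c = push_chain g c"
  by (rule chain_linear_eqI[OF chain_linear_push chain_linear_push assms(1)])
    (auto simp: push_single simplex_map_eq[OF _ assms(2)])

lemma push_id:
  assumes "c \<in> chains_of Y" "\<And>x. x \<in> topspace Y \<Longrightarrow> f x = x"
  shows "push_chain f c = c"
  by (rule chain_linear_eqI[OF chain_linear_push chain_linear_id(2) assms(1)])
    (auto simp: push_single simplex_map_id_gen[OF _ assms(2)])

lemma push_push: "push_chain f (push_chain g c) = push_chain (f \<circ> g) c"
  by (auto simp: push_chain_def chain_extend_chain_extend simplex_map_compose split_def)

section \<open>Homology groups\<close>

lemma carrier_rel_cycle_group [simp]: "carrier (rel_cycle_group R Y B) = rel_cycles Y B"
  and mult_rel_cycle_group [simp]: "c \<otimes>\<^bsub>rel_cycle_group R Y B\<^esub> d = c + d"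
  and one_rel_cycle_group [simp]: "\<one>\<^bsub>rel_cycle_group R Y B\<^esub> = 0"
  by (simp_all add: rel_cycle_group_def)

lemma rel_cycles_0 [simp]: "0 \<in> rel_cycles Y B"
  and rel_cycles_add: "\<lbrakk>c \<in> rel_cycles Y B; d \<in> rel_cycles Y B\<rbrakk> \<Longrightarrow> c + d \<in> rel_cycles Y B"
  and rel_cycles_uminus: "c \<in> rel_cycles Y B \<Longrightarrow> - c \<in> rel_cycles Y B"
  by (auto simp: rel_cycles_def boundary_add boundary_uminus chains_of_add)

lemma rel_cycles_diff: "\<lbrakk>c \<in> rel_cycles Y B; d \<in> rel_cycles Y B\<rbrakk> \<Longrightarrow> c - d \<in> rel_cycles Y B"
  using rel_cycles_add[of c Y B "- d"] rel_cycles_uminus[of d Y B] by simp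

lemma rel_cycles_empty_iff: "c \<in> rel_cycles Y {} \<longleftrightarrow> c \<in> chains_of Y \<and> boundary c = 0"
  by (simp add: rel_cycles_def)

lemma rel_boundariesI:
  "\<lbrakk>d \<in> chains_of Y; b \<in> chains_of (subtopology Y B); c = boundary d + b\<rbrakk> \<Longrightarrow> c \<in> rel_boundaries Y B"
  by (auto simp: rel_boundaries_def)

lemma rel_boundariesE:
  assumes "c \<in> rel_boundaries Y B"
  obtains d b where "d \<in> chains_of Y" "b \<in> chains_of (subtopology Y B)" "c = boundary d + b"
  using assms by (auto simp: rel_boundaries_def)

lemma rel_boundaries_empty_iff: "c \<in> rel_boundaries Y {} \<longleftrightarrow> (\<exists>d\<in>chains_of Y. c = boundary d)"
  by (auto simp: rel_boundaries_def)

lemma rel_boundaries_0 [simp]: "0 \<in> rel_boundaries Y B"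
  by (rule rel_boundariesI[of 0 _ 0]) auto

lemma rel_boundaries_add:
  assumes "c \<in> rel_boundaries Y B" "d \<in> rel_boundaries Y B" shows "c + d \<in> rel_boundaries Y B"
proof -
  obtain c1 c2 d1 d2 where "c1 \<in> chains_of Y" "c2 \<in> chains_of (subtopology Y B)" "c = boundary c1 + c2"
    "d1 \<in> chains_of Y" "d2 \<in> chains_of (subtopology Y B)" "d = boundary d1 + d2"
    using assms by (meson rel_boundariesE)
  then show ?thesis
    by (intro rel_boundariesI[of "c1 + d1" _ "c2 + d2"]) (auto simp: boundary_add chains_of_add algebra_simps)
qed

lemma rel_boundaries_uminus:
  assumes "c \<in> rel_boundaries Y B" shows "- c \<in> rel_boundaries Y B"
proof -
  obtain c1 c2 where "c1 \<in> chains_of Y" "c2 \<in> chains_of (subtopology Y B)" "c = boundary c1 + c2"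
    using assms by (meson rel_boundariesE)
  then show ?thesis
    by (intro rel_boundariesI[of "- c1" _ "- c2"]) (auto simp: boundary_uminus)
qed

lemma rel_boundaries_diff:
  "\<lbrakk>c \<in> rel_boundaries Y B; d \<in> rel_boundaries Y B\<rbrakk> \<Longrightarrow> c - d \<in> rel_boundaries Y B"
  using rel_boundaries_add[of c Y B "- d"] rel_boundaries_uminus[of d Y B] by simp

lemma rel_boundaries_subset: "rel_boundaries Y B \<subseteq> rel_cycles Y B"
  by (auto simp: rel_boundaries_def rel_cycles_def boundary_add boundary_boundary
      intro: chains_of_add boundary_in_chains_of chains_of_subtopology_subset)

lemma comm_group_rel_cycle_group: "comm_group (rel_cycle_group R Y B)"
proof (rule comm_groupI)
  fix c assume "c \<in> carrier (rel_cycle_group R Y B)"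
  then show "\<exists>d\<in>carrier (rel_cycle_group R Y B). d \<otimes>\<^bsub>rel_cycle_group R Y B\<^esub> c = \<one>\<^bsub>rel_cycle_group R Y B\<^esub>"
    by (intro bexI[of _ "- c"]) (auto simp: rel_cycles_uminus)
qed (auto simp: rel_cycles_add algebra_simps)

lemma inv_rel_cycle_group:
  assumes "c \<in> rel_cycles Y B" shows "inv\<^bsub>rel_cycle_group R Y B\<^esub> c = - c"
proof -
  interpret comm_group "rel_cycle_group R Y B" by (rule comm_group_rel_cycle_group)
  show ?thesis by (rule inv_equality) (use assms in \<open>auto simp: rel_cycles_uminus\<close>)
qed

lemma subgroup_rel_boundaries: "subgroup (rel_boundaries Y B) (rel_cycle_group R Y B)"
  using rel_boundaries_subset[of Y B]
  by (unfold_locales) (auto simp: rel_boundaries_add inv_rel_cycle_group rel_boundaries_uminus subset_iff)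

lemma comm_group_rel_homology: "comm_group (rel_homology R Y B)"
  unfolding rel_homology_def
  by (rule comm_group.abelian_FactGroup[OF comm_group_rel_cycle_group subgroup_rel_boundaries])

text \<open>Turns cosets into membership of a difference, the form in which classes are compared
  from here on.\<close>

lemma in_homology_class: "d \<in> homology_class Y B c \<longleftrightarrow> d - c \<in> rel_boundaries Y B"
  by (force simp: homology_class_def r_coset_def)

lemma homology_class_self [simp]: "c \<in> homology_class Y B c"
  by (simp add: in_homology_class)

lemma homology_class_eq_iff: "homology_class Y B c = homology_class Y B d \<longleftrightarrow> c - d \<in> rel_boundaries Y B"
proof
  assume "homology_class Y B c = homology_class Y B d"
  then show "c - d \<in> rel_boundaries Y B"
    using homology_class_self[of c Y B] by (simp add: in_homology_class)
next
  assume *: "c - d \<in> rel_boundaries Y B"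
  have "x - c \<in> rel_boundaries Y B \<longleftrightarrow> x - d \<in> rel_boundaries Y B" for x
    using rel_boundaries_add[OF _ *, of "x - c"] rel_boundaries_diff[OF _ *, of "x - d"]
    by (auto simp: algebra_simps)
  then show "homology_class Y B c = homology_class Y B d"
    by (auto simp: in_homology_class)
qed

lemma homology_class_eqI: "c - d \<in> rel_boundaries Y B \<Longrightarrow> homology_class Y B c = homology_class Y B d"
  by (simp add: homology_class_eq_iff)

lemma carrier_rel_homology: "carrier (rel_homology (R :: 'r::{comm_ring,comm_monoid_mult} itself) Y B) = homology_class Y B ` rel_cycles Y B"
  by (auto simp: rel_homology_def FactGroup_def RCOSETS_def homology_class_def r_coset_def)

lemma homology_class_in_carrier: "c \<in> rel_cycles Y B \<Longrightarrow> homology_class Y B c \<in> carrier (rel_homology R Y B)"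
  by (auto simp: carrier_rel_homology)

lemma rel_homologyE:
  assumes "C \<in> carrier (rel_homology R Y B)"
  obtains c where "c \<in> rel_cycles Y B" "C = homology_class Y B c"
  using assms by (auto simp: carrier_rel_homology)

lemma mult_rel_homology:
  assumes "c \<in> rel_cycles Y B" "d \<in> rel_cycles Y B"
  shows "homology_class Y B c \<otimes>\<^bsub>rel_homology R Y B\<^esub> homology_class Y B d = homology_class Y B (c + d)"
proof -
  have "x \<in> homology_class Y B c <#>\<^bsub>rel_cycle_group R Y B\<^esub> homology_class Y B d \<longleftrightarrow> x \<in> homology_class Y B (c + d)" for x
  proof
    assume "x \<in> homology_class Y B c <#>\<^bsub>rel_cycle_group R Y B\<^esub> homology_class Y B d"
    then show "x \<in> homology_class Y B (c + d)"
      using rel_boundaries_add by (fastforce simp: set_mult_def in_homology_class algebra_simps)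
  next
    assume "x \<in> homology_class Y B (c + d)"
    then have "x - d \<in> homology_class Y B c" "x = (x - d) + d"
      by (auto simp: in_homology_class algebra_simps)
    then show "x \<in> homology_class Y B c <#>\<^bsub>rel_cycle_group R Y B\<^esub> homology_class Y B d"
      using homology_class_self[of d Y B] unfolding set_mult_def mult_rel_cycle_group by blast
  qed
  then show ?thesis
    by (auto simp: rel_homology_def FactGroup_def)
qed

lemma one_rel_homology: "\<one>\<^bsub>rel_homology R Y B\<^esub> = homology_class Y B 0"
  by (auto simp: rel_homology_def FactGroup_def in_homology_class)

lemma inv_rel_homology:
  assumes "c \<in> rel_cycles Y B"
  shows "inv\<^bsub>rel_homology R Y B\<^esub> (homology_class Y B c) = homology_class Y B (- c)"
proof -
  interpret comm_group "rel_homology R Y B" by (rule comm_group_rel_homology)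
  show ?thesis
    by (rule inv_equality)
      (use assms in \<open>auto simp: mult_rel_homology rel_cycles_uminus one_rel_homology homology_class_in_carrier\<close>)
qed

lemma rel_homology_homI:
  assumes "\<And>c. c \<in> rel_cycles Y B \<Longrightarrow> f (homology_class Y B c) = homology_class Z C (T c)"
    and "\<And>c. c \<in> rel_cycles Y B \<Longrightarrow> T c \<in> rel_cycles Z C"
    and "\<And>c d. T (c + d) = T c + T d"
  shows "f \<in> hom (rel_homology R Y B) (rel_homology R' Z C)"
  using assms by (auto simp: hom_def carrier_rel_homology mult_rel_homology rel_cycles_add)

text \<open>Well-definedness on classes is contained in the first premise, so \<open>T\<close> may
  be any additive operation on representatives. It serves for push-forwards and also for \<Theta>,
  where \<open>T\<close> is a part of the boundary and lowers the degree.\<close>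

lemma rel_homology_isoI:
  assumes f: "\<And>c. c \<in> rel_cycles Y B \<Longrightarrow> f (homology_class Y B c) = homology_class Z C (T c)"
    and T: "\<And>c. c \<in> rel_cycles Y B \<Longrightarrow> T c \<in> rel_cycles Z C"
    and add: "\<And>c d. T (c + d) = T c + T d"
    and inj: "\<And>c. \<lbrakk>c \<in> rel_cycles Y B; T c \<in> rel_boundaries Z C\<rbrakk> \<Longrightarrow> c \<in> rel_boundaries Y B"
    and surj: "\<And>d. d \<in> rel_cycles Z C \<Longrightarrow> \<exists>c\<in>rel_cycles Y B. T c - d \<in> rel_boundaries Z C"
  shows "f \<in> iso (rel_homology R Y B) (rel_homology R Z C)"
proof -
  have diff: "T (c - d) = T c - T d" for c d
    using add[of "c - d" d] by (simp add: algebra_simps)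
  have "inj_on f (carrier (rel_homology R Y B))"
  proof (rule inj_onI)
    fix x y assume x: "x \<in> carrier (rel_homology R Y B)" and y: "y \<in> carrier (rel_homology R Y B)"
      and eq: "f x = f y"
    obtain c d where cd: "c \<in> rel_cycles Y B" "x = homology_class Y B c"
        "d \<in> rel_cycles Y B" "y = homology_class Y B d"
      using x y by (meson rel_homologyE)
    then have "T (c - d) \<in> rel_boundaries Z C"
      using eq by (simp add: f homology_class_eq_iff diff)
    then show "x = y"
      using inj[of "c - d"] cd by (simp add: rel_cycles_diff homology_class_eq_iff)
  qed
  moreover have "f ` carrier (rel_homology R Y B) = carrier (rel_homology R Z C)"
  proof
    show "f ` carrier (rel_homology R Y B) \<subseteq> carrier (rel_homology R Z C)"
      using f T by (auto simp: carrier_rel_homology)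
    show "carrier (rel_homology R Z C) \<subseteq> f ` carrier (rel_homology R Y B)"
    proof
      fix y assume "y \<in> carrier (rel_homology R Z C)"
      then obtain d where d: "d \<in> rel_cycles Z C" "y = homology_class Z C d" by (rule rel_homologyE)
      then obtain c where c: "c \<in> rel_cycles Y B" "T c - d \<in> rel_boundaries Z C"
        using surj by blast
      then have "y = f (homology_class Y B c)"
        using d f[OF c(1)] homology_class_eqI[OF c(2)] by simp
      then show "y \<in> f ` carrier (rel_homology R Y B)"
        using homology_class_in_carrier[OF c(1), of R] by blast
    qed
  qed
  ultimately show ?thesis
    using rel_homology_homI[OF f T add] by (simp add: iso_def bij_betw_def)
qed

subsection \<open>Maps of pairs\<close>

definition pair_map :: "'a topology \<Rightarrow> 'a set \<Rightarrow> 'b topology \<Rightarrow> 'b set \<Rightarrow> ('a \<Rightarrow> 'b) \<Rightarrow> bool"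
  where "pair_map Y B Z C f \<longleftrightarrow> continuous_map Y Z f \<and> f ` (topspace Y \<inter> B) \<subseteq> C"

lemma pair_map_empty: "pair_map Y {} Z C f \<longleftrightarrow> continuous_map Y Z f"
  by (simp add: pair_map_def)

lemma push_in_rel_chains:
  assumes "pair_map Y B Z C f" "c \<in> chains_of (subtopology Y B)"
  shows "push_chain f c \<in> chains_of (subtopology Z C)"
  by (rule push_in_chains_of[OF _ assms(2)])
    (use assms(1) in \<open>auto simp: pair_map_def continuous_map_in_subtopology continuous_map_from_subtopology\<close>)

lemma push_rel_cycles:
  assumes "pair_map Y B Z C f" "c \<in> rel_cycles Y B"
  shows "push_chain f c \<in> rel_cycles Z C"
  using assms push_in_rel_chains[OF assms(1)]
  by (auto simp: rel_cycles_def pair_map_def push_in_chains_of boundary_push)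

lemma push_rel_boundaries:
  assumes "pair_map Y B Z C f" "c \<in> rel_boundaries Y B"
  shows "push_chain f c \<in> rel_boundaries Z C"
proof -
  obtain c1 c2 where c: "c1 \<in> chains_of Y" "c2 \<in> chains_of (subtopology Y B)" "c = boundary c1 + c2"
    using assms by (meson rel_boundariesE)
  show ?thesis
  proof (rule rel_boundariesI)
    show "push_chain f c1 \<in> chains_of Z" "push_chain f c2 \<in> chains_of (subtopology Z C)"
      using c assms(1) by (auto simp: pair_map_def push_in_chains_of intro: push_in_rel_chains)
    show "push_chain f c = boundary (push_chain f c1) + push_chain f c2"
      using c by (simp add: push_add boundary_push)
  qed
qed

lemma induced_map_class:
  assumes "pair_map Y B Z C f"
  shows "induced_map Z C f (homology_class Y B c) = homology_class Z C (push_chain f c)"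
proof -
  have "homology_class Z C (push_chain f d) = homology_class Z C (push_chain f c)" if "d \<in> homology_class Y B c" for d
    using push_rel_boundaries[OF assms, of "d - c"] that
    by (simp add: in_homology_class homology_class_eq_iff push_diff)
  then show ?thesis
    unfolding induced_map_def using homology_class_self[of c Y B] by blast
qed

lemma induced_map_hom:
  assumes "pair_map Y B Z C f"
  shows "induced_map Z C f \<in> hom (rel_homology R Y B) (rel_homology R Z C)"
  by (rule rel_homology_homI[OF induced_map_class[OF assms] push_rel_cycles[OF assms] push_add])

section \<open>Homotopy invariance\<close>

text \<open>
  The prism operators come from acyclic models: the image of \<open>\<sigma>\<close> is the push-forward along \<open>id \<times> \<sigma>\<close> of a
  chain \<open>P n\<close> of \<open>[0, 1] \<times> \<Delta>\<^sup>n\<close>, whose boundary \<open>P (n - 1)\<close> prescribes.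
\<close>

abbreviation prism_model :: "nat \<Rightarrow> (real \<times> (nat \<Rightarrow> real)) topology"
  where "prism_model n \<equiv> prod_topology (top_of_set {0..1}) (subtopology (powertop_real UNIV) (standard_simplex n))"

abbreviation id_simplex :: "nat \<Rightarrow> (nat \<Rightarrow> real) chain"
  where "id_simplex n \<equiv> frag_of (restrict id (standard_simplex n))"

text \<open>The natural operator represented by a model chain \<open>y\<close> of the prism over a
  simplex: its value on \<sigma> is the image of \<open>y\<close> under
  \<open>id \<times> \<sigma>\<close>.\<close>

definition prism_ext ::
    "nat \<Rightarrow> (real \<times> (nat \<Rightarrow> real)) chain \<Rightarrow> 'a chain \<Rightarrow> (real \<times> 'a) chain"
  where "prism_ext k y c = frag_extend (\<lambda>\<sigma>. chain_map k (map_prod id \<sigma>) y) c"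

lemma prism_ext_0 [simp]: "prism_ext k y 0 = 0"
  and prism_ext_of [simp]: "prism_ext k y (frag_of \<sigma>) = chain_map k (map_prod id \<sigma>) y"
  and prism_ext_diff: "prism_ext k y (c - d) = prism_ext k y c - prism_ext k y d"
  by (simp_all add: prism_ext_def frag_extend_diff)

lemma continuous_map_prism:
  assumes "singular_simplex n Z \<sigma>"
  shows "continuous_map (prism_model n) (prod_topology (top_of_set {0..1}) Z) (map_prod id \<sigma>)"
  using assms by (auto simp: singular_simplex_def continuous_map_prod_top map_prod_def id_def)

lemma singular_chain_prism_ext:
  assumes "singular_chain n Z c" "singular_chain k (prism_model n) y"
  shows "singular_chain k (prod_topology (top_of_set {0..1}) Z) (prism_ext k y c)"
  unfolding prism_ext_def
proof (rule singular_chain_extend)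
  fix \<sigma> assume "\<sigma> \<in> Poly_Mapping.keys c"
  then have "singular_simplex n Z \<sigma>"
    using assms(1) by (auto simp: singular_chain_def)
  then show "singular_chain k (prod_topology (top_of_set {0..1}) Z) (chain_map k (map_prod id \<sigma>) y)"
    by (rule singular_chain_chain_map[OF assms(2) continuous_map_prism])
qed

lemma chain_boundary_prism_ext:
  assumes "singular_chain k (prism_model n) y"
  shows "chain_boundary k (prism_ext k y c) = prism_ext (k - 1) (chain_boundary k y) c"
  using subset_UNIV
proof (induction c rule: frag_induction)
  case (one \<sigma>)
  then show ?case using chain_boundary_chain_map[OF assms] by simp
qed (simp_all add: prism_ext_diff chain_boundary_diff)

text \<open>Functoriality of \<open>id \<times> \<sigma>\<close> makes the represented operator
  natural. Applied to the faces of the identity simplex, it transports a formula for the model to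
  every simplex.\<close>

lemma prism_ext_prism_ext:
  assumes "singular_chain m' (subtopology (powertop_real UNIV) (standard_simplex m)) c'"
    and "singular_chain k (prism_model m') y"
  shows "chain_map k (map_prod id \<sigma>) (prism_ext k y c') = prism_ext k y (chain_map m' \<sigma> c')"
  using assms(1) unfolding singular_chain_def
proof (induction c' rule: frag_induction)
  case (one \<tau>)
  \<comment> \<open>The two maps agree on the prism only, as \<open>simplex_map\<close> restricts to
    the standard simplex; \<open>y\<close> does not see the difference.\<close>
  have "chain_map k (map_prod id \<sigma> \<circ> map_prod id \<tau>) y = chain_map k (map_prod id (simplex_map m' \<sigma> \<tau>)) y"
    by (rule chain_map_eq[OF assms(2)]) (auto simp: simplex_map_def)
  then show ?case by (simp only: prism_ext_of chain_map_of chain_map_compose o_apply)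
qed (simp_all add: prism_ext_diff chain_map_diff)

lemma chain_map_Pair_prism:
  assumes "singular_simplex n Z \<sigma>"
  shows "chain_map n (map_prod id \<sigma>) (chain_map n (Pair t) (id_simplex n)) = chain_map n (Pair t) (frag_of \<sigma>)"
proof -
  have "simplex_map n (map_prod id \<sigma>) (simplex_map n (Pair t) (restrict id (standard_simplex n))) = simplex_map n (Pair t) \<sigma>"
    by (auto simp: simplex_map_def)
  then show ?thesis by simp
qed

lemma singular_chain_id_simplex: "singular_chain n (subtopology (powertop_real UNIV) (standard_simplex n)) (id_simplex n)"
  by (auto simp: singular_chain_of singular_simplex_def intro: continuous_map_eq[OF continuous_map_id])

lemma continuous_map_prism_Pair:
  "0 \<le> t \<Longrightarrow> t \<le> 1 \<Longrightarrow> continuous_map Y (prod_topology (top_of_set {0..1::real}) Y) (Pair t)"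
  by (simp add: continuous_map_pairwise o_def)

text \<open>Both factors of the prism are convex, so interpolating linearly in each coordinate stays
  inside.\<close>

lemma prism_model_homotopic:
  assumes "continuous_map Y (prism_model n) f" "continuous_map Y (prism_model n) g"
  shows "homotopic_with (\<lambda>_. True) Y (prism_model n) f g"
proof -
  define H where "H = (\<lambda>(u::real, y). ((1 - u) * fst (f y) + u * fst (g y), \<lambda>i. (1 - u) * snd (f y) i + u * snd (g y) i))"
  have f: "continuous_map Y euclideanreal (\<lambda>y. fst (f y))" "continuous_map Y euclideanreal (\<lambda>y. snd (f y) i)"
    "\<And>y. y \<in> topspace Y \<Longrightarrow> fst (f y) \<in> {0..1} \<and> snd (f y) \<in> standard_simplex n"
    and g: "continuous_map Y euclideanreal (\<lambda>y. fst (g y))" "continuous_map Y euclideanreal (\<lambda>y. snd (g y) i)"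
    "\<And>y. y \<in> topspace Y \<Longrightarrow> fst (g y) \<in> {0..1} \<and> snd (g y) \<in> standard_simplex n" for i
    using assms by (auto simp: continuous_map_pairwise o_def continuous_map_in_subtopology continuous_map_componentwise_UNIV)
  have snd': "continuous_map (prod_topology (top_of_set {0..1}) Y) euclideanreal (\<lambda>p. k (snd p))"
    if "continuous_map Y euclideanreal k" for k
    using continuous_map_of_snd that by (auto simp: o_def)
  have fst': "continuous_map (prod_topology (top_of_set {0..1::real}) Y) euclideanreal fst"
    using continuous_map_fst continuous_map_into_fulltopology by blast
  have lin: "continuous_map (prod_topology (top_of_set {0..1}) Y) euclideanreal (\<lambda>p. (1 - fst p) * k (snd p) + fst p * l (snd p))"
    if "continuous_map Y euclideanreal k" "continuous_map Y euclideanreal l" for k l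
    by (intro continuous_map_add continuous_map_real_mult continuous_map_diff continuous_map_const[THEN iffD2]
        snd' fst' that disjI2) auto
  have "continuous_map (prod_topology (top_of_set {0..1}) Y) (prism_model n) H"
    unfolding continuous_map_pairwise continuous_map_in_subtopology continuous_map_componentwise_UNIV
  proof (intro conjI allI)
    show "continuous_map (prod_topology (top_of_set {0..1}) Y) euclideanreal (fst \<circ> H)"
      using lin[OF f(1) g(1)] by (simp add: H_def o_def split_def)
    show "continuous_map (prod_topology (top_of_set {0..1}) Y) euclideanreal (\<lambda>x. (snd \<circ> H) x k)" for k
      using lin[OF f(2)[of k] g(2)[of k]] by (simp add: H_def o_def split_def)
    show "fst \<circ> H \<in> topspace (prod_topology (top_of_set {0..1}) Y) \<rightarrow> {0..1}"
      using f(3) g(3) by (fastforce simp: H_def intro!: convex_bound_le)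
    show "snd \<circ> H \<in> topspace (prod_topology (top_of_set {0..1}) Y) \<rightarrow> standard_simplex n"
      using f(3) g(3) by (auto simp: H_def intro!: convex_standard_simplex)
  qed
  then show ?thesis
    unfolding homotopic_with_def by (intro exI[of _ H]) (auto simp: H_def)
qed

text \<open>Contracting to the point \<open>a\<close> makes \<open>z\<close> homologous to a cycle
  of a one-point space, where cycles of positive degree bound. Degree 0 is excluded by this argument
  and is treated separately when the prism chains are built.\<close>

lemma prism_model_acyclic:
  assumes "singular_chain (Suc m) (prism_model n) z" "chain_boundary (Suc m) z = 0"
  obtains x where "singular_chain (Suc (Suc m)) (prism_model n) x" "chain_boundary (Suc (Suc m)) x = z"
proof -
  let ?e = "\<lambda>j::nat. if j = 0 then 1 else 0 :: real"
  define a where "a = (0::real, ?e)"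
  have a: "a \<in> topspace (prism_model n)"
    by (auto simp: a_def)
  have cyc: "singular_relcycle (Suc m) (prism_model n) {} z"
    using assms by (simp add: singular_cycle)
  have "homologous_rel (Suc m) (prism_model n) {} (chain_map (Suc m) id z) (chain_map (Suc m) (\<lambda>_. a) z)"
    by (rule homotopic_imp_homologous_rel_chain_maps[OF _ cyc])
      (use a in \<open>auto intro!: prism_model_homotopic[THEN homotopic_with_mono]\<close>)
  moreover have "singular_relboundary (Suc m) (prism_model n) {} (chain_map (Suc m) (\<lambda>_. a) z)"
  proof -
    have "singular_relcycle (Suc m) (subtopology (prism_model n) {a}) {} (chain_map (Suc m) (\<lambda>_. a) z)"
      by (rule singular_relcycle_chain_map[OF cyc]) (use a in \<open>auto simp: continuous_map_in_subtopology\<close>)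
    then have "singular_relboundary (Suc m) (subtopology (prism_model n) {a}) {} (chain_map (Suc m) (\<lambda>_. a) z)"
      using a by (subst singular_boundary_eq_cycle_singleton[of _ a]) (auto simp: topspace_subtopology)
    then show ?thesis
      using singular_boundary_mono[of "{a}" UNIV] by auto
  qed
  ultimately have "singular_relboundary (Suc m) (prism_model n) {} (chain_map (Suc m) id z)"
    using singular_relboundary_add unfolding homologous_rel_def by fastforce
  then show thesis
    using that chain_map_ident[OF assms(1)] by (auto simp: singular_boundary)
qed

text \<open>Top minus bottom minus sides: the boundary that the prism chain in degree
  \<open>n\<close> must have, where \<open>y\<close> is the prism chain one degree lower.\<close>

definition prism_bd :: "nat \<Rightarrow> (real \<times> (nat \<Rightarrow> real)) chain \<Rightarrow> (real \<times> (nat \<Rightarrow> real)) chain"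
  where "prism_bd n y = chain_map n (Pair 1) (id_simplex n) - chain_map n (Pair 0) (id_simplex n)
    - prism_ext n y (chain_boundary n (id_simplex n))"

text \<open>Each prescribed boundary is a cycle because of the formula one degree lower, hence can
  be filled by acyclicity; dependent choice assembles the fillings.\<close>

lemma prism_chains_exist:
  obtains P where "\<And>n. singular_chain (Suc n) (prism_model n) (P n)"
    "\<And>n. chain_boundary (Suc n) (P n) = prism_bd n (P (n - 1))"
proof -
  \<comment> \<open>The invariant remembers that the boundary of \<open>x\<close> has the prescribed
    shape for some \<open>y\<close>. This is all that the next step needs from the earlier
    choices.\<close>
  let ?Q = "\<lambda>n x. singular_chain (Suc n) (prism_model n) x \<and>
    (\<exists>y. singular_chain n (prism_model (n - 1)) y \<and> chain_boundary (Suc n) x = prism_bd n y)"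
  have "\<exists>P. \<forall>n. ?Q n (P n) \<and> chain_boundary (Suc (Suc n)) (P (Suc n)) = prism_bd (Suc n) (P n)"
  proof (rule dependent_nat_choice)
    \<comment> \<open>Acyclicity says nothing in degree 0, so the two end points are joined
      directly, the inclusions of the ends being homotopic.\<close>
    have "homologous_rel 0 (prism_model 0) {} (chain_map 0 (Pair 1) (id_simplex 0)) (chain_map 0 (Pair 0) (id_simplex 0))"
      by (rule homotopic_imp_homologous_rel_chain_maps[where S="subtopology (powertop_real UNIV) (standard_simplex 0)"])
        (auto intro!: prism_model_homotopic[THEN homotopic_with_mono] continuous_map_prism_Pair
          simp: singular_cycle singular_chain_id_simplex chain_boundary_def)
    then obtain x where "singular_chain (Suc 0) (prism_model 0) x"
      "chain_boundary (Suc 0) x = chain_map 0 (Pair 1) (id_simplex 0) - chain_map 0 (Pair 0) (id_simplex 0)"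
      unfolding homologous_rel_def singular_boundary by blast
    then show "\<exists>x. ?Q 0 x"
      by (intro exI[of _ x]) (auto simp: prism_bd_def chain_boundary_def[of 0] intro!: exI[of _ 0])
  next
    fix x n assume "?Q n x"
    then obtain y where x: "singular_chain (Suc n) (prism_model n) x"
      and y: "singular_chain n (prism_model (n - 1)) y" and bx: "chain_boundary (Suc n) x = prism_bd n y"
      by blast
    let ?i = "id_simplex (Suc n)"
    let ?D = "\<lambda>n. subtopology (powertop_real UNIV) (standard_simplex n)"
    have i: "singular_chain (Suc n) (?D (Suc n)) ?i"
      by (rule singular_chain_id_simplex)
    have bi: "singular_chain n (?D (Suc n)) (chain_boundary (Suc n) ?i)"
      using singular_chain_boundary[OF i] by simp
    have bbi: "chain_boundary n (chain_boundary (Suc n) ?i) = 0"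
      using chain_boundary_boundary[OF i] by simp
    have z: "singular_chain (Suc n) (prism_model (Suc n)) (prism_bd (Suc n) x)"
      unfolding prism_bd_def
      by (intro singular_chain_diff singular_chain_chain_map[OF i] continuous_map_prism_Pair
          singular_chain_prism_ext[OF bi x]) auto
    \<comment> \<open>By naturality the prism formula holds for all chains of the model simplex; the
      case of interest is \<open>c\<close> the boundary of the identity simplex.\<close>
    have ext: "prism_ext n (prism_bd n y) c =
        chain_map n (Pair 1) c - chain_map n (Pair 0) c - prism_ext n y (chain_boundary n c)"
      if "singular_chain n (?D (Suc n)) c" for c
      using that unfolding singular_chain_def
    proof (induction c rule: frag_induction)
      case (one \<sigma>)
      then have \<sigma>: "singular_simplex n (?D (Suc n)) \<sigma>" by simp
      have "chain_map n (map_prod id \<sigma>) (prism_ext n y (chain_boundary n (id_simplex n))) =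
          prism_ext n y (chain_map (n - 1) \<sigma> (chain_boundary n (id_simplex n)))"
        using singular_chain_boundary[OF singular_chain_id_simplex] y by (intro prism_ext_prism_ext) simp_all
      also have "chain_map (n - 1) \<sigma> (chain_boundary n (id_simplex n)) = chain_boundary n (frag_of \<sigma>)"
        using chain_boundary_chain_map[OF singular_chain_id_simplex, of n \<sigma>] singular_simplex_chain_map_id[OF \<sigma>] by simp
      finally show ?case
        by (simp only: prism_ext_of prism_bd_def chain_map_diff chain_map_Pair_prism[OF \<sigma>])
    next
      case (diff a b)
      then show ?case by (simp add: prism_ext_diff chain_map_diff chain_boundary_diff)
    qed simp
    \<comment> \<open>Substituting \<open>ext\<close> cancels the two end terms and leaves a term in
      the boundary of a boundary.\<close>
    have "chain_boundary (Suc n) (prism_bd (Suc n) x) = chain_map n (Pair 1) (chain_boundary (Suc n) ?i)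
        - chain_map n (Pair 0) (chain_boundary (Suc n) ?i) - prism_ext n (prism_bd n y) (chain_boundary (Suc n) ?i)"
      unfolding prism_bd_def[of "Suc n"] chain_boundary_diff chain_boundary_prism_ext[OF x]
        chain_boundary_chain_map[OF i] bx by simp
    then have "chain_boundary (Suc n) (prism_bd (Suc n) x) = 0"
      by (simp only: ext[OF bi] bbi prism_ext_0) simp
    then obtain x' where "singular_chain (Suc (Suc n)) (prism_model (Suc n)) x'"
      "chain_boundary (Suc (Suc n)) x' = prism_bd (Suc n) x"
      using prism_model_acyclic[OF z] by blast
    then show "\<exists>y. ?Q (Suc n) y \<and> chain_boundary (Suc (Suc n)) y = prism_bd (Suc n) x"
      using x by auto
  qed
  then obtain P where P: "\<And>n. ?Q n (P n)" "\<And>n. chain_boundary (Suc (Suc n)) (P (Suc n)) = prism_bd (Suc n) (P n)"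
    by blast
  show thesis
  proof
    fix n show "chain_boundary (Suc n) (P n) = prism_bd n (P (n - 1))"
    proof (cases n)
      case 0
      \<comment> \<open>The sides of the prism over a point are empty, so the unknown
        \<open>y\<close> of the invariant may be replaced by \<open>P (0 - 1)\<close>, which is
        \<open>P 0\<close>.\<close>
      have "prism_bd 0 y = prism_bd 0 y'" for y y'
        by (simp add: prism_bd_def chain_boundary_def)
      then show ?thesis using P(1)[of 0] 0 by metis
    qed (use P(2) in simp)
  qed (use P in blast)
qed

definition prism_operator ::
    "(nat \<Rightarrow> (real \<times> (nat \<Rightarrow> real)) chain) \<Rightarrow> (real \<times> 'a \<Rightarrow> 'b) \<Rightarrow>
     ('a, 'r::{comm_ring,comm_monoid_mult}) chains \<Rightarrow> ('b, 'r) chains"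
  where "prism_operator P F = chain_extend (\<lambda>(n, \<sigma>). of_frag (Suc n) (chain_map (Suc n) (F \<circ> map_prod id \<sigma>) (P n)))"

lemma prism_operator_single:
  "prism_operator P F (Poly_Mapping.single (n, \<sigma>) 1) = of_frag (Suc n) (chain_map (Suc n) F (prism_ext (Suc n) (P n) (frag_of \<sigma>)))"
  by (simp add: prism_operator_def chain_map_compose)

lemma prism_operator_of_frag:
  "prism_operator P F (of_frag n c) = of_frag (Suc n) (chain_map (Suc n) F (prism_ext (Suc n) (P n) c))"
  unfolding prism_operator_def
  by (rule chain_extend_of_frag) (simp_all add: chain_map_compose prism_ext_diff chain_map_diff)

lemma chain_linear_prism_operator [simp, intro]: "chain_linear (prism_operator P F)"
  by (simp add: prism_operator_def)

text \<open>One operator serves all pairs of subspaces respected by the homotopy, so the same choice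
  handles a relative cycle and its boundary. The formula at chain level, and not just its effect on
  classes, is used later to construct relative cycles of the cylinder.\<close>

lemma homotopy_operator:
  fixes F :: "real \<times> 'a \<Rightarrow> 'b"
  assumes F: "continuous_map (prod_topology (top_of_set {0..1}) Y) Z F"
  obtains P :: "('a, 'r::{comm_ring,comm_monoid_mult}) chains \<Rightarrow> ('b, 'r) chains"
  where "chain_linear P"
    "\<And>c. c \<in> chains_of Y \<Longrightarrow> P c \<in> chains_of Z"
    "\<And>A C c. \<lbrakk>\<And>t x. \<lbrakk>0 \<le> t; t \<le> 1; x \<in> topspace Y; x \<in> A\<rbrakk> \<Longrightarrow> F (t, x) \<in> C; c \<in> chains_of (subtopology Y A)\<rbrakk>
      \<Longrightarrow> P c \<in> chains_of (subtopology Z C)"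
    "\<And>c. c \<in> chains_of Y \<Longrightarrow>
      boundary (P c) + P (boundary c) = push_chain (\<lambda>x. F (1, x)) c - push_chain (\<lambda>x. F (0, x)) c"
proof -
  obtain P where P: "\<And>n. singular_chain (Suc n) (prism_model n) (P n)"
    "\<And>n. chain_boundary (Suc n) (P n) = prism_bd n (P (n - 1))"
    using prism_chains_exist by blast
  let ?I = "top_of_set {0..1::real}"
  let ?P = "prism_operator P F :: ('a, 'r) chains \<Rightarrow> ('b, 'r) chains"
  \<comment> \<open>Both support statements are instances, for the whole spaces and for the
    subspaces \<open>A\<close> and \<open>C\<close>.\<close>
  have closed: "?P c \<in> chains_of Z'" if "c \<in> chains_of Y'" "continuous_map (prod_topology ?I Y') Z' F"
    for Y' Z' and c :: "('a, 'r) chains"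
  proof (rule chain_linear_closed[OF chain_linear_prism_operator that(1)])
    fix n \<sigma> assume "singular_simplex n Y' \<sigma>"
    then have "singular_chain (Suc n) (prod_topology ?I Y') (prism_ext (Suc n) (P n) (frag_of \<sigma>))"
      by (intro singular_chain_prism_ext[OF _ P(1)]) (simp add: singular_chain_of)
    then show "?P (Poly_Mapping.single (n, \<sigma>) 1) \<in> chains_of Z'"
      unfolding prism_operator_single by (intro of_frag_in_chains_of singular_chain_chain_map[OF _ that(2)])
  qed
  show thesis
  proof
    show "chain_linear ?P" by simp
    show "?P c \<in> chains_of Z" if "c \<in> chains_of Y" for c
      by (rule closed[OF that F])
    show "?P c \<in> chains_of (subtopology Z C)"
      if "\<And>t x. \<lbrakk>0 \<le> t; t \<le> 1; x \<in> topspace Y; x \<in> A\<rbrakk> \<Longrightarrow> F (t, x) \<in> C" "c \<in> chains_of (subtopology Y A)" for A C c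
    proof (rule closed[OF that(2)])
      have "continuous_map (subtopology (prod_topology ?I Y) (UNIV \<times> A)) Z F"
        by (rule continuous_map_from_subtopology[OF F])
      then have "continuous_map (prod_topology ?I (subtopology Y A)) Z F"
        by (simp add: subtopology_Times)
      then show "continuous_map (prod_topology ?I (subtopology Y A)) (subtopology Z C) F"
        using that(1) by (auto simp: continuous_map_in_subtopology)
    qed
    fix c :: "('a, 'r) chains" assume c: "c \<in> chains_of Y"
    show "boundary (?P c) + ?P (boundary c) = push_chain (\<lambda>x. F (1, x)) c - push_chain (\<lambda>x. F (0, x)) c"
    proof (rule chain_linear_eqI[OF chain_linear_plus[OF chain_linear_compose[OF chain_linear_boundary chain_linear_prism_operator]
            chain_linear_compose[OF chain_linear_prism_operator chain_linear_boundary]]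
          chain_linear_minus[OF chain_linear_push chain_linear_push] c])
      fix n \<sigma> assume \<sigma>: "singular_simplex n Y \<sigma>"
      let ?s = "Poly_Mapping.single (n, \<sigma>) (1::'r)"
      have 1: "chain_boundary (Suc n) (chain_map (Suc n) F (prism_ext (Suc n) (P n) (frag_of \<sigma>))) =
          chain_map n F (prism_ext n (prism_bd n (P (n - 1))) (frag_of \<sigma>))"
        using chain_boundary_chain_map[OF singular_chain_prism_ext[OF _ P(1)], of n Y "frag_of \<sigma>" F] \<sigma>
        by (simp add: singular_chain_of chain_boundary_prism_ext[OF P(1)] P(2) del: prism_ext_of)
      have 2: "chain_map n (map_prod id \<sigma>) (prism_ext n y (chain_boundary n (id_simplex n))) =
          prism_ext n y (chain_boundary n (frag_of \<sigma>))" if "singular_chain n (prism_model (n - 1)) y" for y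
      proof -
        have "chain_map n (map_prod id \<sigma>) (prism_ext n y (chain_boundary n (id_simplex n))) =
            prism_ext n y (chain_map (n - 1) \<sigma> (chain_boundary n (id_simplex n)))"
          using singular_chain_boundary[OF singular_chain_id_simplex] that by (intro prism_ext_prism_ext) simp_all
        also have "chain_map (n - 1) \<sigma> (chain_boundary n (id_simplex n)) = chain_boundary n (frag_of \<sigma>)"
          using chain_boundary_chain_map[OF singular_chain_id_simplex, of n \<sigma>] singular_simplex_chain_map_id[OF \<sigma>] by simp
        finally show ?thesis .
      qed
      have 3: "chain_map n F (chain_map n (Pair t) (frag_of \<sigma>)) = frag_of (simplex_map n (\<lambda>x. F (t, x)) \<sigma>)" for t
      proof -
        have "simplex_map n F (simplex_map n (Pair t) \<sigma>) = simplex_map n (\<lambda>x. F (t, x)) \<sigma>"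
          by (auto simp: simplex_map_def)
        then show ?thesis by simp
      qed
      show "boundary (?P ?s) + ?P (boundary ?s) = push_chain (\<lambda>x. F (1, x)) ?s - push_chain (\<lambda>x. F (0, x)) ?s"
      \<comment> \<open>The degrees of the two terms on the left match through
        \<open>Suc (n - 1) = n\<close>, which fails for \<open>n = 0\<close>; there the term with
        the boundary of \<sigma> vanishes.\<close>
      proof (cases n)
        case 0
        then have "chain_map n F (prism_ext n (prism_bd n (P (n - 1))) (frag_of \<sigma>)) =
            frag_of (simplex_map n (\<lambda>x. F (1, x)) \<sigma>) - frag_of (simplex_map n (\<lambda>x. F (0, x)) \<sigma>)"
          unfolding prism_ext_of prism_bd_def chain_map_diff chain_map_Pair_prism[OF \<sigma>] 3
          by (simp add: chain_boundary_def)
        then show ?thesis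
          using 1 0 by (simp add: prism_operator_single boundary_of_frag boundary_single prism_operator_of_frag push_single
              of_frag_diff chain_boundary_def[of 0]
              chain_linear_0[OF chain_linear_prism_operator] del: prism_ext_of)
      next
        case (Suc m)
        then have P': "singular_chain n (prism_model (n - 1)) (P (n - 1))"
          using P(1)[of m] by simp
        have "chain_map n F (prism_ext n (prism_bd n (P (n - 1))) (frag_of \<sigma>)) =
            frag_of (simplex_map n (\<lambda>x. F (1, x)) \<sigma>) - frag_of (simplex_map n (\<lambda>x. F (0, x)) \<sigma>)
            - chain_map n F (prism_ext n (P (n - 1)) (chain_boundary n (frag_of \<sigma>)))"
          unfolding prism_ext_of prism_bd_def chain_map_diff chain_map_Pair_prism[OF \<sigma>] 3 2[OF P'] ..
        then show ?thesis
          using 1 Suc by (simp add: prism_operator_single boundary_of_frag boundary_single prism_operator_of_frag push_single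
              of_frag_diff del: prism_ext_of)
      qed
    qed
  qed
qed

text \<open>The term \<open>P (boundary c)\<close> lies in \<open>C\<close>, as the homotopy keeps
  \<open>B\<close> inside \<open>C\<close>, and is absorbed by the relative boundary.\<close>

lemma homotopic_rel_cycles:
  fixes c :: "('a, 'r::{comm_ring,comm_monoid_mult}) chains" and F :: "real \<times> 'a \<Rightarrow> 'b"
  assumes F: "continuous_map (prod_topology (top_of_set {0..1}) Y) Z F"
    and BC: "\<And>t x. \<lbrakk>0 \<le> t; t \<le> 1; x \<in> topspace Y; x \<in> B\<rbrakk> \<Longrightarrow> F (t, x) \<in> C"
    and c: "c \<in> rel_cycles Y B"
    and fg: "\<And>x. x \<in> topspace Y \<Longrightarrow> F (0, x) = f x" "\<And>x. x \<in> topspace Y \<Longrightarrow> F (1, x) = g x"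
  shows "push_chain g c - push_chain f c \<in> rel_boundaries Z C"
proof -
  have cY: "c \<in> chains_of Y" and cB: "boundary c \<in> chains_of (subtopology Y B)"
    using c by (auto simp: rel_cycles_def)
  obtain P :: "('a, 'r) chains \<Rightarrow> ('b, 'r) chains" where P: "P c \<in> chains_of Z"
    "P (boundary c) \<in> chains_of (subtopology Z C)"
    "boundary (P c) + P (boundary c) = push_chain (\<lambda>x. F (1, x)) c - push_chain (\<lambda>x. F (0, x)) c"
    by (rule homotopy_operator[OF F]) (use cY cB BC in blast)
  show ?thesis
    by (rule rel_boundariesI[OF P(1,2)])
      (use P(3) push_cong[OF cY, of "\<lambda>x. F (0, x)" f] push_cong[OF cY, of "\<lambda>x. F (1, x)" g] fg in simp)
qed

lemma induced_map_iso_homotopy_equivalence: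
  assumes f: "pair_map Y B Z C f" and g: "pair_map Z C Y B g"
    and F: "continuous_map (prod_topology (top_of_set {0..1::real}) Y) Y F"
      "\<And>t x. \<lbrakk>0 \<le> t; t \<le> 1; x \<in> topspace Y; x \<in> B\<rbrakk> \<Longrightarrow> F (t, x) \<in> B"
      "\<And>x. x \<in> topspace Y \<Longrightarrow> F (0, x) = x" "\<And>x. x \<in> topspace Y \<Longrightarrow> F (1, x) = g (f x)"
    and G: "continuous_map (prod_topology (top_of_set {0..1::real}) Z) Z G"
      "\<And>t x. \<lbrakk>0 \<le> t; t \<le> 1; x \<in> topspace Z; x \<in> C\<rbrakk> \<Longrightarrow> G (t, x) \<in> C"
      "\<And>x. x \<in> topspace Z \<Longrightarrow> G (0, x) = x" "\<And>x. x \<in> topspace Z \<Longrightarrow> G (1, x) = f (g x)"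
  shows "induced_map Z C f \<in> iso (rel_homology R Y B) (rel_homology R Z C)"
proof (rule rel_homology_isoI[OF induced_map_class[OF f] push_rel_cycles[OF f] push_add])
  fix c assume c: "c \<in> rel_cycles Y B" and fc: "push_chain f c \<in> rel_boundaries Z C"
  have "push_chain (g \<circ> f) c - push_chain (\<lambda>x. x) c \<in> rel_boundaries Y B"
    by (rule homotopic_rel_cycles[OF F(1) _ c]) (use F in auto)
  moreover have "push_chain (g \<circ> f) c \<in> rel_boundaries Y B"
    using push_rel_boundaries[OF g fc] by (simp add: push_push)
  moreover have "push_chain (\<lambda>x. x) c = c"
    using c by (auto simp: rel_cycles_def intro: push_id)
  ultimately show "c \<in> rel_boundaries Y B"
    using rel_boundaries_diff by fastforce
next
  fix d assume d: "d \<in> rel_cycles Z C"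
  have "push_chain (f \<circ> g) d - push_chain (\<lambda>x. x) d \<in> rel_boundaries Z C"
    by (rule homotopic_rel_cycles[OF G(1) _ d]) (use G in auto)
  moreover have "push_chain (\<lambda>x. x) d = d"
    using d by (auto simp: rel_cycles_def intro: push_id)
  ultimately show "\<exists>c\<in>rel_cycles Y B. push_chain f c - d \<in> rel_boundaries Z C"
    using push_rel_cycles[OF g d] by (auto simp: push_push intro!: bexI[of _ "push_chain g d"])
qed

section \<open>Subdivision and excision\<close>

text \<open>\<open>S\<close> is an iterated barycentric subdivision and \<open>D\<close> its chain
  homotopy to the identity. Smallness is claimed for the given \<open>c\<close> only, while the
  support statements and the homotopy formula hold for all chains, since the excision argument also
  applies them to boundaries.\<close>

lemma small_chains:
  fixes Y :: "'a topology" and c :: "('a, 'r::{comm_ring,comm_monoid_mult}) chains"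
  assumes "\<And>U. U \<in> \<C> \<Longrightarrow> openin Y U" "topspace Y \<subseteq> \<Union>\<C>" "c \<in> chains_of Y"
  obtains S D :: "('a, 'r) chains \<Rightarrow> ('a, 'r) chains"
  where "chain_linear S" "chain_linear D"
    "\<And>A d. d \<in> chains_of (subtopology Y A) \<Longrightarrow> S d \<in> chains_of (subtopology Y A)"
    "\<And>A d. d \<in> chains_of (subtopology Y A) \<Longrightarrow> D d \<in> chains_of (subtopology Y A)"
    "\<And>d. d \<in> chains_of Y \<Longrightarrow> boundary (D d) + D (boundary d) = S d - d"
    "\<And>n \<sigma>. (n, \<sigma>) \<in> Poly_Mapping.keys (S c) \<Longrightarrow> \<exists>V\<in>\<C>. \<sigma> ` standard_simplex n \<subseteq> V"
proof -
  let ?sd = "\<lambda>m n c. (singular_subdivision n ^^ m) c"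
  have "\<exists>k. \<forall>m\<ge>k. \<forall>f\<in>Poly_Mapping.keys (?sd m (fst s) (frag_of (snd s))). \<exists>V\<in>\<C>. f \<in> standard_simplex (fst s) \<rightarrow> V"
    if "s \<in> Poly_Mapping.keys c" for s
  proof -
    have "singular_chain (fst s) Y (frag_of (snd s))"
      using that assms(3) by (cases s) (auto simp: chains_of_iff singular_chain_of)
    then obtain k where "\<And>m f. \<lbrakk>k \<le> m; f \<in> Poly_Mapping.keys (?sd m (fst s) (frag_of (snd s)))\<rbrakk>
        \<Longrightarrow> \<exists>V\<in>\<C>. f \<in> standard_simplex (fst s) \<rightarrow> V"
      using sufficient_iterated_singular_subdivision_exists[OF assms(1,2)] by metis
    then show ?thesis by blast
  qed
  then obtain k where k: "\<And>s m f. \<lbrakk>s \<in> Poly_Mapping.keys c; m \<ge> k s; f \<in> Poly_Mapping.keys (?sd m (fst s) (frag_of (snd s)))\<rbrakk>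
      \<Longrightarrow> \<exists>V\<in>\<C>. f \<in> standard_simplex (fst s) \<rightarrow> V"
    by metis
  \<comment> \<open>A common number of subdivisions for all simplices of \<open>c\<close>: the sum
    dominates each \<open>k s\<close>.\<close>
  define m where "m = (\<Sum>s\<in>Poly_Mapping.keys c. k s)"
  have km: "k s \<le> m" if "s \<in> Poly_Mapping.keys c" for s
    unfolding m_def by (rule member_le_sum) (use that in auto)
  obtain h where h: "\<And>p. h p 0 = (0 :: 'a chain)"
    "\<And>p c1 c2. h p (c1-c2) = h p c1 - h p c2"
    "\<And>p X c. singular_chain p X c \<Longrightarrow> singular_chain (Suc p) X (h p c)"
    "\<And>p X c. singular_chain p X c
       \<Longrightarrow> chain_boundary (Suc p) (h p c) + h (p - Suc 0) (chain_boundary p c) = ?sd m p c - c"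
    using chain_homotopic_iterated_singular_subdivision[of m] by metis
  define S :: "('a, 'r) chains \<Rightarrow> ('a, 'r) chains"
    where "S = chain_extend (\<lambda>(n, \<sigma>). of_frag n (?sd m n (frag_of \<sigma>)))"
  define D :: "('a, 'r) chains \<Rightarrow> ('a, 'r) chains"
    where "D = chain_extend (\<lambda>(n, \<sigma>). of_frag (Suc n) (h n (frag_of \<sigma>)))"
  have lin: "chain_linear S" "chain_linear D"
    by (simp_all add: S_def D_def)
  have D_of_frag: "D (of_frag n c) = of_frag (Suc n) (h n c)" for n c
    unfolding D_def by (rule chain_extend_of_frag) (auto simp: h)
  have sd: "singular_chain n X (?sd j n c)" if "singular_chain n X c" for X :: "'a topology" and n c j
    using that by (induction j) (auto intro: singular_chain_singular_subdivision)
  show thesis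
  proof (rule that[OF lin])
    fix A and d :: "('a, 'r) chains" assume "d \<in> chains_of (subtopology Y A)"
    note closed = chain_linear_closed[OF _ this]
    show "S d \<in> chains_of (subtopology Y A)"
    proof (rule closed[OF lin(1)])
      fix n \<sigma> assume "singular_simplex n (subtopology Y A) \<sigma>"
      then have "singular_chain n (subtopology Y A) (?sd m n (frag_of \<sigma>))"
        by (intro sd) (simp add: singular_chain_of)
      then show "S (Poly_Mapping.single (n, \<sigma>) 1) \<in> chains_of (subtopology Y A)"
        by (simp add: S_def of_frag_in_chains_of)
    qed
    show "D d \<in> chains_of (subtopology Y A)"
    proof (rule closed[OF lin(2)])
      fix n \<sigma> assume "singular_simplex n (subtopology Y A) \<sigma>"
      then have "singular_chain (Suc n) (subtopology Y A) (h n (frag_of \<sigma>))"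
        by (intro h(3)) (simp add: singular_chain_of)
      then show "D (Poly_Mapping.single (n, \<sigma>) 1) \<in> chains_of (subtopology Y A)"
        by (simp add: D_def of_frag_in_chains_of)
    qed
  next
    fix d :: "('a, 'r) chains" assume "d \<in> chains_of Y"
    then show "boundary (D d) + D (boundary d) = S d - d"
    proof (rule chain_linear_eqI[rotated 2])
      fix n \<sigma> assume \<sigma>: "singular_simplex n Y \<sigma>"
      have "boundary (D (Poly_Mapping.single (n, \<sigma>) 1)) + D (boundary (Poly_Mapping.single (n, \<sigma>) 1)) =
          of_frag n (chain_boundary (Suc n) (h n (frag_of \<sigma>)) + h (n - Suc 0) (chain_boundary n (frag_of \<sigma>)))"
      proof (cases n)
        case 0
        then show ?thesis
          by (simp add: boundary_single D_of_frag of_frag_add) (simp add: D_def boundary_of_frag chain_boundary_def h)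
      next
        case (Suc m)
        then show ?thesis
          by (simp add: boundary_single D_of_frag of_frag_add) (simp add: D_def boundary_of_frag)
      qed
      also have "\<dots> = S (Poly_Mapping.single (n, \<sigma>) 1) - Poly_Mapping.single (n, \<sigma>) 1"
        using \<sigma> by (simp add: h(4)[of n Y] singular_chain_of of_frag_diff S_def)
      finally show "boundary (D (Poly_Mapping.single (n, \<sigma>) 1)) + D (boundary (Poly_Mapping.single (n, \<sigma>) 1)) =
        S (Poly_Mapping.single (n, \<sigma>) 1) - Poly_Mapping.single (n, \<sigma>) 1" .
    qed (rule chain_linear_plus[OF chain_linear_compose[OF chain_linear_boundary lin(2)] chain_linear_compose[OF lin(2) chain_linear_boundary]]
        chain_linear_minus[OF lin(1) chain_linear_id(2)])+
  next
    \<comment> \<open>Cancellation can only remove simplices: a nonzero coefficient of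
      \<open>S c\<close> comes from the subdivision of some key of \<open>c\<close>.\<close>
    fix n \<sigma> assume "(n, \<sigma>) \<in> Poly_Mapping.keys (S c)"
    then have "Poly_Mapping.lookup (S c) (n, \<sigma>) \<noteq> 0"
      by (simp add: in_keys_iff)
    moreover have "Poly_Mapping.lookup (S c) (n, \<sigma>) = (\<Sum>s\<in>Poly_Mapping.keys c. Poly_Mapping.lookup c s *
        Poly_Mapping.lookup (of_frag (fst s) (?sd m (fst s) (frag_of (snd s)))) (n, \<sigma>))"
      by (simp add: S_def chain_extend_eq lookup_sum split_def)
    ultimately obtain s where s: "s \<in> Poly_Mapping.keys c"
      "Poly_Mapping.lookup (of_frag (fst s) (?sd m (fst s) (frag_of (snd s))) :: ('a, 'r) chains) (n, \<sigma>) \<noteq> 0"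
      by (metis (no_types, lifting) mult_zero_right sum.not_neutral_contains_not_neutral)
    then obtain f where f: "f \<in> Poly_Mapping.keys (?sd m (fst s) (frag_of (snd s)))"
      "Poly_Mapping.lookup (Poly_Mapping.single (fst s, f) (unit_mult (Poly_Mapping.lookup (?sd m (fst s) (frag_of (snd s))) f)) :: ('a, 'r) chains) (n, \<sigma>) \<noteq> 0"
      unfolding of_frag_def lookup_sum by (elim sum.not_neutral_contains_not_neutral) blast
    then have "fst s = n" "f = \<sigma>"
      by (auto simp: lookup_single when_def split: if_splits)
    then show "\<exists>V\<in>\<C>. \<sigma> ` standard_simplex n \<subseteq> V"
      using k[OF s(1) km[OF s(1)] f(1)] by (simp add: image_subset_iff_funcset)
  qed
qed

text \<open>The complement of \<open>K\<close> and the interior of \<open>W\<close> cover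
  \<open>Y\<close> by open sets, so a subdivided chain is the sum of a chain off \<open>K\<close>
  and a chain in \<open>W\<close>.\<close>

lemma induced_map_iso_excision:
  assumes W: "W \<subseteq> topspace Y" and K: "closedin Y K" "K \<subseteq> Y interior_of W"
  shows "induced_map Y W id \<in> iso (rel_homology R (subtopology Y (topspace Y - K)) (W - K)) (rel_homology R Y W)"
proof -
  let ?Z = "subtopology Y (topspace Y - K)"
  have p: "pair_map ?Z (W - K) Y W id"
    by (auto simp: pair_map_def)
  have ZW: "subtopology ?Z (W - K) = subtopology Y (W - K)"
    using W by (simp add: subtopology_subtopology Int_absorb1 Diff_mono)
  have cover: "openin Y U" if "U \<in> {topspace Y - K, Y interior_of W}" for U
    using that K(1) by auto
  have cover': "topspace Y \<subseteq> \<Union>{topspace Y - K, Y interior_of W}"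
    using K(2) by auto
  have int: "Y interior_of W \<subseteq> W" by (rule interior_of_subset)
  have push_id': "push_chain id c = c" if "c \<in> chains_of Y" for c
    using that by (rule push_id) simp
  have split: thesis
    if c: "c \<in> chains_of Y" and
      small: "\<And>n \<sigma>. (n, \<sigma>) \<in> Poly_Mapping.keys c \<Longrightarrow> \<exists>V\<in>{topspace Y - K, Y interior_of W}. \<sigma> ` standard_simplex n \<subseteq> V"
      and *: "\<And>c1 c2. \<lbrakk>c1 \<in> chains_of ?Z; c2 \<in> chains_of (subtopology Y W); c = c1 + c2\<rbrakk> \<Longrightarrow> thesis" for c thesis
  proof (rule chains_of_split[of c ?Z "subtopology Y W"])
    fix n \<sigma> assume "(n, \<sigma>) \<in> Poly_Mapping.keys c"
    then show "singular_simplex n ?Z \<sigma> \<or> singular_simplex n (subtopology Y W) \<sigma>"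
      using small c int by (fastforce simp: singular_simplex_subtopology chains_of_iff)
  qed (use * in blast)
  \<comment> \<open>Membership in the excised subspace is always obtained from two separate
    descriptions of the same chain.\<close>
  have WK: "b \<in> chains_of (subtopology Y (W - K))" if "b \<in> chains_of ?Z" "b \<in> chains_of (subtopology Y W)" for b
    using that unfolding chains_of_subtopology by blast
  show ?thesis
  proof (rule rel_homology_isoI[OF induced_map_class[OF p] push_rel_cycles[OF p] push_add])
    fix c assume c: "c \<in> rel_cycles ?Z (W - K)" and b: "push_chain id c \<in> rel_boundaries Y W"
    have cZ: "c \<in> chains_of ?Z" using c by (simp add: rel_cycles_def)
    then have cY: "c \<in> chains_of Y" by (rule chains_of_subtopology_subset)
    have bc: "boundary c \<in> chains_of (subtopology Y (W - K))"
      using c by (simp add: rel_cycles_def ZW)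
    obtain d w where d: "d \<in> chains_of Y" "w \<in> chains_of (subtopology Y W)" "c = boundary d + w"
      using b push_id'[OF cY] by (auto elim: rel_boundariesE)
    obtain S D where SD: "chain_linear S" "chain_linear D"
      "\<And>A d. d \<in> chains_of (subtopology Y A) \<Longrightarrow> S d \<in> chains_of (subtopology Y A)"
      "\<And>A d. d \<in> chains_of (subtopology Y A) \<Longrightarrow> D d \<in> chains_of (subtopology Y A)"
      "\<And>d. d \<in> chains_of Y \<Longrightarrow> boundary (D d) + D (boundary d) = S d - d"
      "\<And>n \<sigma>. (n, \<sigma>) \<in> Poly_Mapping.keys (S d) \<Longrightarrow> \<exists>V\<in>{topspace Y - K, Y interior_of W}. \<sigma> ` standard_simplex n \<subseteq> V"
      using small_chains[OF cover cover' d(1)] by metis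
    have SdY: "S d \<in> chains_of Y" using SD(3)[of d "topspace Y"] d(1) by simp
    obtain d1 d2 where dd: "d1 \<in> chains_of ?Z" "d2 \<in> chains_of (subtopology Y W)" "S d = d1 + d2"
      using split[OF SdY SD(6)] by metis
    have bw: "boundary w = boundary c"
      using d by (simp add: boundary_add boundary_boundary)
    \<comment> \<open>That subdivision commutes with the boundary follows from the homotopy formula
      applied to \<open>d\<close> and to its boundary.\<close>
    have comm: "boundary (S d) = S (boundary d)"
    proof -
      have "boundary (boundary (D d)) + boundary (D (boundary d)) = boundary (S d) - boundary d"
        using SD(5)[OF d(1)] by (simp flip: boundary_add boundary_diff)
      moreover have "boundary (boundary (D d)) = 0"
        using SD(4)[of d "topspace Y"] d(1) by (intro boundary_boundary) auto
      moreover have "boundary (D (boundary d)) = S (boundary d) - boundary d"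
        using SD(5)[OF boundary_in_chains_of[OF d(1)]] by (simp add: boundary_boundary[OF d(1)] chain_linear_0[OF SD(2)])
      ultimately show ?thesis by simp
    qed
    \<comment> \<open>The remainder of \<open>c\<close> after removing a boundary formed off
      \<open>K\<close>. Its definition places it in \<open>W\<close>; being a difference of
      \<open>c\<close> and that boundary, it also avoids \<open>K\<close>.\<close>
    define e where "e = boundary d2 + S w - D (boundary c)"
    have "S c = boundary d1 + boundary d2 + S w"
      using d(3) dd(3) comm by (simp add: chain_linear_add[OF SD(1)] flip: boundary_add)
    then have ce: "c = boundary (d1 - D c) + e"
      using SD(5)[OF cY] by (simp add: e_def boundary_diff algebra_simps)
    have DcZ: "D c \<in> chains_of ?Z" by (rule SD(4)[OF cZ])
    have "e \<in> chains_of ?Z"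
    proof -
      have "e = c - boundary (d1 - D c)" by (subst ce) simp
      then show ?thesis
        using cZ dd(1) DcZ by (simp add: chains_of_diff boundary_in_chains_of)
    qed
    moreover have "e \<in> chains_of (subtopology Y W)"
      unfolding e_def
      by (intro chains_of_add chains_of_diff boundary_in_chains_of SD dd d chains_of_subtopology_mono[OF bc]) auto
    ultimately show "c \<in> rel_boundaries ?Z (W - K)"
      using ce dd(1) DcZ by (intro rel_boundariesI[of "d1 - D c" _ e]) (auto simp: ZW intro: chains_of_diff WK)
  next
    fix c assume c: "c \<in> rel_cycles Y W"
    then have cY: "c \<in> chains_of Y" and bc: "boundary c \<in> chains_of (subtopology Y W)"
      by (auto simp: rel_cycles_def)
    obtain S D where SD: "chain_linear S" "chain_linear D"
      "\<And>A d. d \<in> chains_of (subtopology Y A) \<Longrightarrow> S d \<in> chains_of (subtopology Y A)"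
      "\<And>A d. d \<in> chains_of (subtopology Y A) \<Longrightarrow> D d \<in> chains_of (subtopology Y A)"
      "\<And>d. d \<in> chains_of Y \<Longrightarrow> boundary (D d) + D (boundary d) = S d - d"
      "\<And>n \<sigma>. (n, \<sigma>) \<in> Poly_Mapping.keys (S c) \<Longrightarrow> \<exists>V\<in>{topspace Y - K, Y interior_of W}. \<sigma> ` standard_simplex n \<subseteq> V"
      using small_chains[OF cover cover' cY] by metis
    have ScY: "S c \<in> chains_of Y" using SD(3)[of c "topspace Y"] cY by simp
    obtain c1 c2 where cc: "c1 \<in> chains_of ?Z" "c2 \<in> chains_of (subtopology Y W)" "S c = c1 + c2"
      using split[OF ScY SD(6)] by metis
    have DcY: "D c \<in> chains_of Y" using SD(4)[of c "topspace Y"] cY by simp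
    \<comment> \<open>The part of \<open>S c\<close> off \<open>K\<close> represents the class of
      \<open>c\<close>: it differs from \<open>c\<close> by a boundary and a chain in
      \<open>W\<close>.\<close>
    have eq: "c1 = c + boundary (D c) + (D (boundary c) - c2)"
      using SD(5)[OF cY] cc(3) by (simp add: algebra_simps)
    have w: "D (boundary c) - c2 \<in> chains_of (subtopology Y W)"
      by (intro chains_of_diff SD(4) bc cc(2))
    have "boundary c1 = boundary c + boundary (D (boundary c) - c2)"
      by (subst eq) (simp add: boundary_add boundary_boundary[OF DcY])
    then have "boundary c1 \<in> chains_of (subtopology Y W)"
      using bc w by (simp add: chains_of_add boundary_in_chains_of)
    then have "c1 \<in> rel_cycles ?Z (W - K)"
      using cc(1) WK[OF boundary_in_chains_of[OF cc(1)]] by (simp add: rel_cycles_def ZW)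
    moreover have "push_chain id c1 - c \<in> rel_boundaries Y W"
      using chains_of_subtopology_subset[OF cc(1)] eq
      by (intro rel_boundariesI[OF DcY w]) (simp add: push_id')
    ultimately show "\<exists>d\<in>rel_cycles ?Z (W - K). push_chain id d - c \<in> rel_boundaries Y W"
      by blast
  qed
qed

section \<open>Cup and cap products\<close>

subsection \<open>Faces of simplices\<close>

text \<open>The inclusion of the standard simplex as the face spanned by the last vertices;
  \<open>back_face\<close> is restriction along it.\<close>

definition simplex_shift :: "nat \<Rightarrow> (nat \<Rightarrow> real) \<Rightarrow> nat \<Rightarrow> real"
  where "simplex_shift d x = (\<lambda>i. if i < d then 0 else x (i - d))"

lemma simplex_shift_in_standard_simplex:
  assumes "x \<in> standard_simplex k" shows "simplex_shift d x \<in> standard_simplex (d + k)"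
proof -
  have "(\<Sum>i\<le>d + k. simplex_shift d x i) = (\<Sum>i\<in>{d..d + k}. x (i - d))"
    by (rule sum.mono_neutral_cong_right) (auto simp: simplex_shift_def)
  also have "\<dots> = (\<Sum>i\<le>k. x i)"
    by (rule sum.reindex_bij_witness[of _ "\<lambda>i. i + d" "\<lambda>i. i - d"]) auto
  finally show ?thesis
    using assms by (auto simp: standard_simplex_def simplex_shift_def)
qed

lemma continuous_map_simplex_shift:
  "continuous_map (subtopology (powertop_real UNIV) (standard_simplex k)) (subtopology (powertop_real UNIV) (standard_simplex (d + k))) (simplex_shift d)"
proof -
  have "continuous_map (subtopology (powertop_real UNIV) (standard_simplex k)) euclideanreal (\<lambda>x. simplex_shift d x i)" for i
    by (cases "i < d") (auto simp: simplex_shift_def intro: continuous_map_from_subtopology continuous_map_product_projection)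
  then show ?thesis
    by (auto simp: continuous_map_in_subtopology continuous_map_componentwise_UNIV simplex_shift_in_standard_simplex)
qed

lemma back_face_eq:
  "k \<le> n \<Longrightarrow> back_face n k \<sigma> = restrict (\<sigma> \<circ> simplex_shift (n - k)) (standard_simplex k)"
  by (simp add: back_face_def o_def simplex_shift_def)

lemma singular_simplex_front_face:
  assumes "singular_simplex n Y \<sigma>" "p \<le> n" shows "singular_simplex p Y (front_face p \<sigma>)"
proof -
  have "continuous_map (subtopology (subtopology (powertop_real UNIV) (standard_simplex n)) (standard_simplex p)) Y \<sigma>"
    using assms by (auto simp: singular_simplex_def intro: continuous_map_from_subtopology)
  then have "continuous_map (subtopology (powertop_real UNIV) (standard_simplex p)) Y \<sigma>"
    using standard_simplex_mono[OF assms(2)] by (simp add: subtopology_subtopology Int_absorb1)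
  then show ?thesis
    by (simp add: singular_simplex_def front_face_def)
qed

lemma singular_simplex_back_face:
  assumes "singular_simplex n Y \<sigma>" "k \<le> n" shows "singular_simplex k Y (back_face n k \<sigma>)"
  using assms continuous_map_compose[OF continuous_map_simplex_shift[of k "n - k"], of Y \<sigma>]
  by (simp add: singular_simplex_def back_face_eq)

lemma simplex_shift_shift: "simplex_shift a (simplex_shift b x) = simplex_shift (a + b) x"
  by (auto simp: fun_eq_iff simplex_shift_def)

lemma front_face_front_face: "p \<le> q \<Longrightarrow> front_face p (front_face q \<sigma>) = front_face p \<sigma>"
  using standard_simplex_mono[of p q] by (auto simp: front_face_def Int_absorb1 intro!: restrict_ext)

lemma back_face_back_face:
  assumes "j \<le> k" "k \<le> n" shows "back_face k j (back_face n k \<sigma>) = back_face n j \<sigma>"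
proof -
  have "n - k + (k - j) = n - j" using assms by simp
  then show ?thesis
    using assms simplex_shift_in_standard_simplex[of _ j "k - j"]
    by (auto simp: back_face_eq simplex_shift_shift Int_absorb1 intro!: restrict_ext)
qed

text \<open>The middle part of a simplex can be cut out in either order, which is what associativity
  of cap and cup products rests on.\<close>

lemma back_face_front_face:
  assumes "i \<le> k" "k \<le> n"
  shows "front_face i (back_face n k \<sigma>) = back_face (n - k + i) i (front_face (n - k + i) \<sigma>)"
  using assms simplex_shift_in_standard_simplex[of _ i "n - k"] standard_simplex_mono[of i k]
  by (auto simp: back_face_eq front_face_def Int_absorb1 intro!: restrict_ext)

lemma front_face_self: "singular_simplex n Y \<sigma> \<Longrightarrow> front_face n \<sigma> = \<sigma>"
  by (simp add: front_face_def singular_simplex_def extensional_restrict)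

lemma back_face_0_self: "singular_simplex n Y \<sigma> \<Longrightarrow> back_face n n \<sigma> = \<sigma>"
  by (simp add: back_face_eq singular_simplex_def extensional_restrict simplex_shift_def o_def)

section \<open>Front and back parts of the faces of a simplex\<close>

lemma simplical_face_in:
  "\<lbrakk>i \<le> Suc p; x \<in> standard_simplex p\<rbrakk> \<Longrightarrow> simplical_face i x \<in> standard_simplex (Suc p)"
  using simplical_face_in_standard_simplex[of "Suc p" i x] by simp

lemma front_face_singular_face_le:
  assumes "i \<le> m" "m \<le> p"
  shows "front_face m (singular_face (Suc p) i \<sigma>) = singular_face (Suc m) i (front_face (Suc m) \<sigma>)"
  using assms standard_simplex_mono[of m p] simplical_face_in[of i m]
  by (auto simp: front_face_def singular_face_def Int_absorb1 intro!: restrict_ext)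

lemma front_face_singular_face_gt:
  assumes "m < i" "i \<le> Suc p" "m \<le> p"
  shows "front_face m (singular_face (Suc p) i \<sigma>) = front_face m \<sigma>"
proof -
  have "simplical_face i x = x" if "x \<in> standard_simplex m" for x :: "nat \<Rightarrow> real"
    using that assms(1) by (auto simp: simplical_face_def standard_simplex_def fun_eq_iff)
  then show ?thesis
    using assms standard_simplex_mono[of m p]
    by (auto simp: front_face_def singular_face_def Int_absorb1 intro!: restrict_ext)
qed

text \<open>Deleting a vertex of the front part moves the cut from \<open>m\<close> to
  \<open>Suc m\<close> in the original numbering, so the back part is an original back face.\<close>

lemma back_face_singular_face_le:
  assumes "i \<le> m" "m \<le> p"
  shows "back_face p (p - m) (singular_face (Suc p) i \<sigma>) = back_face (Suc p) (p - m) \<sigma>"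
proof -
  have "simplical_face i (simplex_shift m x) = simplex_shift (Suc m) x" for x :: "nat \<Rightarrow> real"
    using assms(1) by (auto simp: simplical_face_def simplex_shift_def fun_eq_iff)
  then show ?thesis
    using assms simplex_shift_in_standard_simplex[of _ "p - m" m]
    by (auto simp: back_face_eq singular_face_def Suc_diff_le Int_absorb1 intro!: restrict_ext)
qed

text \<open>Vertex \<open>m\<close> belongs to both parts, so only deletions with
  \<open>j > 0\<close> act on the back part alone; the case \<open>j = 0\<close> is left to
  \<open>singular_face_0_back_face\<close>.\<close>

lemma back_face_singular_face_gt:
  assumes "j \<le> Suc (p - m)" "0 < j" "m \<le> p"
  shows "back_face p (p - m) (singular_face (Suc p) (m + j) \<sigma>) = singular_face (Suc (p - m)) j (back_face (Suc p) (Suc (p - m)) \<sigma>)"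
proof -
  have "simplical_face (m + j) (simplex_shift m x) = simplex_shift m (simplical_face j x)" for x :: "nat \<Rightarrow> real"
    using assms(2) by (auto simp: simplical_face_def simplex_shift_def fun_eq_iff)
  then show ?thesis
    using assms simplex_shift_in_standard_simplex[of _ "p - m" m] simplical_face_in[of j "p - m"]
    by (auto simp: back_face_eq singular_face_def Int_absorb1 intro!: restrict_ext)
qed

text \<open>This and \<open>singular_face_0_back_face\<close> describe the two faces that delete the
  shared vertex. They produce the terms that cancel in the Leibniz rule.\<close>

lemma singular_face_last_front_face: "singular_face (Suc m) (Suc m) (front_face (Suc m) \<sigma>) = front_face m \<sigma>"
proof -
  have "simplical_face (Suc m) x = x" if "x \<in> standard_simplex m" for x :: "nat \<Rightarrow> real"
    using that by (auto simp: simplical_face_def standard_simplex_def fun_eq_iff)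
  then show ?thesis
    using standard_simplex_mono[of m "Suc m"]
    by (auto simp: front_face_def singular_face_def Int_absorb1 intro!: restrict_ext)
qed

lemma singular_face_0_back_face:
  assumes "m \<le> p"
  shows "singular_face (Suc (p - m)) 0 (back_face (Suc p) (Suc (p - m)) \<sigma>) = back_face (Suc p) (p - m) \<sigma>"
proof -
  have "simplex_shift m (simplical_face 0 x) = simplex_shift (Suc m) x" for x :: "nat \<Rightarrow> real"
    by (auto simp: simplical_face_def simplex_shift_def fun_eq_iff)
  then show ?thesis
    using assms simplical_face_in[of 0 "p - m"]
    by (auto simp: back_face_eq singular_face_def Suc_diff_le Int_absorb1 intro!: restrict_ext)
qed

lemma simplex_map_front_face: "p \<le> n \<Longrightarrow> simplex_map p f (front_face p \<sigma>) = front_face p (simplex_map n f \<sigma>)"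
  using standard_simplex_mono[of p n] by (auto simp: simplex_map_def front_face_def Int_absorb1 intro!: restrict_ext)

lemma simplex_map_back_face: "k \<le> n \<Longrightarrow> simplex_map k f (back_face n k \<sigma>) = back_face n k (simplex_map n f \<sigma>)"
  using simplex_shift_in_standard_simplex[of _ k "n - k"]
  by (auto simp: simplex_map_def back_face_eq Int_absorb1 intro!: restrict_ext)

subsection \<open>Evaluation of cochains\<close>

text \<open>The Kronecker pairing. Through it the coboundary is the transpose of the boundary and
  the cup product that of the cap product, so cochain identities follow from chain
  identities.\<close>

definition chain_eval :: "('x \<Rightarrow> 'r::{comm_ring,comm_monoid_mult}) \<Rightarrow> ('x \<Rightarrow>\<^sub>0 'r) \<Rightarrow> 'r"
  where "chain_eval \<phi> c = (\<Sum>s\<in>Poly_Mapping.keys c. Poly_Mapping.lookup c s * \<phi> s)"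

lemma chain_eval_superset:
  assumes "finite A" "Poly_Mapping.keys c \<subseteq> A"
  shows "chain_eval \<phi> c = (\<Sum>s\<in>A. Poly_Mapping.lookup c s * \<phi> s)"
  unfolding chain_eval_def
  by (rule sum.mono_neutral_left) (use assms in \<open>auto simp: in_keys_iff\<close>)

lemma chain_eval_0 [simp]: "chain_eval \<phi> 0 = 0"
  by (simp add: chain_eval_def)

lemma chain_eval_add: "chain_eval \<phi> (c + d) = chain_eval \<phi> c + chain_eval \<phi> d"
proof -
  let ?A = "Poly_Mapping.keys c \<union> Poly_Mapping.keys d"
  have "finite ?A" "Poly_Mapping.keys (c + d) \<subseteq> ?A"
    using keys_add[of c d] by auto
  then show ?thesis
    by (simp add: chain_eval_superset[of ?A] lookup_add distrib_right sum.distrib)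
qed

lemma chain_eval_single [simp]: "chain_eval \<phi> (Poly_Mapping.single s r) = r * \<phi> s"
  by (simp add: chain_eval_superset[of "{s}"])

lemma chain_eval_smul: "chain_eval \<phi> (smul r c) = r * chain_eval \<phi> c"
  by (simp add: chain_eval_superset[OF _ keys_smul] chain_eval_def[of \<phi> c] sum_distrib_left mult.assoc)

lemma chain_eval_uminus: "chain_eval \<phi> (- c) = - chain_eval \<phi> c"
  using chain_eval_smul[of \<phi> "- 1" c] by simp

lemma chain_eval_diff: "chain_eval \<phi> (c - d) = chain_eval \<phi> c - chain_eval \<phi> d"
  using chain_eval_add[of \<phi> c "- d"] by (simp add: chain_eval_uminus)

lemma chain_eval_sum: "chain_eval \<phi> (sum f A) = (\<Sum>a\<in>A. chain_eval \<phi> (f a))"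
  by (induction A rule: infinite_finite_induct) (simp_all add: chain_eval_add)

lemma chain_eval_plus: "chain_eval (\<lambda>s. \<phi> s + \<psi> s) c = chain_eval \<phi> c + chain_eval \<psi> c"
  by (simp add: chain_eval_def distrib_left sum.distrib)

lemma chain_eval_zero [simp]: "chain_eval (\<lambda>s. 0) c = 0"
  by (simp add: chain_eval_def)

lemma chain_eval_linear:
  "chain_linear T \<Longrightarrow> chain_eval \<phi> (T c) = chain_eval (\<lambda>s. chain_eval \<phi> (T (Poly_Mapping.single s 1))) c"
  by (subst chain_linear_iff[THEN iffD1], assumption)
    (simp add: chain_extend_eq chain_eval_sum chain_eval_smul chain_eval_def[of "\<lambda>s. chain_eval \<phi> (T (Poly_Mapping.single s 1))"])

lemma chain_eval_cong:
  assumes "c \<in> chains_of Y" "\<And>n \<sigma>. singular_simplex n Y \<sigma> \<Longrightarrow> \<phi> (n, \<sigma>) = \<psi> (n, \<sigma>)"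
  shows "chain_eval \<phi> c = chain_eval \<psi> c"
  unfolding chain_eval_def
  by (rule sum.cong) (use assms in \<open>auto simp: chains_of_iff\<close>)

section \<open>The cap product of chains and its transpose\<close>

lemma chain_linear_cap [simp, intro]: "chain_linear (cap \<phi>)"
  by (simp add: cap_def)

lemmas cap_0 [simp] = chain_linear_0[OF chain_linear_cap]
  and cap_add = chain_linear_add[OF chain_linear_cap]
  and cap_diff = chain_linear_diff[OF chain_linear_cap]

lemma cap_single:
  "cap \<phi> (Poly_Mapping.single (n, \<sigma>) 1) =
    (\<Sum>k\<le>n. Poly_Mapping.single (n - k, front_face (n - k) \<sigma>) (\<phi> (k, back_face n k \<sigma>)))"
  by (simp add: cap_def)

lemma boundary_single_eq:
  "boundary (Poly_Mapping.single (n, \<sigma>) 1) =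
    (if n = 0 then 0 else \<Sum>k\<le>n. Poly_Mapping.single (n - 1, singular_face n k \<sigma>) ((-1) ^ k))"
  by (simp add: boundary_def)

lemma coboundary_eq:
  "coboundary X \<phi> (n, \<sigma>) = (if singular_simplex n X \<sigma> then chain_eval \<phi> (boundary (Poly_Mapping.single (n, \<sigma>) 1)) else 0)"
  by (simp add: coboundary_def boundary_single_eq chain_eval_sum)

text \<open>The cup product is summed over the degree of the front face and the cap product over
  that of the back face, whence the reversal of the sum.\<close>

lemma cup_eq:
  "cup X \<phi> \<psi> (n, \<sigma>) = (if singular_simplex n X \<sigma> then chain_eval \<phi> (cap \<psi> (Poly_Mapping.single (n, \<sigma>) 1)) else 0)"
proof -
  have "(\<Sum>i\<le>n. \<phi> (i, front_face i \<sigma>) * \<psi> (n - i, back_face n (n - i) \<sigma>)) =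
      (\<Sum>k\<le>n. \<phi> (n - k, front_face (n - k) \<sigma>) * \<psi> (k, back_face n k \<sigma>))"
    by (rule sum.reindex_bij_witness[of _ "\<lambda>i. n - i" "\<lambda>i. n - i"]) auto
  then show ?thesis
    by (simp add: cup_def cap_single chain_eval_sum mult.commute)
qed

lemma chain_eval_coboundary:
  assumes "c \<in> chains_of X" shows "chain_eval (coboundary X \<phi>) c = chain_eval \<phi> (boundary c)"
  by (subst chain_eval_linear[OF chain_linear_boundary], rule chain_eval_cong[OF assms]) (simp add: coboundary_eq)

lemma chain_eval_cup:
  assumes "c \<in> chains_of X" shows "chain_eval (cup X \<phi> \<psi>) c = chain_eval \<phi> (cap \<psi> c)"
  by (subst chain_eval_linear[OF chain_linear_cap], rule chain_eval_cong[OF assms]) (simp add: cup_eq)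

lemma cap_in_chains_of: "c \<in> chains_of Y \<Longrightarrow> cap \<phi> c \<in> chains_of Y"
  by (rule chain_linear_closed[OF chain_linear_cap])
    (auto simp: cap_single intro!: chains_of_sum chains_of_single singular_simplex_front_face)

lemma cap_cong:
  assumes "c \<in> chains_of Y" "\<And>n \<sigma>. singular_simplex n Y \<sigma> \<Longrightarrow> \<phi> (n, \<sigma>) = \<psi> (n, \<sigma>)"
  shows "cap \<phi> c = cap \<psi> c"
  by (rule chain_linear_eqI[OF chain_linear_cap chain_linear_cap assms(1)])
    (auto simp: cap_single assms(2)[OF singular_simplex_back_face])

lemma cap_plus: "cap (\<lambda>s. \<phi> s + \<psi> s) c = cap \<phi> c + cap \<psi> c"
proof -
  have "(\<lambda>(n, \<sigma>). \<Sum>k\<le>n. Poly_Mapping.single (n - k, front_face (n - k) \<sigma>) (\<phi> (k, back_face n k \<sigma>) + \<psi> (k, back_face n k \<sigma>)))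
    = (\<lambda>s. (case s of (n, \<sigma>) \<Rightarrow> \<Sum>k\<le>n. Poly_Mapping.single (n - k, front_face (n - k) \<sigma>) (\<phi> (k, back_face n k \<sigma>)))
      + (case s of (n, \<sigma>) \<Rightarrow> \<Sum>k\<le>n. Poly_Mapping.single (n - k, front_face (n - k) \<sigma>) (\<psi> (k, back_face n k \<sigma>))))"
    by (auto simp: fun_eq_iff single_add sum.distrib)
  then show ?thesis
    by (simp add: cap_def chain_extend_eq[of "\<lambda>s. f s + g s" for f g]) (simp add: chain_extend_eq smul_add_right sum.distrib)
qed

lemma cap_cup:
  assumes "c \<in> chains_of X" shows "cap (cup X \<phi> \<psi>) c = cap \<phi> (cap \<psi> c)"
proof (rule chain_linear_eqI[OF chain_linear_cap chain_linear_compose[OF chain_linear_cap chain_linear_cap] assms])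
  fix n \<sigma> assume \<sigma>: "singular_simplex n X \<sigma>"
  let ?t = "\<lambda>i k. Poly_Mapping.single (n - k, front_face (n - k) \<sigma>)
    (\<phi> (i, front_face i (back_face n k \<sigma>)) * \<psi> (k - i, back_face n (k - i) \<sigma>))"
  have sum_single: "(\<Sum>a\<in>A. Poly_Mapping.single t (f a)) = Poly_Mapping.single t (\<Sum>a\<in>A. f a)" for A :: "nat set" and t :: "'a tagged_simplex" and f :: "nat \<Rightarrow> 'b"
    by (induction A rule: infinite_finite_induct) (simp_all add: single_add)
  have "cap (cup X \<phi> \<psi>) (Poly_Mapping.single (n, \<sigma>) 1) = (\<Sum>k\<le>n. \<Sum>i\<le>k. ?t i k)"
    using singular_simplex_back_face[OF \<sigma>]
    by (auto simp: cap_single cup_def sum_single back_face_back_face intro!: sum.cong)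
  also have "\<dots> = (\<Sum>(k, i)\<in>(SIGMA k:{..n}. {..k}). ?t i k)"
    by (subst sum.Sigma) auto
  \<comment> \<open>Here \<open>j\<close> is the degree of the back face given to \<psi> and
    \<open>i\<close> that of the middle part given to \<phi>; summing over \<open>j\<close> outside
    displays capping with \<psi> first.\<close>
  also have "\<dots> = (\<Sum>(j, i)\<in>(SIGMA j:{..n}. {..n - j}). ?t i (j + i))"
    by (rule sum.reindex_bij_witness[of _ "\<lambda>(j, i). (j + i, i)" "\<lambda>(k, i). (k - i, i)"]) auto
  also have "\<dots> = (\<Sum>j\<le>n. \<Sum>i\<le>n - j. ?t i (j + i))"
    by (subst sum.Sigma) auto
  also have "\<dots> = (\<Sum>j\<le>n. smul (\<psi> (j, back_face n j \<sigma>)) (cap \<phi> (Poly_Mapping.single (n - j, front_face (n - j) \<sigma>) 1)))"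
  proof (intro sum.cong refl)
    fix j assume j: "j \<in> {..n}"
    have "?t i (j + i) = Poly_Mapping.single (n - j - i, front_face (n - j - i) (front_face (n - j) \<sigma>))
        (\<psi> (j, back_face n j \<sigma>) * \<phi> (i, back_face (n - j) i (front_face (n - j) \<sigma>)))" if "i \<le> n - j" for i
    proof -
      have "n - (j + i) + i = n - j" "j + i \<le> n" using that j by auto
      then show ?thesis
        using back_face_front_face[of i "j + i" n \<sigma>] by (simp add: front_face_front_face mult.commute)
    qed
    then show "(\<Sum>i\<le>n - j. ?t i (j + i)) = smul (\<psi> (j, back_face n j \<sigma>)) (cap \<phi> (Poly_Mapping.single (n - j, front_face (n - j) \<sigma>) 1))"
      by (simp add: cap_single smul_sum)
  qed
  also have "\<dots> = cap \<phi> (cap \<psi> (Poly_Mapping.single (n, \<sigma>) 1))"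
    by (simp add: cap_single[of \<psi>] chain_linear_sum[OF chain_linear_cap] flip: chain_linear_smul[OF chain_linear_cap])
  finally show "cap (cup X \<phi> \<psi>) (Poly_Mapping.single (n, \<sigma>) 1) = cap \<phi> (cap \<psi> (Poly_Mapping.single (n, \<sigma>) 1))" .
qed

text \<open>The grading involution of the chain complex, needed as an operator because chains and
  cochains may be inhomogeneous.\<close>

definition degree_sign :: "('a, 'r::{comm_ring,comm_monoid_mult}) chains \<Rightarrow> ('a, 'r) chains"
  where "degree_sign = chain_extend (\<lambda>(n, \<sigma>). Poly_Mapping.single (n, \<sigma>) ((-1) ^ n))"

lemma chain_linear_degree_sign [simp, intro]: "chain_linear degree_sign"
  by (simp add: degree_sign_def)

lemma degree_sign_single: "degree_sign (Poly_Mapping.single (n, \<sigma>) r) = Poly_Mapping.single (n, \<sigma>) ((-1) ^ n * r)"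
  by (simp add: degree_sign_def mult.commute)

text \<open>Since the sign is expressed by the degree of the resulting chain only, the Leibniz rule also holds
  for inhomogeneous cochains.\<close>

lemma cap_boundary:
  assumes "c \<in> chains_of X"
  shows "cap \<phi> (boundary c) - boundary (cap \<phi> c) = degree_sign (cap (coboundary X \<phi>) c)"
proof (rule chain_linear_eqI[OF chain_linear_minus[OF chain_linear_compose[OF chain_linear_cap chain_linear_boundary]
        chain_linear_compose[OF chain_linear_boundary chain_linear_cap]]
      chain_linear_compose[OF chain_linear_degree_sign chain_linear_cap] assms])
  fix n \<sigma> assume \<sigma>: "singular_simplex n X \<sigma>"
  let ?s = "Poly_Mapping.single (n, \<sigma>) (1::'b)"
  let ?S = "Poly_Mapping.single :: 'a tagged_simplex \<Rightarrow> 'b \<Rightarrow> ('a, 'b) chains"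
  show "cap \<phi> (boundary ?s) - boundary (cap \<phi> ?s) = degree_sign (cap (coboundary X \<phi>) ?s)"
  proof (cases n)
    case 0
    then show ?thesis
      by (simp add: boundary_single_eq cap_single coboundary_def degree_sign_single boundary_def
          chain_linear_0[OF chain_linear_degree_sign])
  next
    case (Suc p)
    let ?F = "\<lambda>m i. singular_face (Suc m) i (front_face (Suc m) \<sigma>)"
    let ?b = "\<lambda>m. \<phi> (p - m, back_face n (p - m) \<sigma>)"
    let ?d = "\<lambda>m j. \<phi> (p - m, singular_face (Suc (p - m)) j (back_face n (Suc (p - m)) \<sigma>))"
    \<comment> \<open>All three expansions are indexed by the dimension \<open>m\<close> of the
      front part, so that they can be compared term by term.\<close>
    have rev: "(\<Sum>k\<le>p. f k) = (\<Sum>m\<le>p. f (p - m))" for f :: "nat \<Rightarrow> ('a, 'b) chains"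
      by (rule sum.reindex_bij_witness[of _ "\<lambda>i. p - i" "\<lambda>i. p - i"]) auto
    \<comment> \<open>Faces with index at most \<open>m\<close> hit the front part; those with index
      \<open>m + j\<close>, where \<open>j \<ge> 1\<close>, hit the back part.\<close>
    have A: "cap \<phi> (boundary ?s) = (\<Sum>m\<le>p. (\<Sum>i\<le>m. ?S (m, ?F m i) ((-1) ^ i * ?b m))
        + (\<Sum>j\<in>{1..Suc (p - m)}. ?S (m, front_face m \<sigma>) ((-1) ^ (m + j) * ?d m j)))"
    proof -
      let ?t = "\<lambda>m i. ?S (m, front_face m (singular_face n i \<sigma>)) ((-1) ^ i * \<phi> (p - m, back_face p (p - m) (singular_face n i \<sigma>)))"
      have "cap \<phi> (boundary ?s) = (\<Sum>i\<le>n. smul ((-1) ^ i) (cap \<phi> (?S (p, singular_face n i \<sigma>) 1)))"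
        using Suc by (simp add: boundary_single_eq chain_linear_sum[OF chain_linear_cap] del: sum.atMost_Suc flip: chain_linear_smul[OF chain_linear_cap])
      also have "\<dots> = (\<Sum>i\<le>n. \<Sum>m\<le>p. ?t m i)"
        by (simp add: cap_single smul_sum rev[of "\<lambda>k. ?S (p - k, front_face (p - k) \<tau>) (\<psi> k)" for \<tau> \<psi>])
      also have "\<dots> = (\<Sum>m\<le>p. \<Sum>i\<le>n. ?t m i)" by (rule sum.swap)
      also have "\<dots> = (\<Sum>m\<le>p. (\<Sum>i\<le>m. ?S (m, ?F m i) ((-1) ^ i * ?b m))
        + (\<Sum>j\<in>{1..Suc (p - m)}. ?S (m, front_face m \<sigma>) ((-1) ^ (m + j) * ?d m j)))"
      proof (rule sum.cong[OF refl])
        fix m assume "m \<in> {..p}"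
        then have m: "m \<le> p" by simp
        have "{..n} = {..m} \<union> {Suc m..n}" using m Suc by auto
        then have "(\<Sum>i\<le>n. ?t m i) = (\<Sum>i\<le>m. ?t m i) + (\<Sum>i\<in>{Suc m..n}. ?t m i)"
          by (simp only:) (rule sum.union_disjoint, auto)
        moreover have "(\<Sum>i\<le>m. ?t m i) = (\<Sum>i\<le>m. ?S (m, ?F m i) ((-1) ^ i * ?b m))"
          using m Suc by (auto intro!: sum.cong simp: front_face_singular_face_le back_face_singular_face_le)
        moreover have "(\<Sum>i\<in>{Suc m..n}. ?t m i) = (\<Sum>j\<in>{1..Suc (p - m)}. ?t m (m + j))"
          using m Suc by (intro sum.reindex_bij_witness[of _ "\<lambda>j. m + j" "\<lambda>i. i - m"]) auto
        moreover have "(\<Sum>j\<in>{1..Suc (p - m)}. ?t m (m + j)) = (\<Sum>j\<in>{1..Suc (p - m)}. ?S (m, front_face m \<sigma>) ((-1) ^ (m + j) * ?d m j))"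
          using m Suc by (auto intro!: sum.cong simp: front_face_singular_face_gt back_face_singular_face_gt)
        ultimately show "(\<Sum>i\<le>n. ?t m i) = (\<Sum>i\<le>m. ?S (m, ?F m i) ((-1) ^ i * ?b m))
          + (\<Sum>j\<in>{1..Suc (p - m)}. ?S (m, front_face m \<sigma>) ((-1) ^ (m + j) * ?d m j))" by simp
      qed
      finally show ?thesis .
    qed
    \<comment> \<open>The same faces of the front part, plus the one that deletes the shared
      vertex.\<close>
    have B: "boundary (cap \<phi> ?s) = (\<Sum>m\<le>p. (\<Sum>i\<le>m. ?S (m, ?F m i) ((-1) ^ i * ?b m))
        + ?S (m, front_face m \<sigma>) ((-1) ^ Suc m * ?b m))"
    proof -
      have "boundary (cap \<phi> ?s) = (\<Sum>k\<le>Suc p. smul (\<phi> (k, back_face n k \<sigma>)) (boundary (?S (n - k, front_face (n - k) \<sigma>) 1)))"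
        using Suc by (simp add: cap_single chain_linear_sum[OF chain_linear_boundary] flip: chain_linear_smul[OF chain_linear_boundary] del: sum.atMost_Suc)
      also have "\<dots> = (\<Sum>k\<le>p. smul (\<phi> (k, back_face n k \<sigma>)) (boundary (?S (n - k, front_face (n - k) \<sigma>) 1)))"
        using Suc by (simp add: boundary_single_eq[of 0])
      also have "\<dots> = (\<Sum>m\<le>p. smul (?b m) (boundary (?S (Suc m, front_face (Suc m) \<sigma>) 1)))"
        using Suc by (subst rev) (auto intro!: sum.cong)
      also have "\<dots> = (\<Sum>m\<le>p. (\<Sum>i\<le>m. ?S (m, ?F m i) ((-1) ^ i * ?b m))
        + ?S (m, front_face m \<sigma>) ((-1) ^ Suc m * ?b m))"
        by (simp add: boundary_single_eq smul_sum singular_face_last_front_face smul_add_right mult.commute)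
      finally show ?thesis .
    qed
    \<comment> \<open>The faces of the back part; the separate term is its face
      \<open>j = 0\<close>, again deleting the shared vertex.\<close>
    have C: "degree_sign (cap (coboundary X \<phi>) ?s) = (\<Sum>m\<le>p. (\<Sum>j\<in>{1..Suc (p - m)}. ?S (m, front_face m \<sigma>) ((-1) ^ (m + j) * ?d m j))
        + ?S (m, front_face m \<sigma>) ((-1) ^ m * ?b m))"
    proof -
      have "cap (coboundary X \<phi>) ?s = (\<Sum>k\<le>Suc p. ?S (n - k, front_face (n - k) \<sigma>) (coboundary X \<phi> (k, back_face n k \<sigma>)))"
        using Suc by (simp add: cap_single del: sum.atMost_Suc)
      also have "\<dots> = (\<Sum>k\<le>p. ?S (p - k, front_face (p - k) \<sigma>) (coboundary X \<phi> (Suc k, back_face n (Suc k) \<sigma>)))"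
        using Suc by (subst sum.atMost_Suc_shift) (simp add: coboundary_def)
      also have "\<dots> = (\<Sum>m\<le>p. ?S (m, front_face m \<sigma>) (coboundary X \<phi> (Suc (p - m), back_face n (Suc (p - m)) \<sigma>)))"
        by (subst rev) (auto intro!: sum.cong)
      finally have "degree_sign (cap (coboundary X \<phi>) ?s) =
          (\<Sum>m\<le>p. ?S (m, front_face m \<sigma>) ((-1) ^ m * coboundary X \<phi> (Suc (p - m), back_face n (Suc (p - m)) \<sigma>)))"
        by (simp add: chain_linear_sum[OF chain_linear_degree_sign] degree_sign_single)
      also have "\<dots> = (\<Sum>m\<le>p. (\<Sum>j\<in>{1..Suc (p - m)}. ?S (m, front_face m \<sigma>) ((-1) ^ (m + j) * ?d m j))
        + ?S (m, front_face m \<sigma>) ((-1) ^ m * ?b m))"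
      proof (rule sum.cong[OF refl])
        fix m assume "m \<in> {..p}"
        then have m: "m \<le> p" by simp
        have "singular_simplex (Suc (p - m)) X (back_face n (Suc (p - m)) \<sigma>)"
          using singular_simplex_back_face[OF \<sigma>] m Suc by simp
        then have "coboundary X \<phi> (Suc (p - m), back_face n (Suc (p - m)) \<sigma>) = (\<Sum>j\<le>Suc (p - m). (-1) ^ j * ?d m j)"
          by (simp add: coboundary_def del: sum.atMost_Suc)
        also have "{..Suc (p - m)} = insert 0 {1..Suc (p - m)}" by auto
        also have "(\<Sum>j\<in>insert 0 {1..Suc (p - m)}. (-1) ^ j * ?d m j) = (\<Sum>j\<in>{1..Suc (p - m)}. (-1) ^ j * ?d m j) + ?b m"
          using singular_face_0_back_face[OF m, of \<sigma>] Suc by (simp add: add.commute)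
        finally have 1: "coboundary X \<phi> (Suc (p - m), back_face n (Suc (p - m)) \<sigma>) = (\<Sum>j\<in>{1..Suc (p - m)}. (-1) ^ j * ?d m j) + ?b m" .
        have "?S (m, front_face m \<sigma>) (\<Sum>j\<in>A. f j) = (\<Sum>j\<in>A. ?S (m, front_face m \<sigma>) (f j))" for A :: "nat set" and f :: "nat \<Rightarrow> 'b"
          by (induction A rule: infinite_finite_induct) (simp_all add: single_add)
        then show "?S (m, front_face m \<sigma>) ((-1) ^ m * coboundary X \<phi> (Suc (p - m), back_face n (Suc (p - m)) \<sigma>)) =
          (\<Sum>j\<in>{1..Suc (p - m)}. ?S (m, front_face m \<sigma>) ((-1) ^ (m + j) * ?d m j)) + ?S (m, front_face m \<sigma>) ((-1) ^ m * ?b m)"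
          by (simp only: 1 distrib_left single_add sum_distrib_left power_add mult.assoc)
      qed
      finally show ?thesis .
    qed
    \<comment> \<open>The term for the shared vertex has sign exponent \<open>Suc m\<close> in
      \<open>B\<close> and \<open>m\<close> in \<open>C\<close>, so subtracting \<open>B\<close>
      from \<open>A\<close> gives \<open>C\<close> exactly.\<close>
    have "?S t ((-1) ^ Suc m * r) = - ?S t ((-1) ^ m * r)" for t m r
      by (simp add: single_uminus)
    then show ?thesis
      unfolding A B C by (simp only: sum.distrib sum_negf) simp
  qed
qed

subsection \<open>The cohomology ring\<close>

text \<open>Cochains vanish off the simplices of \<open>X\<close>, so the pairing with chains of
  \<open>X\<close> determines them.\<close>

lemma cochains_eqI:
  assumes "\<phi> \<in> cochains X" "\<psi> \<in> cochains X"
    and "\<And>c. c \<in> chains_of X \<Longrightarrow> chain_eval \<phi> c = chain_eval \<psi> c"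
  shows "\<phi> = \<psi>"
proof
  fix s :: "'a tagged_simplex"
  obtain n \<sigma> where s: "s = (n, \<sigma>)" by (cases s)
  show "\<phi> s = \<psi> s"
  proof (cases "singular_simplex n X \<sigma>")
    case True
    then show ?thesis
      using assms(3)[OF chains_of_single[OF True, of 1]] by (simp add: s)
  qed (use assms(1,2) in \<open>simp add: s cochains_def\<close>)
qed

lemma zero_in_cochains: "(\<lambda>_. 0) \<in> cochains X"
  by (simp add: cochains_def)

lemma add_in_cochains:
  assumes "\<phi> \<in> cochains X" "\<psi> \<in> cochains X" shows "(\<lambda>s. \<phi> s + \<psi> s) \<in> cochains X"
proof -
  obtain N M where "\<forall>n>N. \<forall>\<sigma>. \<phi> (n, \<sigma>) = 0" "\<forall>n>M. \<forall>\<sigma>. \<psi> (n, \<sigma>) = 0"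
    using assms by (auto simp: cochains_def)
  then have "\<forall>n>max N M. \<forall>\<sigma>. \<phi> (n, \<sigma>) + \<psi> (n, \<sigma>) = 0" by simp
  then have "\<exists>N. \<forall>n>N. \<forall>\<sigma>. \<phi> (n, \<sigma>) + \<psi> (n, \<sigma>) = 0" by blast
  moreover have "\<forall>n \<sigma>. \<not> singular_simplex n X \<sigma> \<longrightarrow> \<phi> (n, \<sigma>) + \<psi> (n, \<sigma>) = 0"
    using assms by (simp add: cochains_def)
  ultimately show ?thesis unfolding cochains_def by blast
qed

lemma uminus_in_cochains: "\<phi> \<in> cochains X \<Longrightarrow> (\<lambda>s. - \<phi> s) \<in> cochains X"
  by (auto simp: cochains_def)

lemma coboundary_in_cochains:
  assumes "\<phi> \<in> cochains X" shows "coboundary X \<phi> \<in> cochains X"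
proof -
  obtain N where N: "\<forall>n>N. \<forall>\<sigma>. \<phi> (n, \<sigma>) = 0"
    using assms by (auto simp: cochains_def)
  have "coboundary X \<phi> (n, \<sigma>) = 0" if "n > Suc N" for n \<sigma>
  proof -
    have "n - 1 > N" using that by simp
    then show ?thesis using N by (simp add: coboundary_def)
  qed
  then have "\<exists>N. \<forall>n>N. \<forall>\<sigma>. coboundary X \<phi> (n, \<sigma>) = 0" by blast
  moreover have "\<forall>n \<sigma>. \<not> singular_simplex n X \<sigma> \<longrightarrow> coboundary X \<phi> (n, \<sigma>) = 0"
    by (simp add: coboundary_def)
  ultimately show ?thesis unfolding cochains_def by blast
qed

lemma cup_in_cochains:
  assumes "\<phi> \<in> cochains X" "\<psi> \<in> cochains X" shows "cup X \<phi> \<psi> \<in> cochains X"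
proof -
  obtain N M where NM: "\<forall>n>N. \<forall>\<sigma>. \<phi> (n, \<sigma>) = 0" "\<forall>n>M. \<forall>\<sigma>. \<psi> (n, \<sigma>) = 0"
    using assms by (auto simp: cochains_def)
  have "cup X \<phi> \<psi> (n, \<sigma>) = 0" if "n > N + M" for n \<sigma>
  proof -
    have "i > N \<or> n - i > M" for i using that by linarith
    then have "\<phi> (i, \<tau>) * \<psi> (n - i, \<tau>') = 0" for i \<tau> \<tau>'
      using NM by (metis mult_zero_left mult_zero_right)
    then show ?thesis by (simp add: cup_def)
  qed
  then have "\<exists>N. \<forall>n>N. \<forall>\<sigma>. cup X \<phi> \<psi> (n, \<sigma>) = 0" by blast
  moreover have "\<forall>n \<sigma>. \<not> singular_simplex n X \<sigma> \<longrightarrow> cup X \<phi> \<psi> (n, \<sigma>) = 0"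
    by (simp add: cup_def)
  ultimately show ?thesis unfolding cochains_def by blast
qed

lemma unit_in_cochains: "unit_cochain X \<in> cochains X"
  by (auto simp: cochains_def unit_cochain_def)

lemma coboundary_add: "coboundary X (\<lambda>s. \<phi> s + \<psi> s) = (\<lambda>s. coboundary X \<phi> s + coboundary X \<psi> s)"
  by (auto simp: fun_eq_iff coboundary_eq chain_eval_plus)

lemma coboundary_zero [simp]: "coboundary X (\<lambda>s. 0) = (\<lambda>s. 0)"
  by (auto simp: fun_eq_iff coboundary_eq)

lemma chain_eval_neg: "chain_eval (\<lambda>s. - \<phi> s) c = - chain_eval \<phi> c"
  by (simp add: chain_eval_def sum_negf)

lemma coboundary_neg: "coboundary X (\<lambda>s. - \<phi> s) = (\<lambda>s. - coboundary X \<phi> s)"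
  by (auto simp: fun_eq_iff coboundary_eq chain_eval_neg)

lemma cap_unit:
  assumes "c \<in> chains_of X" shows "cap (unit_cochain X) c = c"
proof (rule chain_linear_eqI[OF chain_linear_cap chain_linear_id(2) assms])
  fix n \<sigma> assume \<sigma>: "singular_simplex n X \<sigma>"
  have "cap (unit_cochain X) (Poly_Mapping.single (n, \<sigma>) 1) =
      (\<Sum>k\<le>n. if k = 0 then Poly_Mapping.single (n, \<sigma>) 1 else 0)"
    unfolding cap_single
    by (intro sum.cong refl) (use singular_simplex_back_face[OF \<sigma>, of 0] in \<open>auto simp: unit_cochain_def front_face_self[OF \<sigma>]\<close>)
  then show "cap (unit_cochain X) (Poly_Mapping.single (n, \<sigma>) 1) = Poly_Mapping.single (n, \<sigma>) 1"
    by simp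
qed

lemma cup_unit_left:
  assumes "\<phi> \<in> cochains X" shows "cup X (unit_cochain X) \<phi> = \<phi>"
proof
  fix s :: "'a tagged_simplex"
  obtain n \<sigma> where s: "s = (n, \<sigma>)" by (cases s)
  show "cup X (unit_cochain X) \<phi> s = \<phi> s"
  proof (cases "singular_simplex n X \<sigma>")
    case True
    have "unit_cochain X (i, front_face i \<sigma>) * \<phi> (n - i, back_face n (n - i) \<sigma>) = (if i = 0 then \<phi> (n, \<sigma>) else 0)" for i
      using singular_simplex_front_face[OF True, of 0] by (simp add: unit_cochain_def back_face_0_self[OF True])
    then show ?thesis using True by (simp add: s cup_def)
  qed (use assms in \<open>simp add: s cochains_def cup_def\<close>)
qed

lemma cup_unit_right:
  assumes "\<phi> \<in> cochains X" shows "cup X \<phi> (unit_cochain X) = \<phi>"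
  by (rule cochains_eqI[OF cup_in_cochains[OF assms unit_in_cochains] assms])
    (simp add: chain_eval_cup cap_unit)

text \<open>Paired with a chain, both sides become iterated caps, and the identity becomes
  \<open>cap_cup\<close>.\<close>

lemma cup_assoc:
  assumes "\<phi> \<in> cochains X" "\<psi> \<in> cochains X" "\<rho> \<in> cochains X"
  shows "cup X (cup X \<phi> \<psi>) \<rho> = cup X \<phi> (cup X \<psi> \<rho>)"
  by (rule cochains_eqI[where X=X]) (simp_all add: assms cup_in_cochains chain_eval_cup cap_cup cap_in_chains_of)

lemma cup_add_left: "cup X (\<lambda>s. \<phi> s + \<psi> s) \<rho> = (\<lambda>s. cup X \<phi> \<rho> s + cup X \<psi> \<rho> s)"
  and cup_add_right: "cup X \<rho> (\<lambda>s. \<phi> s + \<psi> s) = (\<lambda>s. cup X \<rho> \<phi> s + cup X \<rho> \<psi> s)"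
  by (auto simp: fun_eq_iff cup_eq chain_eval_plus cap_plus chain_eval_add)

lemma degree_sign_in_chains_of: "c \<in> chains_of X \<Longrightarrow> degree_sign c \<in> chains_of X"
  by (rule chain_linear_closed[OF chain_linear_degree_sign]) (auto simp: degree_sign_single intro: chains_of_single)

lemma degree_sign_degree_sign:
  assumes "c \<in> chains_of X" shows "degree_sign (degree_sign c) = c"
proof (rule chain_linear_eqI[OF chain_linear_compose[OF chain_linear_degree_sign chain_linear_degree_sign]
      chain_linear_id(2) assms])
  fix n :: nat and \<sigma> :: "(nat \<Rightarrow> real) \<Rightarrow> 'a"
  have "(-1) ^ n * (-1) ^ n = (1 :: 'b)"
    by (simp flip: power_mult_distrib)
  then show "degree_sign (degree_sign (Poly_Mapping.single (n, \<sigma>) 1)) = Poly_Mapping.single (n, \<sigma>) (1 :: 'b)"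
    by (simp add: degree_sign_single)
qed

text \<open>The boundary lowers the degree by one, which changes the sign once; in degree 0 both
  sides vanish.\<close>

lemma degree_sign_boundary:
  assumes "c \<in> chains_of X" shows "degree_sign (boundary c) = - boundary (degree_sign c)"
proof (rule chain_linear_eqI[OF chain_linear_compose[OF chain_linear_degree_sign chain_linear_boundary]
      chain_linear_neg[OF chain_linear_compose[OF chain_linear_boundary chain_linear_degree_sign]] assms])
  fix n :: nat and \<sigma> :: "(nat \<Rightarrow> real) \<Rightarrow> 'a"
  let ?s = "Poly_Mapping.single (n, \<sigma>) (1 :: 'b)"
  show "degree_sign (boundary ?s) = - boundary (degree_sign ?s)"
  proof (cases n)
    case 0
    then show ?thesis
      by (simp add: boundary_single_eq boundary_def degree_sign_single chain_linear_0[OF chain_linear_degree_sign])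
  next
    case (Suc p)
    have "boundary (degree_sign ?s) = smul ((-1) ^ n) (boundary ?s)"
      by (simp add: degree_sign_single flip: chain_linear_smul[OF chain_linear_boundary])
    moreover have "degree_sign (boundary ?s) = smul ((-1) ^ p) (boundary ?s)"
      using Suc by (simp add: boundary_single_eq chain_linear_sum[OF chain_linear_degree_sign] smul_sum degree_sign_single
          smul_add_right chain_linear_add[OF chain_linear_degree_sign] del: sum.atMost_Suc)
    ultimately show ?thesis
      using Suc by (simp add: smul_uminus_left)
  qed
qed

text \<open>The transpose of \<open>degree_sign\<close>, which supplies the sign in the Leibniz rule
  for a left factor of mixed degree.\<close>

definition sign_cochain :: "('a, 'r::{comm_ring,comm_monoid_mult}) cochain \<Rightarrow> ('a, 'r) cochain"
  where "sign_cochain \<phi> = (\<lambda>(n, \<sigma>). (-1) ^ n * \<phi> (n, \<sigma>))"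

lemma sign_in_cochains: "\<phi> \<in> cochains X \<Longrightarrow> sign_cochain \<phi> \<in> cochains X"
  by (fastforce simp: cochains_def sign_cochain_def)

lemma chain_eval_sign: "chain_eval (sign_cochain \<phi>) c = chain_eval \<phi> (degree_sign c)"
proof -
  have "chain_eval \<phi> (degree_sign c) = chain_eval (\<lambda>s. chain_eval \<phi> (degree_sign (Poly_Mapping.single s 1))) c"
    by (rule chain_eval_linear) simp
  also have "(\<lambda>s. chain_eval \<phi> (degree_sign (Poly_Mapping.single s 1))) = sign_cochain \<phi>"
    by (auto simp: fun_eq_iff sign_cochain_def degree_sign_single)
  finally show ?thesis ..
qed

lemma coboundary_coboundary: "coboundary X (coboundary X \<phi>) = (\<lambda>_. 0)"
proof
  fix s :: "'a tagged_simplex"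
  obtain n \<sigma> where s: "s = (n, \<sigma>)" by (cases s)
  show "coboundary X (coboundary X \<phi>) s = 0"
  proof (cases "singular_simplex n X \<sigma>")
    case True
    note c = chains_of_single[OF True]
    show ?thesis
      using True by (simp add: s coboundary_eq[of X "coboundary X \<phi>"] chain_eval_coboundary[OF boundary_in_chains_of[OF c]]
          boundary_boundary[OF c])
  qed (simp add: s coboundary_eq)
qed

lemma cocycle_eval_boundary:
  assumes "coboundary X \<phi> = (\<lambda>_. 0)" "c \<in> chains_of X" shows "chain_eval \<phi> (boundary c) = 0"
  using chain_eval_coboundary[OF assms(2), of \<phi>] assms(1) by simp

lemma cap_zero [simp]: "cap (\<lambda>_. 0) c = 0"
proof -
  have "(\<lambda>(n::nat, \<sigma>::(nat \<Rightarrow> real) \<Rightarrow> 'a). \<Sum>k\<le>n. Poly_Mapping.single (n - k, front_face (n - k) \<sigma>) (0::'b)) = (\<lambda>_. 0)"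
    by auto
  then show ?thesis by (simp add: cap_def chain_extend_eq)
qed

lemma cap_cocycle_boundary:
  assumes "coboundary X \<phi> = (\<lambda>_. 0)" "c \<in> chains_of X" shows "boundary (cap \<phi> c) = cap \<phi> (boundary c)"
  using cap_boundary[OF assms(2), of \<phi>] assms(1) by (simp add: chain_linear_0[OF chain_linear_degree_sign])

text \<open>No sign arises with the cocycle on the right, since it is evaluated on the back face and
  capping with it commutes with the boundary. Together with \<open>cup_coboundary\<close> this makes
  the coboundaries a two-sided ideal among the cocycles.\<close>

lemma coboundary_cup_cocycle:
  assumes "coboundary X \<psi> = (\<lambda>_. 0)" "\<phi> \<in> cochains X" "\<psi> \<in> cochains X"
  shows "coboundary X (cup X \<phi> \<psi>) = cup X (coboundary X \<phi>) \<psi>"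
  by (rule cochains_eqI[where X=X])
    (simp_all add: assms coboundary_in_cochains cup_in_cochains chain_eval_coboundary chain_eval_cup boundary_in_chains_of
      cap_in_chains_of cap_cocycle_boundary[OF assms(1)])

lemma cup_coboundary:
  assumes "coboundary X \<phi> = (\<lambda>_. 0)" "\<phi> \<in> cochains X" "\<psi> \<in> cochains X"
  shows "cup X \<phi> (coboundary X \<psi>) = coboundary X (cup X (sign_cochain \<phi>) \<psi>)"
proof (rule cochains_eqI[where X=X])
  fix c :: "('a, 'b) chains" assume c: "c \<in> chains_of X"
  note in_chains = boundary_in_chains_of cap_in_chains_of degree_sign_in_chains_of
  have "cap (coboundary X \<psi>) c = degree_sign (cap \<psi> (boundary c)) - degree_sign (boundary (cap \<psi> c))"
    using arg_cong[OF cap_boundary[OF c, of \<psi>], of degree_sign] degree_sign_degree_sign[OF cap_in_chains_of[OF c]]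
    by (simp add: chain_linear_diff[OF chain_linear_degree_sign])
  \<comment> \<open>Up to sign the argument is again a boundary, on which the cocycle \<phi>
    vanishes.\<close>
  moreover have "chain_eval \<phi> (degree_sign (boundary (cap \<psi> c))) = 0"
    using c by (simp add: degree_sign_boundary[OF cap_in_chains_of[OF c]] chain_eval_uminus cocycle_eval_boundary[OF assms(1)] in_chains)
  ultimately show "chain_eval (cup X \<phi> (coboundary X \<psi>)) c = chain_eval (coboundary X (cup X (sign_cochain \<phi>) \<psi>)) c"
    using c by (simp add: chain_eval_cup chain_eval_coboundary chain_eval_sign chain_eval_diff in_chains)
qed (simp_all add: assms coboundary_in_cochains cup_in_cochains sign_in_cochains)

section \<open>The ring of cocycles and its quotient\<close>

lemma carrier_cocycle_ring: "\<phi> \<in> carrier (cocycle_ring R X) \<longleftrightarrow> \<phi> \<in> cochains X \<and> coboundary X \<phi> = (\<lambda>_. 0)"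
  and add_cocycle_ring: "\<phi> \<oplus>\<^bsub>cocycle_ring R X\<^esub> \<psi> = (\<lambda>s. \<phi> s + \<psi> s)"
  and mult_cocycle_ring: "\<phi> \<otimes>\<^bsub>cocycle_ring R X\<^esub> \<psi> = cup X \<phi> \<psi>"
  and zero_cocycle_ring: "\<zero>\<^bsub>cocycle_ring R X\<^esub> = (\<lambda>_. 0)"
  and one_cocycle_ring: "\<one>\<^bsub>cocycle_ring R X\<^esub> = unit_cochain X"
  by (simp_all add: cocycle_ring_def)

lemmas cocycle_ring_simps = carrier_cocycle_ring add_cocycle_ring mult_cocycle_ring zero_cocycle_ring one_cocycle_ring

text \<open>Capping with the unit is the identity, so the Leibniz rule makes the cap product with
  its coboundary vanish. A cochain is recovered from its cap products by pairing with the
  unit.\<close>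

lemma coboundary_unit: "coboundary X (unit_cochain X) = (\<lambda>_. 0)"
proof (rule cochains_eqI[OF coboundary_in_cochains[OF unit_in_cochains] zero_in_cochains])
  fix c :: "('a, 'b) chains" assume c: "c \<in> chains_of X"
  have "degree_sign (cap (coboundary X (unit_cochain X)) c) = 0"
    using cap_boundary[OF c, of "unit_cochain X"] c by (simp add: cap_unit boundary_in_chains_of)
  then have "cap (coboundary X (unit_cochain X)) c = 0"
    using degree_sign_degree_sign[OF cap_in_chains_of[OF c]] by (metis chain_linear_0 chain_linear_degree_sign)
  moreover have "chain_eval (coboundary X (unit_cochain X)) c =
      chain_eval (unit_cochain X) (cap (coboundary X (unit_cochain X)) c)"
    using c by (simp add: cup_unit_left coboundary_in_cochains unit_in_cochains flip: chain_eval_cup)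
  ultimately show "chain_eval (coboundary X (unit_cochain X)) c = chain_eval (\<lambda>_. 0) c" by simp
qed

lemma ring_cocycle_ring: "ring (cocycle_ring R X)"
proof (rule ringI)
  show "abelian_group (cocycle_ring R X)"
  proof (rule abelian_groupI)
    fix \<phi> assume "\<phi> \<in> carrier (cocycle_ring R X)"
    then show "\<exists>\<psi>\<in>carrier (cocycle_ring R X). \<psi> \<oplus>\<^bsub>cocycle_ring R X\<^esub> \<phi> = \<zero>\<^bsub>cocycle_ring R X\<^esub>"
      by (intro bexI[of _ "\<lambda>s. - \<phi> s"]) (auto simp: cocycle_ring_simps uminus_in_cochains coboundary_neg)
  qed (auto simp: cocycle_ring_simps add_in_cochains coboundary_add zero_in_cochains algebra_simps)
  show "monoid (cocycle_ring R X)"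
  proof (rule monoidI)
    fix \<phi> \<psi> assume "\<phi> \<in> carrier (cocycle_ring R X)" "\<psi> \<in> carrier (cocycle_ring R X)"
    then show "\<phi> \<otimes>\<^bsub>cocycle_ring R X\<^esub> \<psi> \<in> carrier (cocycle_ring R X)"
      by (auto simp: cocycle_ring_simps cup_in_cochains coboundary_cup_cocycle) (simp add: fun_eq_iff cup_eq)
  qed (auto simp: cocycle_ring_simps cup_assoc cup_unit_left cup_unit_right unit_in_cochains coboundary_unit)
qed (auto simp: cocycle_ring_simps cup_add_left cup_add_right)

lemma ideal_coboundaries:
  fixes R :: "'r::{comm_ring,comm_monoid_mult} itself" and X :: "'a topology"
  shows "ideal (coboundary X ` cochains X) (cocycle_ring R X)"
proof (rule idealI[OF ring_cocycle_ring])
  interpret ring "cocycle_ring R X" by (rule ring_cocycle_ring)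
  have inv: "inv\<^bsub>add_monoid (cocycle_ring R X)\<^esub> \<phi> = (\<lambda>s. - \<phi> s)" if "\<phi> \<in> carrier (cocycle_ring R X)" for \<phi>
  proof -
    have "\<ominus>\<^bsub>cocycle_ring R X\<^esub> \<phi> = (\<lambda>s. - \<phi> s)"
      by (rule minus_equality) (use that in \<open>auto simp: cocycle_ring_simps uminus_in_cochains coboundary_neg\<close>)
    then show ?thesis by (simp add: a_inv_def)
  qed
  have sub: "coboundary X ` cochains X \<subseteq> carrier (cocycle_ring R X)"
    by (auto simp: cocycle_ring_simps coboundary_in_cochains coboundary_coboundary)
  show "subgroup (coboundary X ` cochains X) (add_monoid (cocycle_ring R X))"
  proof
    fix x y :: "('a, 'r) cochain" assume "x \<in> coboundary X ` cochains X" "y \<in> coboundary X ` cochains X"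
    then show "x \<otimes>\<^bsub>add_monoid (cocycle_ring R X)\<^esub> y \<in> coboundary X ` cochains X"
      by (auto simp: cocycle_ring_simps add_in_cochains simp flip: coboundary_add)
  next
    show "\<one>\<^bsub>add_monoid (cocycle_ring R X)\<^esub> \<in> coboundary X ` cochains X"
      using zero_in_cochains[of X] coboundary_zero[of X] by (auto simp: cocycle_ring_simps intro!: image_eqI)
  next
    fix x :: "('a, 'r) cochain" assume x: "x \<in> coboundary X ` cochains X"
    then show "inv\<^bsub>add_monoid (cocycle_ring R X)\<^esub> x \<in> coboundary X ` cochains X"
      using inv[of x] sub by (auto simp: uminus_in_cochains simp flip: coboundary_neg)
  qed (use sub in auto)
  fix \<phi> \<psi> :: "('a, 'r) cochain" assume *: "\<phi> \<in> coboundary X ` cochains X" "\<psi> \<in> carrier (cocycle_ring R X)"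
  then show "\<psi> \<otimes>\<^bsub>cocycle_ring R X\<^esub> \<phi> \<in> coboundary X ` cochains X"
    by (auto simp: cocycle_ring_simps cup_coboundary cup_in_cochains sign_in_cochains)
  show "\<phi> \<otimes>\<^bsub>cocycle_ring R X\<^esub> \<psi> \<in> coboundary X ` cochains X"
    using * by (auto simp: cocycle_ring_simps cup_in_cochains simp flip: coboundary_cup_cocycle)
qed

definition cohomology_class :: "'a topology \<Rightarrow> ('a, 'r::{comm_ring,comm_monoid_mult}) cochain \<Rightarrow> ('a, 'r) cochain set"
  where "cohomology_class X \<phi> = (coboundary X ` cochains X) +>\<^bsub>cocycle_ring TYPE('r) X\<^esub> \<phi>"

lemma in_cohomology_class: "\<rho> \<in> cohomology_class X \<phi> \<longleftrightarrow> (\<exists>\<psi>\<in>cochains X. \<rho> = (\<lambda>s. coboundary X \<psi> s + \<phi> s))"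
  by (auto simp: cohomology_class_def a_r_coset_def' cocycle_ring_simps)

lemma carrier_cohomology:
  "carrier (cohomology (R :: 'r::{comm_ring,comm_monoid_mult} itself) X) = cohomology_class X ` carrier (cocycle_ring R X)"
  by (auto simp: cohomology_def FactRing_def A_RCOSETS_def' cohomology_class_def a_r_coset_def' cocycle_ring_simps)

lemma cohomologyE:
  assumes "A \<in> carrier (cohomology R X)"
  obtains \<phi> where "\<phi> \<in> carrier (cocycle_ring R X)" "A = cohomology_class X \<phi>"
  using assms by (auto simp: carrier_cohomology)

lemma cocycle_ring_TYPE: "cocycle_ring (R :: 'r::{comm_ring,comm_monoid_mult} itself) X = cocycle_ring TYPE('r) X"
  by (simp add: cocycle_ring_def)

lemma add_cohomology:
  assumes "\<phi> \<in> carrier (cocycle_ring R X)" "\<psi> \<in> carrier (cocycle_ring R X)"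
  shows "cohomology_class X \<phi> \<oplus>\<^bsub>cohomology R X\<^esub> cohomology_class X \<psi> = cohomology_class X (\<lambda>s. \<phi> s + \<psi> s)"
proof -
  interpret ideal "coboundary X ` cochains X" "cocycle_ring R X" by (rule ideal_coboundaries)
  show ?thesis
    using a_rcos_sum[OF assms] by (simp add: cohomology_def FactRing_def cohomology_class_def add_cocycle_ring cocycle_ring_TYPE[of R])
qed

lemma mult_cohomology:
  assumes "\<phi> \<in> carrier (cocycle_ring R X)" "\<psi> \<in> carrier (cocycle_ring R X)"
  shows "cohomology_class X \<phi> \<otimes>\<^bsub>cohomology R X\<^esub> cohomology_class X \<psi> = cohomology_class X (cup X \<phi> \<psi>)"
proof -
  interpret ideal "coboundary X ` cochains X" "cocycle_ring R X" by (rule ideal_coboundaries)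
  show ?thesis
    using rcoset_mult_add[OF assms] by (simp add: cohomology_def FactRing_def cohomology_class_def mult_cocycle_ring cocycle_ring_TYPE[of R])
qed

lemma one_cohomology: "\<one>\<^bsub>cohomology R X\<^esub> = cohomology_class X (unit_cochain X)"
  by (simp add: cohomology_def FactRing_def cohomology_class_def one_cocycle_ring cocycle_ring_TYPE[of R])

lemma ring_cohomology: "ring (cohomology R X)"
  unfolding cohomology_def by (rule ideal.quotient_is_ring[OF ideal_coboundaries])

subsection \<open>Naturality and the action on homology\<close>

lemma chain_eval_pull:
  assumes "c \<in> chains_of Y" shows "chain_eval (pull_cochain Y f \<phi>) c = chain_eval \<phi> (push_chain f c)"
  by (subst chain_eval_linear[OF chain_linear_push], rule chain_eval_cong[OF assms])
    (simp add: pull_cochain_def push_single)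

lemma pull_in_cochains: "\<phi> \<in> cochains X \<Longrightarrow> pull_cochain Y f \<phi> \<in> cochains Y"
  by (fastforce simp: cochains_def pull_cochain_def)

text \<open>The projection formula: taking front and back faces commutes with composition by
  \<open>f\<close>. Naturality of cup products and linearity of induced maps derive from it.\<close>

lemma push_cap_pull:
  assumes "c \<in> chains_of Y" shows "push_chain f (cap (pull_cochain Y f \<phi>) c) = cap \<phi> (push_chain f c)"
proof (rule chain_linear_eqI[OF chain_linear_compose[OF chain_linear_push chain_linear_cap]
      chain_linear_compose[OF chain_linear_cap chain_linear_push] assms])
  fix n \<sigma> assume \<sigma>: "singular_simplex n Y \<sigma>"
  show "push_chain f (cap (pull_cochain Y f \<phi>) (Poly_Mapping.single (n, \<sigma>) 1)) = cap \<phi> (push_chain f (Poly_Mapping.single (n, \<sigma>) 1))"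
    using singular_simplex_back_face[OF \<sigma>]
    by (auto simp: push_single cap_single chain_linear_sum[OF chain_linear_push] pull_cochain_def
        simplex_map_front_face[of _ n] simplex_map_back_face intro!: sum.cong)
qed

lemma pull_coboundary:
  assumes "continuous_map Y X f" "\<phi> \<in> cochains X"
  shows "pull_cochain Y f (coboundary X \<phi>) = coboundary Y (pull_cochain Y f \<phi>)"
  by (rule cochains_eqI[where X=Y])
    (simp_all add: assms pull_in_cochains[where X=X] coboundary_in_cochains chain_eval_pull chain_eval_coboundary
      push_in_chains_of[OF assms(1)] boundary_in_chains_of boundary_push)

lemma pull_cup:
  assumes "continuous_map Y X f" "\<phi> \<in> cochains X" "\<psi> \<in> cochains X"
  shows "pull_cochain Y f (cup X \<phi> \<psi>) = cup Y (pull_cochain Y f \<phi>) (pull_cochain Y f \<psi>)"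
  by (rule cochains_eqI[where X=Y])
    (simp_all add: assms pull_in_cochains[where X=X] cup_in_cochains chain_eval_pull chain_eval_cup
      push_in_chains_of[OF assms(1)] cap_in_chains_of push_cap_pull)

lemma pull_add: "pull_cochain Y f (\<lambda>s. \<phi> s + \<psi> s) = (\<lambda>s. pull_cochain Y f \<phi> s + pull_cochain Y f \<psi> s)"
  by (auto simp: pull_cochain_def fun_eq_iff)

lemma pull_zero: "pull_cochain Y f (\<lambda>s. 0) = (\<lambda>s. 0)"
  by (auto simp: pull_cochain_def fun_eq_iff)

lemma pull_unit:
  assumes "continuous_map Y X f" shows "pull_cochain Y f (unit_cochain X) = unit_cochain Y"
  using singular_simplex_simplex_map[OF _ assms] by (auto simp: pull_cochain_def unit_cochain_def fun_eq_iff)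

text \<open>Agreement on the points of \<open>Y\<close> suffices because simplices see nothing else;
  the projections to \<open>X\<close> are compatible only there.\<close>

lemma pull_pull:
  assumes "continuous_map Y Z f" "\<And>y. y \<in> topspace Y \<Longrightarrow> q (f y) = p y"
  shows "pull_cochain Y f (pull_cochain Z q \<phi>) = pull_cochain Y p \<phi>"
proof -
  have "simplex_map n q (simplex_map n f \<sigma>) = simplex_map n p \<sigma>" if "singular_simplex n Y \<sigma>" for n \<sigma>
    using simplex_map_eq[OF that, of "q \<circ> f" p] assms(2) by (simp add: simplex_map_compose)
  then have "pull_cochain Y f (pull_cochain Z q \<phi>) (n, \<sigma>) = pull_cochain Y p \<phi> (n, \<sigma>)" for n \<sigma>
    using singular_simplex_simplex_map[OF _ assms(1)] by (simp add: pull_cochain_def)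
  then show ?thesis by auto
qed

lemma pull_in_cocycles:
  assumes "continuous_map Y X f" "\<phi> \<in> carrier (cocycle_ring R X)"
  shows "pull_cochain Y f \<phi> \<in> carrier (cocycle_ring R Y)"
  using assms by (auto simp: cocycle_ring_simps pull_in_cochains pull_zero simp flip: pull_coboundary)

lemma cap_rel_cycles:
  assumes "\<phi> \<in> carrier (cocycle_ring R Y)" "c \<in> rel_cycles Y B" shows "cap \<phi> c \<in> rel_cycles Y B"
  using assms by (auto simp: rel_cycles_def cocycle_ring_simps cap_in_chains_of cap_cocycle_boundary)

lemma cap_rel_boundaries:
  assumes "\<phi> \<in> carrier (cocycle_ring R Y)" "c \<in> rel_boundaries Y B" shows "cap \<phi> c \<in> rel_boundaries Y B"
proof -
  obtain d b where db: "d \<in> chains_of Y" "b \<in> chains_of (subtopology Y B)" "c = boundary d + b"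
    using assms(2) by (rule rel_boundariesE)
  show ?thesis
    by (rule rel_boundariesI[of "cap \<phi> d" _ "cap \<phi> b"])
      (use assms(1) db in \<open>auto simp: cocycle_ring_simps cap_in_chains_of cap_cocycle_boundary cap_add\<close>)
qed

text \<open>On a cycle the Leibniz rule leaves only the boundary of a cap product, and the degree
  sign maps boundaries to boundaries.\<close>

lemma cap_coboundary_cycle:
  assumes "c \<in> rel_cycles Y {}" shows "cap (coboundary Y \<psi>) c \<in> rel_boundaries Y {}"
proof -
  have c: "c \<in> chains_of Y" "boundary c = 0"
    using assms by (auto simp: rel_cycles_empty_iff)
  have "degree_sign (cap (coboundary Y \<psi>) c) = - boundary (cap \<psi> c)"
    using cap_boundary[OF c(1), of \<psi>] by (simp add: c(2))
  then have "cap (coboundary Y \<psi>) c = - degree_sign (boundary (cap \<psi> c))"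
    using degree_sign_degree_sign[OF cap_in_chains_of[OF c(1)]] by (metis chain_linear_uminus chain_linear_degree_sign)
  also have "\<dots> = boundary (degree_sign (cap \<psi> c))"
    by (simp add: degree_sign_boundary[OF cap_in_chains_of[OF c(1)]])
  finally show ?thesis
    using c(1) by (auto simp: rel_boundaries_empty_iff intro!: degree_sign_in_chains_of cap_in_chains_of)
qed

text \<open>The action is a union over three choices: a representative in \<open>X\<close>, one of
  its pullback, and one of the homology class. All choices give the same coset, so a single one
  computes it.\<close>

lemma homology_action_class:
  assumes "continuous_map Y X \<pi>" "\<phi> \<in> carrier (cocycle_ring R X)" "c \<in> rel_cycles Y {}"
  shows "homology_action Y \<pi> (cohomology_class X \<phi>) (homology_class Y {} c) =
    homology_class Y {} (cap (pull_cochain Y \<pi> \<phi>) c)"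
proof -
  have "homology_class Y {} (cap \<rho> c') = homology_class Y {} (cap (pull_cochain Y \<pi> \<phi>) c)"
    if \<phi>': "\<phi>' \<in> cohomology_class X \<phi>" and \<rho>: "\<rho> \<in> cohomology_class Y (pull_cochain Y \<pi> \<phi>')"
      and c': "c' \<in> homology_class Y {} c" for \<phi>' \<rho> c'
  proof -
    obtain \<psi> where \<psi>: "\<psi> \<in> cochains X" "\<phi>' = (\<lambda>s. coboundary X \<psi> s + \<phi> s)"
      using \<phi>' unfolding in_cohomology_class by blast
    obtain \<psi>' where \<psi>': "\<psi>' \<in> cochains Y" "\<rho> = (\<lambda>s. coboundary Y \<psi>' s + pull_cochain Y \<pi> \<phi>' s)"
      using \<rho> unfolding in_cohomology_class by blast
    \<comment> \<open>Collects both changes of cochain representative into one coboundary on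
      \<open>Y\<close>.\<close>
    define \<theta> where "\<theta> = (\<lambda>s. \<psi>' s + pull_cochain Y \<pi> \<psi> s)"
    have eq: "\<rho> = (\<lambda>s. coboundary Y \<theta> s + pull_cochain Y \<pi> \<phi> s)"
      by (simp add: \<psi>' \<psi> \<theta>_def pull_add pull_coboundary[OF assms(1)] coboundary_add add.assoc)
    have b: "c' - c \<in> rel_boundaries Y {}"
      using c' by (simp add: in_homology_class)
    have "(c' - c) + c \<in> rel_cycles Y {}"
      using b rel_boundaries_subset[of Y "{}"] assms(3) by (intro rel_cycles_add) auto
    then have c'Y: "c' \<in> rel_cycles Y {}" by simp
    have "cap \<rho> c' - cap (pull_cochain Y \<pi> \<phi>) c = cap (coboundary Y \<theta>) c' + cap (pull_cochain Y \<pi> \<phi>) (c' - c)"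
      unfolding eq cap_plus by (simp add: cap_diff)
    also have "\<dots> \<in> rel_boundaries Y {}"
      by (intro rel_boundaries_add cap_coboundary_cycle[OF c'Y] cap_rel_boundaries[OF pull_in_cocycles[OF assms(1,2)] b])
    finally show ?thesis by (simp add: homology_class_eq_iff)
  qed
  note key = this
  have self: "\<phi> \<in> cohomology_class X \<phi>" for X :: "'x topology" and \<phi> :: "('x, 'c) cochain"
    using zero_in_cochains[of X] by (force simp: in_cohomology_class intro: bexI[of _ "\<lambda>_. 0"])
  have mem: "x \<in> homology_action Y \<pi> (cohomology_class X \<phi>) (homology_class Y {} c) \<longleftrightarrow>
      (\<exists>\<phi>'\<in>cohomology_class X \<phi>. \<exists>\<rho>\<in>cohomology_class Y (pull_cochain Y \<pi> \<phi>').
        \<exists>c'\<in>homology_class Y {} c. x \<in> homology_class Y {} (cap \<rho> c'))" for x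
    unfolding homology_action_def cap_class_def cohomology_map_def cohomology_class_def[symmetric] by simp
  show ?thesis
  proof (rule Set.set_eqI)
    fix x
    show "x \<in> homology_action Y \<pi> (cohomology_class X \<phi>) (homology_class Y {} c) \<longleftrightarrow>
        x \<in> homology_class Y {} (cap (pull_cochain Y \<pi> \<phi>) c)"
    proof
      assume "x \<in> homology_action Y \<pi> (cohomology_class X \<phi>) (homology_class Y {} c)"
      then obtain \<phi>' \<rho> c' where "\<phi>' \<in> cohomology_class X \<phi>" "\<rho> \<in> cohomology_class Y (pull_cochain Y \<pi> \<phi>')"
        "c' \<in> homology_class Y {} c" "x \<in> homology_class Y {} (cap \<rho> c')"
        unfolding mem by blast
      then show "x \<in> homology_class Y {} (cap (pull_cochain Y \<pi> \<phi>) c)" using key by simp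
    next
      assume "x \<in> homology_class Y {} (cap (pull_cochain Y \<pi> \<phi>) c)"
      then show "x \<in> homology_action Y \<pi> (cohomology_class X \<phi>) (homology_class Y {} c)"
        unfolding mem by (intro bexI[OF _ self] bexI[OF _ homology_class_self])
    qed
  qed
qed

text \<open>The axiom for products is \<open>cap_cup\<close>, which has no sign since the cap
  product evaluates on back faces; the unit axiom is \<open>cap_unit\<close>.\<close>

lemma left_module_homology:
  assumes "continuous_map Y X \<pi>"
  shows "left_module (cohomology R X) (homology R Y) (homology_action Y \<pi>)"
proof -
  note cl = homology_action_class[where R=R, OF assms]
  note pc = pull_in_cocycles[where R=R, OF assms]
  interpret C: ring "cocycle_ring R X" by (rule ring_cocycle_ring)
  interpret H: comm_group "homology R Y" by (rule comm_group_rel_homology)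
  interpret A: ring "cohomology R X" by (rule ring_cohomology)
  note closed = C.a_closed[unfolded add_cocycle_ring] C.m_closed[unfolded mult_cocycle_ring] C.one_closed[unfolded one_cocycle_ring]
  show ?thesis
  proof
    fix a b x y
    assume "a \<in> carrier (cohomology R X)" "b \<in> carrier (cohomology R X)"
      and "x \<in> carrier (homology R Y)" "y \<in> carrier (homology R Y)"
    then obtain \<phi> \<psi> c d where *: "\<phi> \<in> carrier (cocycle_ring R X)" "a = cohomology_class X \<phi>"
      "\<psi> \<in> carrier (cocycle_ring R X)" "b = cohomology_class X \<psi>"
      "c \<in> rel_cycles Y {}" "x = homology_class Y {} c" "d \<in> rel_cycles Y {}" "y = homology_class Y {} d"
      by (meson cohomologyE rel_homologyE)
    then show "homology_action Y \<pi> (a \<oplus>\<^bsub>cohomology R X\<^esub> b) x = homology_action Y \<pi> a x \<otimes>\<^bsub>homology R Y\<^esub> homology_action Y \<pi> b x"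
      by (simp add: add_cohomology cl closed pull_add cap_plus mult_rel_homology cap_rel_cycles[OF pc])
    show "homology_action Y \<pi> a (x \<otimes>\<^bsub>homology R Y\<^esub> y) = homology_action Y \<pi> a x \<otimes>\<^bsub>homology R Y\<^esub> homology_action Y \<pi> a y"
      using * by (simp add: cl mult_rel_homology cap_rel_cycles[OF pc] rel_cycles_add cap_add)
    have "cap (pull_cochain Y \<pi> (cup X \<phi> \<psi>)) c = cap (pull_cochain Y \<pi> \<phi>) (cap (pull_cochain Y \<pi> \<psi>) c)"
      using * by (subst pull_cup[OF assms]) (auto simp: cocycle_ring_simps rel_cycles_def intro!: cap_cup)
    then show "homology_action Y \<pi> (a \<otimes>\<^bsub>cohomology R X\<^esub> b) x = homology_action Y \<pi> a (homology_action Y \<pi> b x)"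
      using * by (simp add: cl mult_cohomology closed cap_rel_cycles[OF pc])
  next
    fix a x assume "a \<in> carrier (cohomology R X)" "x \<in> carrier (homology R Y)"
    then obtain \<phi> c where *: "\<phi> \<in> carrier (cocycle_ring R X)" "a = cohomology_class X \<phi>"
      "c \<in> rel_cycles Y {}" "x = homology_class Y {} c"
      by (meson cohomologyE rel_homologyE)
    then show "homology_action Y \<pi> a x \<in> carrier (homology R Y)"
      by (simp add: cl homology_class_in_carrier cap_rel_cycles[OF pc])
  next
    fix x assume "x \<in> carrier (homology R Y)"
    then obtain c where *: "c \<in> rel_cycles Y {}" "x = homology_class Y {} c"
      by (meson rel_homologyE)
    moreover have "cap (pull_cochain Y \<pi> (unit_cochain X)) c = c"
      using *(1) by (simp add: pull_unit[OF assms] cap_unit rel_cycles_def)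
    ultimately show "homology_action Y \<pi> \<one>\<^bsub>cohomology R X\<^esub> x = x"
      by (simp add: one_cohomology cl[OF closed(3)])
  qed
qed

lemma induced_map_linear:
  assumes "continuous_map Y Z f" "continuous_map Z X q" "\<And>y. y \<in> topspace Y \<Longrightarrow> q (f y) = p y"
  shows "induced_map Z {} f \<in> linear_hom (cohomology R X) (homology R Y) (homology_action Y p)
    (homology R Z) (homology_action Z q)"
proof -
  have f: "pair_map Y {} Z {} f" using assms(1) by (simp add: pair_map_empty)
  have "continuous_map Y X (q \<circ> f)" by (rule continuous_map_compose[OF assms(1,2)])
  then have p: "continuous_map Y X p" by (rule continuous_map_eq) (use assms(3) in simp)
  show ?thesis
    unfolding linear_hom_def
  proof (intro CollectI conjI ballI)
    show "induced_map Z {} f \<in> hom (homology R Y) (homology R Z)"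
      by (rule induced_map_hom[OF f])
    fix a x assume "a \<in> carrier (cohomology R X)" "x \<in> carrier (homology R Y)"
    then obtain \<phi> c where *: "\<phi> \<in> carrier (cocycle_ring R X)" "a = cohomology_class X \<phi>"
      "c \<in> rel_cycles Y {}" "x = homology_class Y {} c"
      by (meson cohomologyE rel_homologyE)
    have "push_chain f (cap (pull_cochain Y p \<phi>) c) = cap (pull_cochain Z q \<phi>) (push_chain f c)"
      using push_cap_pull[of c Y f "pull_cochain Z q \<phi>"] *(3) pull_pull[of Y Z f q p \<phi>, OF assms(1,3)] by (simp add: rel_cycles_def)
    then show "induced_map Z {} f (homology_action Y p a x) = homology_action Z q a (induced_map Z {} f x)"
      using * by (simp add: homology_action_class[OF p] homology_action_class[OF assms(2)] induced_map_class[OF f] push_rel_cycles[OF f])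
  qed
qed

subsection \<open>Homogeneous components\<close>

text \<open>Having the projection as a linear operator on chains lets degrees be treated like cap
  products, as an operation with which the residue is compatible.\<close>

definition degree_part :: "nat \<Rightarrow> ('a, 'r::{comm_ring,comm_monoid_mult}) chains \<Rightarrow> ('a, 'r) chains"
  where "degree_part n = chain_extend (\<lambda>(m, \<sigma>). if m = n then Poly_Mapping.single (m, \<sigma>) 1 else 0)"

lemma chain_linear_degree_part [simp, intro]: "chain_linear (degree_part n)"
  by (simp add: degree_part_def)

lemmas degree_part_0 [simp] = chain_linear_0[OF chain_linear_degree_part]
  and degree_part_add = chain_linear_add[OF chain_linear_degree_part]
  and degree_part_diff = chain_linear_diff[OF chain_linear_degree_part]

lemma degree_part_single: "degree_part n (Poly_Mapping.single (m, \<sigma>) r) = (if m = n then Poly_Mapping.single (m, \<sigma>) r else 0)"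
  by (simp add: degree_part_def)

lemma lookup_degree_part: "Poly_Mapping.lookup (degree_part n c) s = (if fst s = n then Poly_Mapping.lookup c s else 0)"
proof -
  have "Poly_Mapping.lookup (degree_part n c) s =
      (\<Sum>t\<in>Poly_Mapping.keys c. if t = s then (if fst s = n then Poly_Mapping.lookup c s else 0) else 0)"
    unfolding degree_part_def chain_extend_eq lookup_sum
    by (rule sum.cong) (auto simp: lookup_single when_def split: prod.splits)
  then show ?thesis by (auto simp: in_keys_iff)
qed

lemma homogeneous_iff: "(\<forall>s\<in>Poly_Mapping.keys c. fst s = n) \<longleftrightarrow> degree_part n c = c"
  by (auto simp: poly_mapping_eq_iff fun_eq_iff lookup_degree_part in_keys_iff) (metis fst_conv in_keys_iff)

lemma degree_part_idem [simp]: "degree_part n (degree_part n c) = degree_part n c"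
  by (rule poly_mapping_eqI) (simp add: lookup_degree_part)

lemma degree_part_in_chains_of: "c \<in> chains_of Y \<Longrightarrow> degree_part n c \<in> chains_of Y"
  by (rule chain_linear_closed[OF chain_linear_degree_part]) (auto simp: degree_part_single intro: chains_of_single)

lemma push_degree_part:
  assumes "c \<in> chains_of Y" shows "push_chain f (degree_part n c) = degree_part n (push_chain f c)"
  by (rule chain_linear_eqI[OF chain_linear_compose[OF chain_linear_push chain_linear_degree_part]
        chain_linear_compose[OF chain_linear_degree_part chain_linear_push] assms])
    (auto simp: push_single degree_part_single)

text \<open>The projection is a chain map up to a shift of the degree. Degree 0 has no predecessor
  and is covered by \<open>boundary_degree_part_0\<close>.\<close>

lemma boundary_degree_part_Suc:
  assumes "c \<in> chains_of Y" shows "boundary (degree_part (Suc n) c) = degree_part n (boundary c)"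
proof (rule chain_linear_eqI[OF chain_linear_compose[OF chain_linear_boundary chain_linear_degree_part]
        chain_linear_compose[OF chain_linear_degree_part chain_linear_boundary] assms])
  fix m \<sigma>
  show "boundary (degree_part (Suc n) (Poly_Mapping.single (m, \<sigma>) (1::'b))) =
      degree_part n (boundary (Poly_Mapping.single (m, \<sigma> :: (nat \<Rightarrow> real) \<Rightarrow> 'a) 1))"
    by (cases m) (auto simp: degree_part_single boundary_single_eq chain_linear_sum[OF chain_linear_degree_part]
        simp del: sum.atMost_Suc)
qed

lemma boundary_degree_part_0:
  assumes "c \<in> chains_of Y" shows "boundary (degree_part 0 c) = 0"
  by (rule chain_linear_eqI[OF chain_linear_compose[OF chain_linear_boundary chain_linear_degree_part] chain_linear_zero assms])
    (auto simp: degree_part_single boundary_single_eq)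

lemma degree_part_rel_cycles:
  assumes "c \<in> rel_cycles Y B" shows "degree_part n c \<in> rel_cycles Y B"
  using assms by (cases n) (auto simp: rel_cycles_def degree_part_in_chains_of boundary_degree_part_0 boundary_degree_part_Suc)

lemma degree_part_rel_boundaries:
  assumes "c \<in> rel_boundaries Y B" shows "degree_part n c \<in> rel_boundaries Y B"
proof -
  obtain d b where db: "d \<in> chains_of Y" "b \<in> chains_of (subtopology Y B)" "c = boundary d + b"
    using assms by (rule rel_boundariesE)
  show ?thesis
    by (rule rel_boundariesI[of "degree_part (Suc n) d" _ "degree_part n b"])
      (use db in \<open>auto simp: degree_part_in_chains_of boundary_degree_part_Suc degree_part_add\<close>)
qed

lemma homology_degree_eq:
  "homology_degree R Y n = homology_class Y {} ` {c \<in> rel_cycles Y {}. degree_part n c = c}"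
  by (simp add: homology_degree_def homogeneous_iff)

lemma homology_degree_induced:
  assumes "continuous_map Y Z f"
  shows "induced_map Z {} f ` homology_degree R Y n \<subseteq> homology_degree R Z n"
proof -
  have f: "pair_map Y {} Z {} f" using assms by (simp add: pair_map_empty)
  have "degree_part n (push_chain f c) = push_chain f c" if "c \<in> rel_cycles Y {}" "degree_part n c = c" for c :: "('a, 'c) chains"
    using push_degree_part[of c Y f n] that by (simp add: rel_cycles_def)
  then show ?thesis
    by (auto simp: homology_degree_eq induced_map_class[OF f] push_rel_cycles[OF f])
qed

section \<open>The homology of a cylinder relative to its ends\<close>

abbreviation cylinder_boundary :: "'e topology \<Rightarrow> (real \<times> 'e) topology"
  where "cylinder_boundary S \<equiv> subtopology (cylinder S) (cylinder_ends S)"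

text \<open>A simplex in the ends of the cylinder stays in one end because it is connected, so its
  value at vertex 0 decides which. On such chains this is the projection to one summand, followed by
  the identification of the end with the sphere bundle.\<close>

definition end_part :: "real \<Rightarrow> (real \<times> 'e, 'r::{comm_ring,comm_monoid_mult}) chains \<Rightarrow> ('e, 'r) chains"
  where "end_part t = chain_extend (\<lambda>(n, \<sigma>).
    if fst (\<sigma> (\<lambda>j. if j = 0 then 1 else 0)) = t then Poly_Mapping.single (n, simplex_map n snd \<sigma>) 1 else 0)"

lemma chain_linear_end_part [simp, intro]: "chain_linear (end_part t)"
  by (simp add: end_part_def)

lemmas end_part_0 [simp] = chain_linear_0[OF chain_linear_end_part]
  and end_part_add = chain_linear_add[OF chain_linear_end_part]
  and end_part_diff = chain_linear_diff[OF chain_linear_end_part]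

lemma end_part_single: "end_part t (Poly_Mapping.single (n, \<sigma>) 1) =
    (if fst (\<sigma> (\<lambda>j. if j = 0 then 1 else 0)) = t then Poly_Mapping.single (n, simplex_map n snd \<sigma>) 1 else 0)"
  by (simp add: end_part_def)

lemma continuous_map_cylinder_end:
  "t \<in> {1/2, 1} \<Longrightarrow> continuous_map S (cylinder_boundary S) (Pair t)"
  by (auto simp: cylinder_def cylinder_ends_def continuous_map_in_subtopology continuous_map_pairwise o_def)

lemma continuous_map_cylinder_end': "t \<in> {1/2..1} \<Longrightarrow> continuous_map S (cylinder S) (Pair t)"
  by (simp add: cylinder_def continuous_map_pairwise o_def)

lemma continuous_map_cylinder_snd: "continuous_map (cylinder S) S snd"
  by (simp add: cylinder_def continuous_map_snd)

lemma continuous_map_cylinder_boundary_snd: "continuous_map (cylinder_boundary S) S snd"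
  by (intro continuous_map_from_subtopology continuous_map_cylinder_snd)

text \<open>The first coordinate maps the connected simplex to a two-point set of reals, hence is
  constant.\<close>

lemma cylinder_boundary_simplex:
  assumes "singular_simplex n (cylinder_boundary S) \<sigma>"
  obtains t where "t \<in> {1/2, 1}" "\<And>x. x \<in> standard_simplex n \<Longrightarrow> fst (\<sigma> x) = t"
    "\<sigma> = simplex_map n (Pair t) (simplex_map n snd \<sigma>)"
proof -
  let ?D = "subtopology (powertop_real UNIV) (standard_simplex n)"
  let ?e = "\<lambda>j::nat. if j = 0 then 1 else 0 :: real"
  have \<sigma>: "continuous_map ?D (cylinder S) \<sigma>" "\<And>x. x \<in> standard_simplex n \<Longrightarrow> \<sigma> x \<in> cylinder_ends S"
    "\<sigma> \<in> extensional (standard_simplex n)"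
    using assms by (auto simp: singular_simplex_def continuous_map_in_subtopology)
  have "continuous_map (cylinder S) euclideanreal fst"
    unfolding cylinder_def using continuous_map_fst continuous_map_into_fulltopology by blast
  then have "continuous_map ?D euclideanreal (fst \<circ> \<sigma>)"
    by (rule continuous_map_compose[OF \<sigma>(1)])
  moreover have "connectedin ?D (standard_simplex n)"
    using connectedin_standard_simplex by (simp add: connectedin_subtopology)
  ultimately have "connected ((fst \<circ> \<sigma>) ` standard_simplex n)"
    using connectedin_continuous_map_image connectedin_iff_connected by metis
  moreover have sub: "(fst \<circ> \<sigma>) ` standard_simplex n \<subseteq> {1/2, 1}"
    using \<sigma>(2) by (fastforce simp: cylinder_ends_def)
  then have "finite ((fst \<circ> \<sigma>) ` standard_simplex n)"
    by (rule finite_subset) simp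
  ultimately obtain t where t: "(fst \<circ> \<sigma>) ` standard_simplex n = {t}"
    using connected_finite_iff_sing[of "(fst \<circ> \<sigma>) ` standard_simplex n"] nonempty_standard_simplex[of n] by auto
  then have fst: "fst (\<sigma> x) = t" if "x \<in> standard_simplex n" for x
    using that by force
  have "\<sigma> x = simplex_map n (Pair t) (simplex_map n snd \<sigma>) x" for x
    using \<sigma>(3) fst by (cases "x \<in> standard_simplex n") (auto simp: simplex_map_def extensional_def prod_eq_iff)
  moreover have "t \<in> {1/2, 1}" using t sub by blast
  ultimately show thesis using that fst by blast
qed

lemma end_part_in_chains_of: "c \<in> chains_of (cylinder_boundary S) \<Longrightarrow> end_part t c \<in> chains_of S"
  by (rule chain_linear_closed[OF chain_linear_end_part])
    (auto simp: end_part_single intro!: chains_of_single singular_simplex_simplex_map[OF _ continuous_map_cylinder_boundary_snd])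

lemma end_part_decomposition:
  assumes "c \<in> chains_of (cylinder_boundary S)"
  shows "c = push_chain (Pair (1/2)) (end_part (1/2) c) + push_chain (Pair 1) (end_part 1 c)"
proof (rule chain_linear_eqI[OF chain_linear_id(2) chain_linear_plus[OF chain_linear_compose[OF chain_linear_push chain_linear_end_part]
        chain_linear_compose[OF chain_linear_push chain_linear_end_part]] assms])
  fix n \<sigma> assume "singular_simplex n (cylinder_boundary S) \<sigma>"
  then obtain t where t: "t \<in> {1/2, 1}" "\<And>x. x \<in> standard_simplex n \<Longrightarrow> fst (\<sigma> x) = t"
    "\<sigma> = simplex_map n (Pair t) (simplex_map n snd \<sigma>)"
    by (rule cylinder_boundary_simplex) blast
  have "fst (\<sigma> (\<lambda>j. if j = 0 then 1 else 0)) = t" by (rule t(2)) simp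
  note e0 = this
  have "t = 1/2 \<or> t = 1" using t(1) by blast
  then show "Poly_Mapping.single (n, \<sigma>) 1 = push_chain (Pair (1/2)) (end_part (1/2) (Poly_Mapping.single (n, \<sigma>) 1)) +
      push_chain (Pair 1) (end_part 1 (Poly_Mapping.single (n, \<sigma>) 1))"
  proof (elim disjE)
    assume tt: "t = 1/2"
    show ?thesis using e0[unfolded tt] t(3)[symmetric, unfolded tt] by (simp add: end_part_single push_single)
  next
    assume tt: "t = 1"
    show ?thesis using e0[unfolded tt] t(3)[symmetric, unfolded tt] by (simp add: end_part_single push_single)
  qed
qed

lemma end_part_push:
  assumes "y \<in> chains_of S" shows "end_part t (push_chain (Pair s) y) = (if s = t then y else 0)"
proof (cases "s = t")
  case True
  have "end_part t (push_chain (Pair t) y) = y"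
  proof (rule chain_linear_eqI[OF chain_linear_compose[OF chain_linear_end_part chain_linear_push] chain_linear_id(2) assms])
    fix n \<sigma> assume "singular_simplex n S \<sigma>"
    then have "simplex_map n snd (simplex_map n (Pair t) \<sigma>) = \<sigma>"
      by (auto simp: simplex_map_def singular_simplex_def extensional_def fun_eq_iff)
    then show "end_part t (push_chain (Pair t) (Poly_Mapping.single (n, \<sigma>) 1)) = Poly_Mapping.single (n, \<sigma>) 1"
      by (simp add: push_single end_part_single) (simp add: simplex_map_def)
  qed
  then show ?thesis using True by simp
next
  case False
  then have "end_part t (push_chain (Pair s) y) = 0"
    by (intro chain_linear_eqI[OF chain_linear_compose[OF chain_linear_end_part chain_linear_push] chain_linear_zero assms])
      (simp add: push_single end_part_single, simp add: simplex_map_def)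
  then show ?thesis using False by simp
qed

text \<open>Since a chain on the ends is the sum of its two parts, an operator compatible with both
  inclusions is compatible with the projections. The boundary, the degree projection and the cap
  product are all treated this way.\<close>

lemma end_part_natural:
  assumes c: "c \<in> chains_of (cylinder_boundary S)" and t: "t \<in> {1/2, 1}"
    and T: "chain_linear T" and U: "\<And>y. y \<in> chains_of S \<Longrightarrow> U y \<in> chains_of S"
    and TU: "\<And>s y. \<lbrakk>s \<in> {1/2, 1}; y \<in> chains_of S\<rbrakk> \<Longrightarrow> T (push_chain (Pair s) y) = push_chain (Pair s) (U y)"
  shows "end_part t (T c) = U (end_part t c)"
proof -
  have "T c = push_chain (Pair (1/2)) (U (end_part (1/2) c)) + push_chain (Pair 1) (U (end_part 1 c))"
    by (subst end_part_decomposition[OF c])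
      (simp add: chain_linear_add[OF T] TU end_part_in_chains_of[OF c])
  note Tc = this
  have "t = 1/2 \<or> t = 1" using t by blast
  then show ?thesis
  proof (elim disjE)
    assume tt: "t = 1/2"
    show ?thesis unfolding tt by (simp add: Tc end_part_add end_part_push[OF U] end_part_in_chains_of[OF c])
  next
    assume tt: "t = 1"
    show ?thesis unfolding tt by (simp add: Tc end_part_add end_part_push[OF U] end_part_in_chains_of[OF c])
  qed
qed

lemma boundary_end_part:
  assumes "c \<in> chains_of (cylinder_boundary S)" "t \<in> {1/2, 1}"
  shows "end_part t (boundary c) = boundary (end_part t c)"
  by (rule end_part_natural[OF assms chain_linear_boundary]) (auto simp: boundary_in_chains_of boundary_push)

lemma degree_part_end_part:
  assumes "c \<in> chains_of (cylinder_boundary S)" "t \<in> {1/2, 1}"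
  shows "end_part t (degree_part n c) = degree_part n (end_part t c)"
  by (rule end_part_natural[OF assms chain_linear_degree_part]) (auto simp: degree_part_in_chains_of push_degree_part)

lemma cap_end_part:
  fixes c :: "(real \<times> 'e, 'r::{comm_ring,comm_monoid_mult}) chains"
  assumes c: "c \<in> chains_of (cylinder_boundary S)" and t: "t \<in> {1/2, 1}" and \<phi>: "\<phi> \<in> cochains S"
  shows "end_part t (cap (pull_cochain (cylinder S) snd \<phi>) c) = cap \<phi> (end_part t c)"
proof (rule end_part_natural[OF c t chain_linear_cap])
  fix s and y :: "('e, 'r) chains" assume s: "s \<in> {1/2, 1 :: real}" and y: "y \<in> chains_of S"
  have "continuous_map S (cylinder S) (Pair s)"
    using s by (intro continuous_map_cylinder_end') auto
  then have "pull_cochain S (Pair s) (pull_cochain (cylinder S) snd \<phi>) = pull_cochain S id \<phi>"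
    by (rule pull_pull) simp
  \<comment> \<open>Pulling back along the identity restricts simplices to the standard simplex,
    which changes nothing as they are extensional.\<close>
  moreover have "cap (pull_cochain S id \<phi>) y = cap \<phi> y"
    by (rule cap_cong[OF y]) (simp add: pull_cochain_def singular_simplex_def extensional_restrict)
  ultimately show "cap (pull_cochain (cylinder S) snd \<phi>) (push_chain (Pair s) y) = push_chain (Pair s) (cap \<phi> y)"
    using push_cap_pull[OF y, of "Pair s" "pull_cochain (cylinder S) snd \<phi>"] by simp
qed (rule cap_in_chains_of)

text \<open>Existence for the definite description is the decomposition into the two end parts;
  uniqueness holds because \<open>end_part 1\<close> kills the other summand and preserves
  boundaries.\<close>

lemma end_projection_class:
  assumes c: "c \<in> rel_cycles (cylinder_boundary S) {}"
  shows "end_projection S (homology_class (cylinder_boundary S) {} c) = homology_class S {} (end_part 1 c)"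
proof -
  let ?D = "cylinder_boundary S"
  have cD: "c \<in> chains_of ?D" and bc: "boundary c = 0"
    using c by (auto simp: rel_cycles_empty_iff)
  have i: "pair_map S {} ?D {} (Pair t)" if "t \<in> {1/2, 1}" for t
    using continuous_map_cylinder_end[OF that] by (simp add: pair_map_empty)
  have cyc: "end_part t c \<in> rel_cycles S {}" if "t \<in> {1/2, 1}" for t
    using end_part_in_chains_of[OF cD] boundary_end_part[OF cD that] bc by (simp add: rel_cycles_empty_iff)
  show ?thesis
    unfolding end_projection_def Let_def
  proof (rule the_equality)
    show "homology_class S {} (end_part 1 c) \<in> carrier (homology TYPE('b) S) \<and>
      (\<exists>z\<in>carrier (homology TYPE('b) S). homology_class ?D {} c =
        induced_map ?D {} (Pair (1/2)) z \<otimes>\<^bsub>homology TYPE('b) ?D\<^esub> induced_map ?D {} (Pair 1) (homology_class S {} (end_part 1 c)))"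
    proof (intro conjI bexI)
      show "homology_class ?D {} c = induced_map ?D {} (Pair (1/2)) (homology_class S {} (end_part (1/2) c))
        \<otimes>\<^bsub>homology TYPE('b) ?D\<^esub> induced_map ?D {} (Pair 1) (homology_class S {} (end_part 1 c))"
        using end_part_decomposition[OF cD]
        by (simp add: induced_map_class[OF i] mult_rel_homology push_rel_cycles[OF i] cyc)
    qed (simp_all add: homology_class_in_carrier cyc)
  next
    fix Y assume *: "Y \<in> carrier (homology TYPE('b) S) \<and>
      (\<exists>z\<in>carrier (homology TYPE('b) S). homology_class ?D {} c =
        induced_map ?D {} (Pair (1/2)) z \<otimes>\<^bsub>homology TYPE('b) ?D\<^esub> induced_map ?D {} (Pair 1) Y)"
    then obtain y z where y: "y \<in> rel_cycles S {}" "Y = homology_class S {} y" and z: "z \<in> rel_cycles S {}"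
      and eq: "homology_class ?D {} c = induced_map ?D {} (Pair (1/2)) (homology_class S {} z)
        \<otimes>\<^bsub>homology TYPE('b) ?D\<^esub> induced_map ?D {} (Pair 1) (homology_class S {} y)"
      by (metis rel_homologyE)
    then have "c - (push_chain (Pair (1/2)) z + push_chain (Pair 1) y) \<in> rel_boundaries ?D {}"
      by (simp add: induced_map_class[OF i] mult_rel_homology push_rel_cycles[OF i] homology_class_eq_iff)
    then obtain d where d: "d \<in> chains_of ?D" "c - (push_chain (Pair (1/2)) z + push_chain (Pair 1) y) = boundary d"
      by (auto simp: rel_boundaries_empty_iff)
    \<comment> \<open>The chain at the end 1/2 disappears, so a homology between the two expressions
      in the cylinder ends restricts to one between \<open>end_part 1 c\<close> and
      \<open>y\<close>.\<close>
    have "end_part 1 (boundary d) = end_part 1 c - y"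
      using y z by (simp add: end_part_diff end_part_add end_part_push[of _ S] rel_cycles_def flip: d(2))
    then have "y - end_part 1 c = boundary (- end_part 1 d)"
      using boundary_end_part[OF d(1), of 1] by (simp add: boundary_uminus)
    then have "y - end_part 1 c \<in> rel_boundaries S {}"
      using end_part_in_chains_of[OF d(1)] by (auto simp: rel_boundaries_empty_iff)
    then show "Y = homology_class S {} (end_part 1 c)"
      by (simp add: y homology_class_eq_iff)
  qed
qed

section \<open>The map \<Theta>\<close>

lemma connecting_map_class:
  assumes "c \<in> rel_cycles Y B"
  shows "connecting_map Y B (homology_class Y B c) = homology_class (subtopology Y B) {} (boundary c)"
proof -
  have "homology_class (subtopology Y B) {} (boundary c') = homology_class (subtopology Y B) {} (boundary c)"
    if c': "c' \<in> homology_class Y B c" for c'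
  proof -
    obtain d b where db: "d \<in> chains_of Y" "b \<in> chains_of (subtopology Y B)" "c' - c = boundary d + b"
      using rel_boundariesE[OF c'[unfolded in_homology_class]] by blast
    \<comment> \<open>Changing the representative changes the boundary by that of a chain inside
      \<open>B\<close>, hence by a boundary there.\<close>
    have "boundary c' - boundary c = boundary (boundary d + b)"
      by (simp only: db(3) flip: boundary_diff)
    then have "boundary c' - boundary c = boundary b"
      by (simp add: boundary_add boundary_boundary[OF db(1)])
    then show ?thesis
      using db(2) by (intro homology_class_eqI) (auto simp: rel_boundaries_empty_iff)
  qed
  then show ?thesis
    unfolding connecting_map_def using homology_class_self[of c Y B] by blast
qed

lemma boundary_rel_cycle: "c \<in> rel_cycles Y B \<Longrightarrow> boundary c \<in> rel_cycles (subtopology Y B) {}"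
  by (auto simp: rel_cycles_def boundary_boundary)

lemma theta_map_class:
  assumes "c \<in> rel_cycles (cylinder S) (cylinder_ends S)"
  shows "theta_map S (homology_class (cylinder S) (cylinder_ends S) c) = homology_class S {} (end_part 1 (boundary c))"
  using assms by (simp add: theta_map_def connecting_map_class end_projection_class boundary_rel_cycle)

lemma end_part_boundary_cycle:
  assumes "c \<in> rel_cycles (cylinder S) (cylinder_ends S)" "t \<in> {1/2, 1}"
  shows "end_part t (boundary c) \<in> rel_cycles S {}"
proof -
  have "boundary c \<in> chains_of (cylinder_boundary S)" "boundary (boundary c) = 0"
    using boundary_rel_cycle[OF assms(1)] by (auto simp: rel_cycles_empty_iff)
  then show ?thesis
    using boundary_end_part[of "boundary c" S t] end_part_in_chains_of[of "boundary c" S t] assms(2)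
    by (simp add: rel_cycles_empty_iff)
qed

text \<open>Injectivity: if the boundary at the end 1 bounds, a chain \<open>w\<close> on the ends
  corrects \<open>c\<close> to an absolute cycle, and sliding the cylinder to the end 1 moves this
  cycle into the ends. Surjectivity: take the prism over a cycle of \<open>S\<close>.\<close>

lemma theta_map_iso:
  "theta_map S \<in> iso (rel_homology R (cylinder S) (cylinder_ends S)) (homology R S)"
proof (rule rel_homology_isoI[where T="\<lambda>c. end_part 1 (boundary c)", OF theta_map_class])
  let ?C = "cylinder S" and ?E = "cylinder_ends S" and ?D = "cylinder_boundary S"
  note push_D = push_in_chains_of[OF continuous_map_cylinder_end]
  note push_C = push_in_chains_of[OF continuous_map_cylinder_end']
  note push_S = push_in_chains_of[OF continuous_map_cylinder_snd]
  fix c assume c: "c \<in> rel_cycles ?C ?E" and b: "end_part 1 (boundary c) \<in> rel_boundaries S {}"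
  have cC: "c \<in> chains_of ?C" and bD: "boundary c \<in> chains_of ?D"
    using c by (auto simp: rel_cycles_def)
  obtain y where y: "y \<in> chains_of S" "end_part 1 (boundary c) = boundary y"
    using b by (auto simp: rel_boundaries_empty_iff)
  have snd_push: "push_chain snd (push_chain (Pair t) x) = x" if "x \<in> chains_of S" for t :: real and x
    unfolding push_push by (rule push_id[OF that]) simp
  \<comment> \<open>The projection of \<open>c\<close> to \<open>S\<close> bounds the sum of both
    end parts; removing \<open>y\<close> leaves a chain bounding the part at 1/2.\<close>
  define z where "z = push_chain snd c - y"
  have zS: "z \<in> chains_of S" using push_S[OF cC] y(1) by (simp add: z_def chains_of_diff)
  have "boundary (push_chain snd c) = end_part (1/2) (boundary c) + end_part 1 (boundary c)"
    unfolding boundary_push[OF cC]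
    by (subst end_part_decomposition[OF bD]) (simp add: push_add snd_push end_part_in_chains_of[OF bD])
  then have bz: "boundary z = end_part (1/2) (boundary c)"
    using y(2) by (simp add: z_def boundary_diff)
  define w where "w = push_chain (Pair (1/2 :: real)) z + push_chain (Pair 1) y"
  have wD: "w \<in> chains_of ?D" unfolding w_def by (intro chains_of_add push_D zS y(1)) auto
  then have wC: "w \<in> chains_of ?C" by (rule chains_of_subtopology_subset)
  have "boundary w = boundary c"
    by (subst end_part_decomposition[OF bD]) (simp add: w_def boundary_add boundary_push[OF zS] boundary_push[OF y(1)] bz y(2))
  then have cyc: "c - w \<in> rel_cycles ?C {}"
    using cC wC by (simp add: rel_cycles_empty_iff chains_of_diff boundary_diff)
  \<comment> \<open>The linear homotopy from the identity of the cylinder to the projection onto the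
    end 1.\<close>
  have F: "continuous_map (prod_topology (top_of_set {0..1}) ?C) ?C (\<lambda>(u, p). ((1 - u) * fst p + u, snd p))"
  proof -
    have "continuous_map (prod_topology (top_of_set {0..1}) ?C) euclideanreal fst"
      using continuous_map_fst continuous_map_into_fulltopology by blast
    moreover have "continuous_map ?C euclideanreal fst" "continuous_map ?C S snd"
      unfolding cylinder_def using continuous_map_fst continuous_map_into_fulltopology continuous_map_snd by blast+
    then have "continuous_map (prod_topology (top_of_set {0..1}) ?C) euclideanreal (\<lambda>x. fst (snd x))"
      "continuous_map (prod_topology (top_of_set {0..1}) ?C) S (\<lambda>x. snd (snd x))"
      using continuous_map_of_snd by (force simp: o_def)+
    ultimately have 1: "continuous_map (prod_topology (top_of_set {0..1}) ?C) euclideanreal (\<lambda>x. (1 - fst x) * fst (snd x) + fst x)"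
      "continuous_map (prod_topology (top_of_set {0..1}) ?C) S (\<lambda>x. snd (snd x))"
      by (auto intro!: continuous_map_add continuous_map_real_mult continuous_map_diff)
    have "1/2 \<le> (1 - u) * r + u \<and> (1 - u) * r + u \<le> 1" if "0 \<le> u" "u \<le> 1" "1/2 \<le> r" "r \<le> 1" for u r :: real
    proof -
      have "(1 - u) * (1/2) \<le> (1 - u) * r" "(1 - u) * r \<le> (1 - u) * 1"
        using that by (intro mult_left_mono; simp)+
      then show ?thesis using that by (simp add: field_simps)
    qed
    then have 2: "(1 - fst x) * fst (snd x) + fst x \<in> {1/2..1}" if "x \<in> topspace (prod_topology (top_of_set {0..1}) ?C)" for x
      using that by (force simp: cylinder_def)
    show ?thesis
      unfolding cylinder_def continuous_map_pairwise continuous_map_in_subtopology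
      using 1 2 by (auto simp: o_def split_def simp flip: cylinder_def)
  qed
  have "push_chain (Pair 1 \<circ> snd) (c - w) - push_chain (\<lambda>x. x) (c - w) \<in> rel_boundaries ?C {}"
    by (rule homotopic_rel_cycles[OF F _ cyc]) auto
  moreover have "push_chain (\<lambda>x. x) (c - w) = c - w"
    using cyc by (auto simp: rel_cycles_def intro: push_id)
  ultimately obtain d where d: "d \<in> chains_of ?C" "push_chain (Pair 1 \<circ> snd) (c - w) - (c - w) = boundary d"
    by (auto simp: rel_boundaries_empty_iff)
  have "push_chain (Pair 1 \<circ> snd) (c - w) \<in> chains_of ?D"
    using cC wC by (simp only: push_push[symmetric]) (intro push_D push_S chains_of_diff; simp)
  then have "push_chain (Pair 1 \<circ> snd) (c - w) + w \<in> chains_of ?D"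
    using wD by (rule chains_of_add)
  then show "c \<in> rel_boundaries ?C ?E"
    by (rule rel_boundariesI[of "- d", rotated]) (use d in \<open>simp_all add: boundary_uminus flip: d(2)\<close>)
next
  let ?C = "cylinder S" and ?E = "cylinder_ends S" and ?D = "cylinder_boundary S"
  fix y :: "('a, 'b) chains" assume y: "y \<in> rel_cycles S {}"
  have yS: "y \<in> chains_of S" and by0: "boundary y = 0"
    using y by (auto simp: rel_cycles_empty_iff)
  \<comment> \<open>Identifies \<open>[0, 1]\<close> with \<open>[1/2, 1]\<close>, increasing so
    that the end 1 enters the boundary of the prism with sign plus.\<close>
  define F where "F = (\<lambda>(u::real, v::'a). ((1 + u) / 2, v))"
  have F: "continuous_map (prod_topology (top_of_set {0..1}) S) ?C F"
  proof -
    have "continuous_map (prod_topology (top_of_set {0..1::real}) S) euclideanreal fst"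
      using continuous_map_fst continuous_map_into_fulltopology by blast
    then have "continuous_map (prod_topology (top_of_set {0..1::real}) S) euclideanreal (\<lambda>x. (1 + fst x) / 2)"
      by (auto intro!: continuous_map_add continuous_map_real_divide)
    then show ?thesis
      unfolding cylinder_def continuous_map_pairwise continuous_map_in_subtopology
      by (auto simp: F_def o_def split_def continuous_map_snd)
  qed
  obtain P :: "('a, 'b) chains \<Rightarrow> (real \<times> 'a, 'b) chains" where P: "chain_linear P" "P y \<in> chains_of ?C"
    "boundary (P y) + P (boundary y) = push_chain (\<lambda>x. F (1, x)) y - push_chain (\<lambda>x. F (0, x)) y"
    by (rule homotopy_operator[OF F]) (use yS in blast)
  have F01: "(\<lambda>x. F (1, x)) = Pair 1" "(\<lambda>x. F (0, x)) = Pair (1/2)"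
    by (auto simp: F_def)
  have bP: "boundary (P y) = push_chain (Pair 1) y - push_chain (Pair (1/2)) y"
    using P(3) by (simp add: by0 chain_linear_0[OF P(1)] F01)
  then have "P y \<in> rel_cycles ?C ?E"
    using P(2) push_in_chains_of[OF continuous_map_cylinder_end yS, of 1] push_in_chains_of[OF continuous_map_cylinder_end yS, of "1/2"]
    by (simp add: rel_cycles_def chains_of_diff)
  moreover have "end_part 1 (boundary (P y)) = y"
    by (simp add: bP end_part_diff end_part_push[OF yS])
  ultimately show "\<exists>c\<in>rel_cycles ?C ?E. end_part 1 (boundary c) - y \<in> rel_boundaries S {}"
    by (intro bexI[of _ "P y"]) auto
qed (auto simp: boundary_add end_part_add end_part_boundary_cycle)

section \<open>The pinched compactification\<close>

locale hermitian_bundle =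
  fixes X :: "'a topology" and \<xi> :: "('a, 'e) vbundle" and h :: "'e \<Rightarrow> 'e \<Rightarrow> complex"
  assumes is_bundle: "complex_vector_bundle X \<xi>" and is_metric: "hermitian_metric \<xi> h"
begin

abbreviation "E \<equiv> total \<xi>"

definition rscale :: "real \<Rightarrow> 'e \<Rightarrow> 'e"
  where "rscale r v = vscale \<xi> (complex_of_real r) v"

lemma continuous_bproj: "continuous_map E X (bproj \<xi>)"
  using is_bundle by (simp add: complex_vector_bundle_def)

lemma bproj_in: "v \<in> topspace E \<Longrightarrow> bproj \<xi> v \<in> topspace X"
  using continuous_map_image_subset_topspace[OF continuous_bproj] by auto

lemma local_coordinates:
  assumes "v \<in> topspace E"
  obtains U n \<Phi> z where "openin X U" "local_trivialisation X \<xi> U n \<Phi>" "bproj \<xi> v \<in> topspace X \<inter> U"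
    "z \<in> topspace (complex_space n)" "v = \<Phi> (bproj \<xi> v, z)"
proof -
  obtain U n \<Phi> where U: "openin X U" "bproj \<xi> v \<in> U" and triv: "local_trivialisation X \<xi> U n \<Phi>"
    using is_bundle bproj_in[OF assms] by (auto simp: complex_vector_bundle_def)
  have "\<Phi> ` topspace (prod_topology (subtopology X U) (complex_space n)) = topspace (subtopology E {v. bproj \<xi> v \<in> U})"
    using triv homeomorphic_imp_surjective_map unfolding local_trivialisation_def by blast
  then have "v \<in> \<Phi> ` topspace (prod_topology (subtopology X U) (complex_space n))"
    using assms U(2) by auto
  then obtain x z where xz: "x \<in> topspace X \<inter> U" "z \<in> topspace (complex_space n)" "v = \<Phi> (x, z)"
    by auto
  then have "bproj \<xi> v = x"
    using triv by (simp add: local_trivialisation_def)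
  then show thesis using that[OF U(1) triv] xz by blast
qed

lemma topspace_complex_space: "topspace (complex_space n) = {z. \<forall>i\<ge>n. z i = 0}"
  by (simp add: complex_space_def)

lemma trivialisation_in_total:
  assumes "local_trivialisation X \<xi> U n \<Phi>" "x \<in> topspace X \<inter> U" "z \<in> topspace (complex_space n)"
  shows "\<Phi> (x, z) \<in> topspace E" "bproj \<xi> (\<Phi> (x, z)) = x"
proof -
  have "\<Phi> ` topspace (prod_topology (subtopology X U) (complex_space n)) = topspace (subtopology E {v. bproj \<xi> v \<in> U})"
    using assms homeomorphic_imp_surjective_map unfolding local_trivialisation_def by blast
  moreover have "(x, z) \<in> topspace (prod_topology (subtopology X U) (complex_space n))"
    using assms by simp
  ultimately show "\<Phi> (x, z) \<in> topspace E" by auto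
  show "bproj \<xi> (\<Phi> (x, z)) = x" using assms by (simp add: local_trivialisation_def)
qed

text \<open>A bundle carries its vector space axioms only through local trivialisations, so each law
  is read off from the coordinates.\<close>

lemma vscale_in: "v \<in> topspace E \<Longrightarrow> vscale \<xi> c v \<in> topspace E"
  and bproj_vscale: "v \<in> topspace E \<Longrightarrow> bproj \<xi> (vscale \<xi> c v) = bproj \<xi> v"
  and vscale_vscale: "v \<in> topspace E \<Longrightarrow> vscale \<xi> c (vscale \<xi> d v) = vscale \<xi> (c * d) v"
  and vscale_one: "v \<in> topspace E \<Longrightarrow> vscale \<xi> 1 v = v"
  and vscale_0: "v \<in> topspace E \<Longrightarrow> vscale \<xi> 0 v = vzero \<xi> (bproj \<xi> v)"
proof -
  assume v: "v \<in> topspace E"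
  obtain U n \<Phi> z where U: "local_trivialisation X \<xi> U n \<Phi>" "bproj \<xi> v \<in> topspace X \<inter> U"
    "z \<in> topspace (complex_space n)" "v = \<Phi> (bproj \<xi> v, z)"
    by (rule local_coordinates[OF v]) blast
  have cz: "(\<lambda>i. c * w i) \<in> topspace (complex_space n)" if "w \<in> topspace (complex_space n)" for c w
    using that by (simp add: topspace_complex_space)
  have sc: "vscale \<xi> c (\<Phi> (bproj \<xi> v, w)) = \<Phi> (bproj \<xi> v, \<lambda>i. c * w i)" if "w \<in> topspace (complex_space n)" for c w
    using U that by (simp add: local_trivialisation_def)
  have vz: "vzero \<xi> (bproj \<xi> v) = \<Phi> (bproj \<xi> v, \<lambda>_. 0)"
    using U unfolding local_trivialisation_def by blast
  have vs: "vscale \<xi> c v = \<Phi> (bproj \<xi> v, \<lambda>i. c * z i)" for c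
    using sc[OF U(3)] U(4) by metis
  show "vscale \<xi> c v \<in> topspace E" "bproj \<xi> (vscale \<xi> c v) = bproj \<xi> v"
    unfolding vs using trivialisation_in_total[OF U(1,2) cz[OF U(3)]] by auto
  show "vscale \<xi> c (vscale \<xi> d v) = vscale \<xi> (c * d) v"
    unfolding vs sc[OF cz[OF U(3)]] by (simp add: mult.assoc)
  show "vscale \<xi> 1 v = v" using vs[of 1] U(4) by simp
  show "vscale \<xi> 0 v = vzero \<xi> (bproj \<xi> v)" using vs[of 0] vz by simp
qed

lemma vzero_in: "x \<in> topspace X \<Longrightarrow> vzero \<xi> x \<in> topspace E"
  and bproj_vzero: "x \<in> topspace X \<Longrightarrow> bproj \<xi> (vzero \<xi> x) = x"
proof -
  assume x: "x \<in> topspace X"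
  then obtain U n \<Phi> where U: "x \<in> topspace X \<inter> U" "local_trivialisation X \<xi> U n \<Phi>"
    using is_bundle unfolding complex_vector_bundle_def by blast
  have 0: "(\<lambda>_. 0) \<in> topspace (complex_space n)" by (simp add: topspace_complex_space)
  then have "vzero \<xi> x = \<Phi> (x, \<lambda>_. 0)"
    using U unfolding local_trivialisation_def by blast
  then show "vzero \<xi> x \<in> topspace E" "bproj \<xi> (vzero \<xi> x) = x"
    using trivialisation_in_total[OF U(2,1) 0] by auto
qed

lemma vscale_vzero: "x \<in> topspace X \<Longrightarrow> vscale \<xi> c (vzero \<xi> x) = vzero \<xi> x"
  using vscale_0[OF vzero_in] vscale_vscale[OF vzero_in, of x c 0] by (simp add: bproj_vzero)

lemma openin_over: "openin X U \<Longrightarrow> openin E {v \<in> topspace E. bproj \<xi> v \<in> U}"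
  by (rule openin_continuous_map_preimage[OF continuous_bproj])

lemma subtopology_over: "subtopology E {v \<in> topspace E. bproj \<xi> v \<in> U} = subtopology E {v. bproj \<xi> v \<in> U}"
proof -
  have "{v \<in> topspace E. bproj \<xi> v \<in> U} = topspace E \<inter> {v. bproj \<xi> v \<in> U}" by auto
  then show ?thesis by (metis subtopology_restrict)
qed

text \<open>Scaling is jointly continuous because it is coordinatewise multiplication over each
  trivialising open set, and these local pieces are pasted.\<close>

lemma continuous_rscale: "continuous_map (prod_topology euclideanreal E) E (\<lambda>(r, v). rscale r v)"
proof (rule pasting_lemma[where I="{U. openin X U \<and> (\<exists>n \<Phi>. local_trivialisation X \<xi> U n \<Phi>)}"
      and T="\<lambda>U. UNIV \<times> {v \<in> topspace E. bproj \<xi> v \<in> U}" and f="\<lambda>_ (r, v). rscale r v"])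
  fix U assume "U \<in> {U. openin X U \<and> (\<exists>n \<Phi>. local_trivialisation X \<xi> U n \<Phi>)}"
  then obtain n \<Phi> where U: "openin X U" and triv: "local_trivialisation X \<xi> U n \<Phi>" by blast
  show "openin (prod_topology euclideanreal E) (UNIV \<times> {v \<in> topspace E. bproj \<xi> v \<in> U})"
    using openin_over[OF U] by (simp add: openin_prod_Times_iff)
  let ?XU = "subtopology X U" and ?EU = "subtopology E {v. bproj \<xi> v \<in> U}" and ?C = "complex_space n"
  obtain \<Psi> where "homeomorphic_maps (prod_topology ?XU ?C) ?EU \<Phi> \<Psi>"
    using triv unfolding local_trivialisation_def homeomorphic_map_maps by blast
  then have \<Phi>: "continuous_map (prod_topology ?XU ?C) ?EU \<Phi>" and \<Psi>: "continuous_map ?EU (prod_topology ?XU ?C) \<Psi>"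
    and inv: "\<And>v. v \<in> topspace ?EU \<Longrightarrow> \<Phi> (\<Psi> v) = v"
    by (auto simp: homeomorphic_maps_def)
  \<comment> \<open>Scaling as seen in a trivialisation.\<close>
  define m where "m = (\<lambda>(r::real, x::'a, z::nat \<Rightarrow> complex). (x, \<lambda>i. complex_of_real r * z i))"
  let ?RXC = "prod_topology euclideanreal (prod_topology ?XU ?C)"
  have m: "continuous_map ?RXC (prod_topology ?XU ?C) m"
    unfolding continuous_map_pairwise
  proof
    show "continuous_map ?RXC ?XU (fst \<circ> m)"
      using continuous_map_compose[OF continuous_map_snd continuous_map_fst, of euclideanreal ?XU ?C]
      by (simp add: m_def o_def split_def)
    have mult: "continuous_map (euclidean :: (real \<times> complex) topology) euclidean (\<lambda>p. complex_of_real (fst p) * snd p)"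
      by (simp add: continuous_intros)
    have "continuous_map ?C euclidean (\<lambda>z. z i)" for i
      unfolding complex_space_def by (intro continuous_map_from_subtopology continuous_map_product_projection) simp
    then have "continuous_map ?RXC euclidean (\<lambda>p. snd (snd p) i)" for i
      using continuous_map_compose[OF continuous_map_compose[OF continuous_map_snd continuous_map_snd], of ?C euclidean "\<lambda>z. z i" euclideanreal ?XU]
      by (simp add: o_def)
    then have "continuous_map ?RXC (prod_topology euclidean euclidean) (\<lambda>p. (fst p, snd (snd p) i))" for i
      by (simp add: continuous_map_pairwise o_def continuous_map_fst del: prod_topology_euclidean)
    then have "continuous_map ?RXC euclidean (\<lambda>p. complex_of_real (fst p) * snd (snd p) i)" for i
      using continuous_map_compose[OF _ mult, of ?RXC "\<lambda>p. (fst p, snd (snd p) i)"] by (simp add: o_def)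
    then have "continuous_map ?RXC (product_topology (\<lambda>_. euclidean) UNIV) (\<lambda>p i. complex_of_real (fst p) * snd (snd p) i)"
      by (simp add: continuous_map_componentwise_UNIV del: euclidean_product_topology)
    then show "continuous_map ?RXC ?C (snd \<circ> m)"
      by (auto simp: complex_space_def continuous_map_in_subtopology m_def o_def split_def simp del: euclidean_product_topology)
  qed
  have "continuous_map (prod_topology euclideanreal ?EU) ?RXC (\<lambda>(r, v). (r, \<Psi> v))"
    using continuous_map_compose[OF continuous_map_snd \<Psi>, of euclideanreal]
    by (simp add: continuous_map_pairwise o_def split_def continuous_map_fst)
  from continuous_map_compose[OF continuous_map_compose[OF this m] \<Phi>]
  have "continuous_map (prod_topology euclideanreal ?EU) ?EU (\<lambda>(r, v). rscale r v)"
  proof (rule continuous_map_eq)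
    fix p assume "p \<in> topspace (prod_topology euclideanreal ?EU)"
    then obtain r v where p: "p = (r, v)" "v \<in> topspace ?EU" by auto
    obtain x z where xz: "\<Psi> v = (x, z)" by fastforce
    have "\<Psi> v \<in> topspace (prod_topology ?XU ?C)"
      using \<Psi> p(2) continuous_map_image_subset_topspace by blast
    then have "x \<in> topspace X \<inter> U" "z \<in> topspace ?C" by (auto simp: xz)
    then have "vscale \<xi> (complex_of_real r) (\<Phi> (x, z)) = \<Phi> (x, \<lambda>i. complex_of_real r * z i)"
      using triv unfolding local_trivialisation_def by blast
    moreover have "\<Phi> (x, z) = v" using inv[OF p(2)] by (simp add: xz)
    ultimately show "(\<Phi> \<circ> (m \<circ> (\<lambda>(r, v). (r, \<Psi> v)))) p = (\<lambda>(r, v). rscale r v) p"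
      by (simp add: p xz m_def rscale_def)
  qed
  then have "continuous_map (prod_topology euclideanreal ?EU) E (\<lambda>(r, v). rscale r v)"
    by (rule continuous_map_into_fulltopology)
  then show "continuous_map (subtopology (prod_topology euclideanreal E) (UNIV \<times> {v \<in> topspace E. bproj \<xi> v \<in> U})) E (\<lambda>(r, v). rscale r v)"
    by (simp add: subtopology_Times subtopology_over)
next
  fix p :: "real \<times> 'e" assume "p \<in> topspace (prod_topology euclideanreal E)"
  then obtain r v where p: "p = (r, v)" "v \<in> topspace E" by auto
  then obtain U n \<Phi> where "openin X U" "local_trivialisation X \<xi> U n \<Phi>" "bproj \<xi> v \<in> U"
    using local_coordinates by blast
  then show "\<exists>U. U \<in> {U. openin X U \<and> (\<exists>n \<Phi>. local_trivialisation X \<xi> U n \<Phi>)} \<and>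
      p \<in> UNIV \<times> {v \<in> topspace E. bproj \<xi> v \<in> U} \<and> (\<lambda>(r, v). rscale r v) p = (\<lambda>(r, v). rscale r v) p"
    using p by blast
qed simp

lemma continuous_map_rscale:
  assumes "continuous_map Y euclideanreal f" "continuous_map Y E g"
  shows "continuous_map Y E (\<lambda>y. rscale (f y) (g y))"
  using continuous_map_compose[OF _ continuous_rscale, of Y "\<lambda>y. (f y, g y)"] assms
  by (simp add: continuous_map_pairwise o_def)

lemma continuous_vzero: "continuous_map X E (vzero \<xi>)"
proof (rule pasting_lemma[where I="{U. openin X U \<and> (\<exists>n \<Phi>. local_trivialisation X \<xi> U n \<Phi>)}" and T="\<lambda>U. U" and f="\<lambda>_. vzero \<xi>"])
  fix U assume "U \<in> {U. openin X U \<and> (\<exists>n \<Phi>. local_trivialisation X \<xi> U n \<Phi>)}"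
  then obtain n \<Phi> where U: "openin X U" and triv: "local_trivialisation X \<xi> U n \<Phi>" by blast
  then show "openin X U" by simp
  have 0: "(\<lambda>_. 0) \<in> topspace (complex_space n)" by (simp add: topspace_complex_space)
  have "continuous_map (prod_topology (subtopology X U) (complex_space n)) (subtopology E {v. bproj \<xi> v \<in> U}) \<Phi>"
    using triv homeomorphic_imp_continuous_map unfolding local_trivialisation_def by blast
  moreover have "continuous_map (subtopology X U) (prod_topology (subtopology X U) (complex_space n)) (\<lambda>x. (x, \<lambda>_. 0))"
    using 0 by (simp add: continuous_map_pairwise o_def)
  ultimately have "continuous_map (subtopology X U) (subtopology E {v. bproj \<xi> v \<in> U}) (\<Phi> \<circ> (\<lambda>x. (x, \<lambda>_. 0)))"
    using continuous_map_compose by blast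
  then have "continuous_map (subtopology X U) (subtopology E {v. bproj \<xi> v \<in> U}) (vzero \<xi>)"
  proof (rule continuous_map_eq)
    fix x assume "x \<in> topspace (subtopology X U)"
    then have "x \<in> topspace X \<inter> U" by simp
    then have "vzero \<xi> x = \<Phi> (x, \<lambda>_. 0)" using triv 0 unfolding local_trivialisation_def by blast
    then show "(\<Phi> \<circ> (\<lambda>x. (x, \<lambda>_. 0))) x = vzero \<xi> x" by simp
  qed
  then show "continuous_map (subtopology X U) E (vzero \<xi>)"
    by (rule continuous_map_into_fulltopology)
next
  fix x assume "x \<in> topspace X"
  then show "\<exists>U. U \<in> {U. openin X U \<and> (\<exists>n \<Phi>. local_trivialisation X \<xi> U n \<Phi>)} \<and> x \<in> U \<and> vzero \<xi> x = vzero \<xi> x"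
    using is_bundle unfolding complex_vector_bundle_def by blast
qed simp

lemma continuous_vnorm: "continuous_map E euclideanreal (vnorm h)"
proof -
  let ?T = "subtopology (prod_topology E E) {(v, w). bproj \<xi> v = bproj \<xi> w}"
  have "continuous_map ?T euclidean (\<lambda>(v, w). h v w)"
    using is_metric by (simp add: hermitian_metric_def)
  moreover have "continuous_map E ?T (\<lambda>v. (v, v))"
    by (auto simp: continuous_map_in_subtopology continuous_map_pairwise o_def)
  ultimately have "continuous_map E euclidean ((\<lambda>(v, w). h v w) \<circ> (\<lambda>v. (v, v)))"
    using continuous_map_compose by blast
  moreover have "continuous_map euclidean euclideanreal Re"
    by (simp add: continuous_intros)
  ultimately have "continuous_map E euclideanreal (Re \<circ> ((\<lambda>(v, w). h v w) \<circ> (\<lambda>v. (v, v))))"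
    using continuous_map_compose by blast
  from continuous_map_sqrt[OF this] have "continuous_map E euclideanreal (\<lambda>v. vnorm h v)"
    by (simp add: vnorm_def o_def)
  then show ?thesis by simp
qed

text \<open>The metric is linear in its second argument and conjugate symmetric, so a scalar comes
  out once as \<open>c\<close> and once conjugated.\<close>

lemma metric_scale:
  assumes "v \<in> topspace E" shows "Re (h (vscale \<xi> c v) (vscale \<xi> c v)) = (cmod c)\<^sup>2 * Re (h v v)"
proof -
  have sym: "h w u = cnj (h u w)" and lin: "h u (vscale \<xi> c w) = c * h u w"
    if "u \<in> topspace E" "w \<in> topspace E" "bproj \<xi> u = bproj \<xi> w" for u w c
    using is_metric that unfolding hermitian_metric_def by blast+
  let ?w = "vscale \<xi> c v"
  have w: "?w \<in> topspace E" "bproj \<xi> ?w = bproj \<xi> v" using assms vscale_in bproj_vscale by auto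
  have "h ?w ?w = c * h ?w v" using lin[OF w(1) assms w(2)] .
  also have "h ?w v = cnj (h v ?w)" using sym[OF assms w(1)] w(2) by simp
  also have "h v ?w = c * h v v" using lin[OF assms assms] by simp
  finally have "h ?w ?w = (c * cnj c) * cnj (h v v)" by (simp add: mult.assoc)
  also have "c * cnj c = complex_of_real ((cmod c)\<^sup>2)" by (rule complex_norm_square[symmetric])
  finally show ?thesis by simp
qed

lemma vnorm_vscale: "v \<in> topspace E \<Longrightarrow> vnorm h (vscale \<xi> c v) = cmod c * vnorm h v"
  by (simp add: vnorm_def metric_scale real_sqrt_mult)

lemma rscale_in: "v \<in> topspace E \<Longrightarrow> rscale r v \<in> topspace E"
  and bproj_rscale: "v \<in> topspace E \<Longrightarrow> bproj \<xi> (rscale r v) = bproj \<xi> v"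
  and rscale_rscale: "v \<in> topspace E \<Longrightarrow> rscale r (rscale s v) = rscale (r * s) v"
  and rscale_one: "v \<in> topspace E \<Longrightarrow> rscale 1 v = v"
  and rscale_vzero: "x \<in> topspace X \<Longrightarrow> rscale r (vzero \<xi> x) = vzero \<xi> x"
  and vnorm_rscale: "v \<in> topspace E \<Longrightarrow> vnorm h (rscale r v) = \<bar>r\<bar> * vnorm h v"
  by (simp_all add: rscale_def vscale_in bproj_vscale vscale_vscale vscale_one vscale_0 vscale_vzero vnorm_vscale)

lemma vnorm_vzero: "x \<in> topspace X \<Longrightarrow> vnorm h (vzero \<xi> x) = 0"
  using vnorm_vscale[OF vzero_in, of x 0] by (simp add: vscale_vzero)

lemma vnorm_pos:
  assumes "v \<in> topspace E" "v \<noteq> vzero \<xi> (bproj \<xi> v)" shows "vnorm h v > 0"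
proof -
  have "Re (h v v) > 0" using is_metric assms unfolding hermitian_metric_def by blast
  then show ?thesis by (simp add: vnorm_def)
qed

lemma vnorm_eq_0_iff: "v \<in> topspace E \<Longrightarrow> vnorm h v = 0 \<longleftrightarrow> v = vzero \<xi> (bproj \<xi> v)"
  using vnorm_pos[of v] vnorm_vzero[OF bproj_in, of v] by (cases "v = vzero \<xi> (bproj \<xi> v)") auto

subsection \<open>The quotient map\<close>

abbreviation "S \<equiv> sphere_bundle \<xi> h"
abbreviation "\<Sigma> \<equiv> spherical_compactification \<xi> h"
abbreviation "P \<equiv> pinched \<xi> h"
abbreviation "q \<equiv> pinch \<xi>"
abbreviation "W \<equiv> annulus_compl \<xi> h"
abbreviation "X\<^sub>0 \<equiv> zero_section \<xi> h ` topspace X"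

lemma topspace_S: "v \<in> topspace S \<longleftrightarrow> v \<in> topspace E \<and> vnorm h v = 1"
  by (auto simp: sphere_bundle_def)

lemma topspace_\<Sigma>: "(v, t) \<in> topspace \<Sigma> \<longleftrightarrow> v \<in> topspace E \<and> (vnorm h v)\<^sup>2 + t\<^sup>2 = 1"
  by (auto simp: spherical_compactification_def)

text \<open>Either a pole over a zero vector, where the quotient map identifies, or a point of
  height strictly between -1 and 1, where it is injective.\<close>

lemma \<Sigma>_cases:
  assumes "(v, t) \<in> topspace \<Sigma>"
  obtains "vnorm h v = 0" "t\<^sup>2 = 1" "v = vzero \<xi> (bproj \<xi> v)" | "vnorm h v > 0" "-1 < t" "t < 1" "v \<noteq> vzero \<xi> (bproj \<xi> v)"
proof (cases "v = vzero \<xi> (bproj \<xi> v)")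
  case True
  then show ?thesis using that(1) assms by (simp add: topspace_\<Sigma> flip: vnorm_eq_0_iff)
next
  case False
  then have "vnorm h v > 0" using assms by (simp add: topspace_\<Sigma> vnorm_pos)
  moreover from this have "t\<^sup>2 < 1" using assms by (simp add: topspace_\<Sigma>) (smt (verit) zero_less_power)
  then have "-1 < t" "t < 1" by (auto simp: abs_square_less_1)
  ultimately show ?thesis using that(2) False by blast
qed

lemma \<Sigma>_bounds: "(v, t) \<in> topspace \<Sigma> \<Longrightarrow> -1 \<le> t \<and> t \<le> 1"
  by (erule \<Sigma>_cases) (auto simp: power2_eq_1_iff)

lemma quotient_q: "quotient_map \<Sigma> P q"
  unfolding pinched_def by (rule quotient_map_quotient_topology)

lemma topspace_P: "topspace P = q ` topspace \<Sigma>"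
  by (simp add: pinched_def topspace_quotient_topology)

lemma P_cases:
  assumes "p \<in> topspace P" obtains v t where "(v, t) \<in> topspace \<Sigma>" "p = q (v, t)"
  using assms by (auto simp: topspace_P)

text \<open>Over a zero vector \<open>pinch\<close> forgets \<open>t\<close> altogether; within the
  sphere only the two poles occur there.\<close>

lemma q_eq_iff:
  "q (v, t) = q (w, s) \<longleftrightarrow> v = w \<and> (v = vzero \<xi> (bproj \<xi> v) \<or> t = s)"
  by (auto simp: pinch_def doubleton_eq_iff)

lemma q_zero: "v = vzero \<xi> (bproj \<xi> v) \<Longrightarrow> q (v, t) = q (v, s)"
  by (simp add: q_eq_iff)

text \<open>A set-theoretic section of the quotient map. At a pinched point it picks one of the
  poles arbitrarily, so only expressions with equal values at both poles may be read through
  it.\<close>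

definition point_of :: "('e \<times> real) set \<Rightarrow> 'e \<times> real"
  where "point_of p = (SOME x. x \<in> p)"

lemma point_of_q:
  assumes "(v, t) \<in> topspace \<Sigma>"
  obtains s where "point_of (q (v, t)) = (v, s)" "(v, s) \<in> topspace \<Sigma>" "q (v, s) = q (v, t)"
    "s = t \<or> v = vzero \<xi> (bproj \<xi> v) \<and> s\<^sup>2 = 1 \<and> t\<^sup>2 = 1"
proof -
  have "q (v, t) \<noteq> {}" by (simp add: pinch_def)
  then have in_q: "point_of (q (v, t)) \<in> q (v, t)"
    unfolding point_of_def by (rule some_in_eq[THEN iffD2])
  show thesis
  proof (cases "v = vzero \<xi> (bproj \<xi> v)")
    case True
    then obtain s where s: "point_of (q (v, t)) = (v, s)" "s\<^sup>2 = 1"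
      using in_q by (auto simp: pinch_def power2_eq_1_iff split: if_splits)
    moreover have "t\<^sup>2 = 1" using assms True by (auto elim: \<Sigma>_cases)
    moreover have "(v, s) \<in> topspace \<Sigma>" using s assms \<open>t\<^sup>2 = 1\<close> by (simp add: topspace_\<Sigma>)
    ultimately show thesis using that True by (metis q_zero)
  next
    case False
    then have "point_of (q (v, t)) = (v, t)" using in_q by (simp add: pinch_def)
    then show thesis using that assms by blast
  qed
qed

text \<open>This is how functions on the sphere bundle become functions on the quotient; their
  continuity then follows from the quotient map.\<close>

lemma descend:
  assumes "\<And>v s t. \<lbrakk>(v, t) \<in> topspace \<Sigma>; (v, s) \<in> topspace \<Sigma>; v = vzero \<xi> (bproj \<xi> v)\<rbrakk> \<Longrightarrow> f (v, s) = f (v, t)"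
    and "x \<in> topspace \<Sigma>"
  shows "f (point_of (q x)) = f x"
proof -
  obtain v t where x: "x = (v, t)" by (cases x)
  then have vt: "(v, t) \<in> topspace \<Sigma>" using assms(2) by simp
  obtain s where "point_of (q (v, t)) = (v, s)" "(v, s) \<in> topspace \<Sigma>"
    "s = t \<or> v = vzero \<xi> (bproj \<xi> v) \<and> s\<^sup>2 = 1 \<and> t\<^sup>2 = 1"
    by (rule point_of_q[OF vt]) blast
  then show ?thesis using assms(1)[OF vt] by (auto simp: x)
qed

lemma pinched_proj_q:
  assumes "(v, t) \<in> topspace \<Sigma>" shows "pinched_proj \<xi> (q (v, t)) = bproj \<xi> v"
  unfolding pinched_proj_def by (rule the_equality) (auto simp: pinch_def split: if_splits)

lemma continuous_\<Sigma>_fst: "continuous_map \<Sigma> E fst" and continuous_\<Sigma>_snd: "continuous_map \<Sigma> euclideanreal snd"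
  unfolding spherical_compactification_def
  by (simp_all add: continuous_map_from_subtopology continuous_map_fst continuous_map_snd)

lemma continuous_pinched_proj: "continuous_map P X (pinched_proj \<xi>)"
proof (rule continuous_compose_quotient_map[OF quotient_q])
  have "continuous_map \<Sigma> X (bproj \<xi> \<circ> fst)"
    by (rule continuous_map_compose[OF continuous_\<Sigma>_fst continuous_bproj])
  then show "continuous_map \<Sigma> X (pinched_proj \<xi> \<circ> q)"
    by (rule continuous_map_eq) (auto simp: pinched_proj_q)
qed

lemma pinched_incl_eq: "pinched_incl \<xi> h v = q (rscale (2 / ((vnorm h v)\<^sup>2 + 1)) v, ((vnorm h v)\<^sup>2 - 1) / ((vnorm h v)\<^sup>2 + 1))"
  by (simp only: pinched_incl_def rscale_def)

lemma zero_section_eq: "x \<in> topspace X \<Longrightarrow> zero_section \<xi> h x = q (vzero \<xi> x, -1)"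
  by (simp add: zero_section_def pinched_incl_eq vnorm_vzero rscale_vzero)

lemma pole_in_\<Sigma>: "x \<in> topspace X \<Longrightarrow> t\<^sup>2 = 1 \<Longrightarrow> (vzero \<xi> x, t) \<in> topspace \<Sigma>"
  by (simp add: topspace_\<Sigma> vzero_in vnorm_vzero)

lemma continuous_zero_section: "continuous_map X P (zero_section \<xi> h)"
proof -
  have "continuous_map X \<Sigma> (\<lambda>x. (vzero \<xi> x, -1))"
    unfolding spherical_compactification_def
    by (auto simp: continuous_map_in_subtopology continuous_map_pairwise o_def continuous_vzero vnorm_vzero)
  then have "continuous_map X P (q \<circ> (\<lambda>x. (vzero \<xi> x, -1)))"
    using continuous_map_compose quotient_imp_continuous_map[OF quotient_q] by blast
  then show ?thesis by (rule continuous_map_eq) (simp add: zero_section_eq)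
qed

lemma proj_zero_section: "x \<in> topspace X \<Longrightarrow> pinched_proj \<xi> (zero_section \<xi> h x) = x"
  by (simp add: zero_section_eq pinched_proj_q pole_in_\<Sigma> bproj_vzero)

lemma X\<^sub>0_subset: "X\<^sub>0 \<subseteq> topspace P"
  using continuous_map_image_subset_topspace[OF continuous_zero_section] by auto

text \<open>The zero section is defined by the pole of height -1, but its image contains the class
  of the opposite pole, which is the same class.\<close>

lemma q_in_X\<^sub>0_iff:
  assumes "(v, t) \<in> topspace \<Sigma>" shows "q (v, t) \<in> X\<^sub>0 \<longleftrightarrow> t\<^sup>2 = 1"
proof
  assume "q (v, t) \<in> X\<^sub>0"
  then obtain x where x: "x \<in> topspace X" "q (v, t) = q (vzero \<xi> x, -1)" by (auto simp: zero_section_eq)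
  then have "v = vzero \<xi> (bproj \<xi> v)" by (auto simp: q_eq_iff bproj_vzero)
  then show "t\<^sup>2 = 1" using assms by (auto elim: \<Sigma>_cases)
next
  assume t: "t\<^sup>2 = 1"
  have v: "v = vzero \<xi> (bproj \<xi> v)" using assms by (rule \<Sigma>_cases) (use t in \<open>auto simp: power2_eq_1_iff\<close>)
  have x: "bproj \<xi> v \<in> topspace X" using assms bproj_in by (simp add: topspace_\<Sigma>)
  have "q (v, t) = zero_section \<xi> h (bproj \<xi> v)"
    using x v by (simp add: zero_section_eq) (metis q_zero)
  then show "q (v, t) \<in> X\<^sub>0" using x by blast
qed

subsection \<open>The annulus\<close>

text \<open>The point of the sphere bundle that corresponds to the vector \<open>r v\<close>, for
  \<open>v\<close> of length 1.\<close>

definition polar :: "real \<times> 'e \<Rightarrow> 'e \<times> real"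
  where "polar = (\<lambda>(r, v). (rscale (2 * r / (r\<^sup>2 + 1)) v, (r\<^sup>2 - 1) / (r\<^sup>2 + 1)))"

lemma r2_pos: "(r::real)\<^sup>2 + 1 > 0" "(r::real)\<^sup>2 + 1 \<noteq> 0"
  using zero_le_power2[of r] by linarith+

lemma polar_in_\<Sigma>:
  assumes "v \<in> topspace S" shows "polar (r, v) \<in> topspace \<Sigma>"
proof -
  define a where "a = 2 * r / (r\<^sup>2 + 1)"
  define b where "b = (r\<^sup>2 - 1) / (r\<^sup>2 + 1)"
  have "a\<^sup>2 + b\<^sup>2 = ((2 * r)\<^sup>2 + (r\<^sup>2 - 1)\<^sup>2) / (r\<^sup>2 + 1)\<^sup>2"
    by (simp add: a_def b_def power_divide add_divide_distrib)
  also have "(2 * r)\<^sup>2 + (r\<^sup>2 - 1)\<^sup>2 = (r\<^sup>2 + 1)\<^sup>2"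
    by (simp add: power2_eq_square algebra_simps)
  finally have "a\<^sup>2 + b\<^sup>2 = 1" using r2_pos[of r] by simp
  then have "(rscale a v, b) \<in> topspace \<Sigma>"
    using assms by (simp add: topspace_\<Sigma> topspace_S rscale_in vnorm_rscale power_mult_distrib)
  then show ?thesis by (simp add: polar_def a_def b_def)
qed

text \<open>With \<rho> the squared length, length 1/2 has height
  \<open>(1/4 - 1) / (1/4 + 1)\<close>, which is -3/5, and length 1 has height 0.\<close>

lemma height_bounds:
  fixes \<rho> :: real
  assumes "\<rho> \<ge> 0"
  shows "-3/5 < (\<rho> - 1) / (\<rho> + 1) \<longleftrightarrow> 1/4 < \<rho>" "(\<rho> - 1) / (\<rho> + 1) < 0 \<longleftrightarrow> \<rho> < 1"
  using assms by (simp_all add: field_simps)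

lemma pinched_incl_polar:
  assumes "v \<in> topspace S" "r \<ge> 0" shows "pinched_incl \<xi> h (rscale r v) = q (polar (r, v))"
  using assms by (simp add: pinched_incl_eq polar_def topspace_S vnorm_rscale rscale_rscale)

text \<open>Stereographic projection from the pole of height 1, with the result split into its
  length and direction.\<close>

definition unpolar :: "'e \<times> real \<Rightarrow> real \<times> 'e"
  where "unpolar = (\<lambda>(w, t). (vnorm h w / (1 - t), rscale (inverse (vnorm h w)) w))"

lemma unpolar_in:
  assumes "(w, t) \<in> topspace \<Sigma>" "t\<^sup>2 \<noteq> 1"
  shows "fst (unpolar (w, t)) > 0" "snd (unpolar (w, t)) \<in> topspace S"
proof -
  have w: "vnorm h w > 0" "t < 1" "w \<in> topspace E"
    using assms(2) \<Sigma>_cases[OF assms(1)] assms(1)[unfolded topspace_\<Sigma>] by blast+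
  then show "fst (unpolar (w, t)) > 0" by (simp add: unpolar_def)
  show "snd (unpolar (w, t)) \<in> topspace S"
    using w by (simp add: unpolar_def topspace_S rscale_in vnorm_rscale)
qed

lemma polar_unpolar:
  assumes "(w, t) \<in> topspace \<Sigma>" "t\<^sup>2 \<noteq> 1" shows "polar (unpolar (w, t)) = (w, t)"
proof -
  have w: "vnorm h w > 0" "t < 1" "w \<in> topspace E"
    using assms(2) \<Sigma>_cases[OF assms(1)] assms(1)[unfolded topspace_\<Sigma>] by blast+
  have w4: "(vnorm h w)\<^sup>2 = 1 - t\<^sup>2"
    using assms(1) by (simp add: topspace_\<Sigma>)
  define r where "r = vnorm h w / (1 - t)"
  \<comment> \<open>On the sphere the squared length determines the height by
    \<open>r\<^sup>2 = (1 + t) / (1 - t)\<close>.\<close>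
  have "r\<^sup>2 = (1 - t\<^sup>2) / (1 - t)\<^sup>2" using w4 by (simp add: r_def power_divide)
  also have "1 - t\<^sup>2 = (1 - t) * (1 + t)" by (simp add: power2_eq_square algebra_simps)
  also have "(1 - t) * (1 + t) / (1 - t)\<^sup>2 = (1 + t) / (1 - t)" by (simp add: power2_eq_square)
  finally have r2: "r\<^sup>2 = (1 + t) / (1 - t)" .
  have "r\<^sup>2 + 1 = 2 / (1 - t)" "r\<^sup>2 - 1 = 2 * t / (1 - t)"
    unfolding r2 using w(2) by (simp_all add: field_simps)
  then have "(r\<^sup>2 - 1) / (r\<^sup>2 + 1) = t" "2 * r / (r\<^sup>2 + 1) = r * (1 - t)"
    using w(2) by (simp_all only:) simp_all
  moreover have "r * (1 - t) = vnorm h w" using w(2) by (simp add: r_def)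
  ultimately show ?thesis
    using w by (simp add: polar_def unpolar_def rscale_rscale rscale_one flip: r_def)
qed

lemma polar_t: "((r\<^sup>2 - 1) / (r\<^sup>2 + 1))\<^sup>2 \<noteq> 1" if "r > 0" for r :: real
proof -
  have "(r\<^sup>2 - 1) / (r\<^sup>2 + 1) < 1" "(r\<^sup>2 - 1) / (r\<^sup>2 + 1) > -1"
    using that r2_pos[of r] by (auto simp: field_simps)
  then show ?thesis by (auto simp: power2_eq_1_iff)
qed

lemma unpolar_polar:
  assumes "v \<in> topspace S" "r > 0" shows "unpolar (polar (r, v)) = (r, v)"
proof -
  have v: "v \<in> topspace E" "vnorm h v = 1" using assms by (auto simp: topspace_S)
  have pos: "2 * r / (r\<^sup>2 + 1) > 0" using assms(2) r2_pos[of r] by simp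
  have "vnorm h (rscale (2 * r / (r\<^sup>2 + 1)) v) = 2 * r / (r\<^sup>2 + 1)"
    using v pos assms(2) by (simp add: vnorm_rscale)
  moreover have "1 - (r\<^sup>2 - 1) / (r\<^sup>2 + 1) = 2 / (r\<^sup>2 + 1)" using r2_pos[of r] by (simp add: field_simps)
  moreover have "2 * r / (r\<^sup>2 + 1) / (2 / (r\<^sup>2 + 1)) = r" using r2_pos[of r] by simp
  moreover have "inverse (2 * r / (r\<^sup>2 + 1)) * (2 * r / (r\<^sup>2 + 1)) = 1" by (rule left_inverse[OF less_imp_neq[OF pos, symmetric]])
  ultimately show ?thesis
    by (simp only: unpolar_def polar_def split_conv rscale_rscale[OF v(1)] rscale_one[OF v(1)])
qed

lemma q_in_W_iff:
  assumes "(w, t) \<in> topspace \<Sigma>" shows "q (w, t) \<in> W \<longleftrightarrow> t \<le> -3/5 \<or> t \<ge> 0"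
proof -
  have "q (w, t) \<in> annulus \<xi> h \<longleftrightarrow> -3/5 < t \<and> t < 0"
  proof
    assume "q (w, t) \<in> annulus \<xi> h"
    then obtain v where v: "v \<in> topspace E" "1/2 < vnorm h v" "vnorm h v < 1" "q (w, t) = pinched_incl \<xi> h v"
      by (auto simp: annulus_def)
    let ?r = "vnorm h v"
    let ?u = "rscale (2 / (?r\<^sup>2 + 1)) v"
    have "(1/2)\<^sup>2 < ?r\<^sup>2" "?r\<^sup>2 < 1\<^sup>2" using v by (intro power_strict_mono; simp)+
    then have r2: "1/4 < ?r\<^sup>2" "?r\<^sup>2 < 1" by (simp_all add: power_divide)
    have "vnorm h ?u > 0" using v r2_pos[of ?r] by (simp add: vnorm_rscale)
    \<comment> \<open>Off the zero vectors the class determines the height, so \<open>t\<close> can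
      be compared.\<close>
    then have "?u \<noteq> vzero \<xi> (bproj \<xi> ?u)" using vnorm_eq_0_iff[of ?u] v(1) by (auto simp: rscale_in)
    then have "t = (?r\<^sup>2 - 1) / (?r\<^sup>2 + 1)" using v(4) by (auto simp: pinched_incl_eq q_eq_iff)
    then show "-3/5 < t \<and> t < 0" using r2 height_bounds[of "?r\<^sup>2"] by simp
  next
    assume t: "-3/5 < t \<and> t < 0"
    have t2: "t\<^sup>2 \<noteq> 1" using t by (auto simp: power2_eq_1_iff)
    obtain r v where rv: "unpolar (w, t) = (r, v)" by fastforce
    have r: "r > 0" "v \<in> topspace S" using unpolar_in[OF assms t2] by (auto simp: rv)
    have p: "polar (r, v) = (w, t)" using polar_unpolar[OF assms t2] by (simp add: rv)
    then have "t = (r\<^sup>2 - 1) / (r\<^sup>2 + 1)" by (auto simp: polar_def)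
    then have "(1/2)\<^sup>2 < r\<^sup>2" "r\<^sup>2 < 1\<^sup>2" using t height_bounds[of "r\<^sup>2"] by (simp_all add: power_divide)
    then have "1/2 < r" "r < 1" using r(1) power2_less_imp_less[of "1/2" r] power2_less_imp_less[of r 1] by simp_all
    moreover have "q (w, t) = pinched_incl \<xi> h (rscale r v)" using pinched_incl_polar[OF r(2)] r(1) p by simp
    ultimately show "q (w, t) \<in> annulus \<xi> h"
      unfolding annulus_def using r by (intro image_eqI[of _ _ "rscale r v"]) (auto simp: topspace_S rscale_in vnorm_rscale)
  qed
  then show ?thesis
    using assms by (auto simp: annulus_compl_def topspace_P)
qed

lemma W_subset: "W \<subseteq> topspace P"
  by (auto simp: annulus_compl_def)

lemma X\<^sub>0_W: "X\<^sub>0 \<subseteq> W"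
proof
  fix p assume p: "p \<in> X\<^sub>0"
  then obtain v t where vt: "(v, t) \<in> topspace \<Sigma>" "p = q (v, t)" using P_cases[OF subsetD[OF X\<^sub>0_subset p]] by blast
  then have "t = 1 \<or> t = -1" using p q_in_X\<^sub>0_iff by (auto simp: power2_eq_1_iff)
  then show "p \<in> W" using vt q_in_W_iff by auto
qed

subsection \<open>Radial homotopies\<close>

text \<open>For \<open>a, b \<ge> 0\<close> and \<open>b > 0\<close> multiplication by \<open>a / b\<close> on \<open>\<xi>\<close> becomes the map
  \<open>(v, t) \<mapsto> (scale_factor a b t v, scale_height a b t)\<close> of \<open>\<xi>\<^sup>S\<close>.  The homogeneous
  parameters also allow the limit \<open>b = 0\<close>.\<close>

definition scale_denom :: "real \<Rightarrow> real \<Rightarrow> real \<Rightarrow> real"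
  where "scale_denom a b t = a\<^sup>2 * (1 + t) + b\<^sup>2 * (1 - t)"

definition scale_factor :: "real \<Rightarrow> real \<Rightarrow> real \<Rightarrow> real"
  where "scale_factor a b t = 2 * a * b / scale_denom a b t"

definition scale_height :: "real \<Rightarrow> real \<Rightarrow> real \<Rightarrow> real"
  where "scale_height a b t = (a\<^sup>2 * (1 + t) - b\<^sup>2 * (1 - t)) / scale_denom a b t"

text \<open>This is \<open>(x - y)\<^sup>2 + 4 x y = (x + y)\<^sup>2\<close> for
  \<open>x = a\<^sup>2 * (1 + t)\<close> and \<open>y = b\<^sup>2 * (1 - t)\<close>; it says that
  scaled points stay on the sphere.\<close>

lemma scale_identity:
  assumes "scale_denom a b t \<noteq> 0"
  shows "(scale_factor a b t)\<^sup>2 * (1 - t\<^sup>2) + (scale_height a b t)\<^sup>2 = 1"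
proof -
  have "(scale_factor a b t)\<^sup>2 * (1 - t\<^sup>2) + (scale_height a b t)\<^sup>2 =
      ((2 * a * b)\<^sup>2 * (1 - t\<^sup>2) + (a\<^sup>2 * (1 + t) - b\<^sup>2 * (1 - t))\<^sup>2) / (scale_denom a b t)\<^sup>2"
    by (simp add: scale_factor_def scale_height_def power_divide add_divide_distrib)
  also have "(2 * a * b)\<^sup>2 * (1 - t\<^sup>2) + (a\<^sup>2 * (1 + t) - b\<^sup>2 * (1 - t))\<^sup>2 = (scale_denom a b t)\<^sup>2"
    by (simp add: scale_denom_def power2_eq_square algebra_simps)
  finally show ?thesis using assms by simp
qed

lemma scaled_in_\<Sigma>:
  assumes "(w, t) \<in> topspace \<Sigma>" "scale_denom a b t \<noteq> 0"
  shows "(rscale (scale_factor a b t) w, scale_height a b t) \<in> topspace \<Sigma>"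
proof -
  have "w \<in> topspace E" "(vnorm h w)\<^sup>2 = 1 - t\<^sup>2" using assms(1) by (auto simp: topspace_\<Sigma>)
  then show ?thesis
    using scale_identity[OF assms(2)] by (simp add: topspace_\<Sigma> rscale_in vnorm_rscale power_mult_distrib)
qed

definition radial_homotopy :: "(real \<Rightarrow> real \<Rightarrow> real) \<Rightarrow> (real \<Rightarrow> real \<Rightarrow> real) \<Rightarrow> real \<times> ('e \<times> real) set \<Rightarrow> ('e \<times> real) set"
  where "radial_homotopy a b = (\<lambda>(s, p). case point_of p of (w, t) \<Rightarrow>
    q (rscale (scale_factor (a s t) (b s t) t) w, scale_height (a s t) (b s t) t))"

text \<open>The choice of pole does not matter: the scaled vector stays zero, and over a zero vector
  the height is forgotten.\<close>

lemma radial_homotopy_q: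
  assumes "(w, t) \<in> topspace \<Sigma>"
  shows "radial_homotopy a b (s, q (w, t)) = q (rscale (scale_factor (a s t) (b s t) t) w, scale_height (a s t) (b s t) t)"
proof -
  let ?f = "\<lambda>(w, t). q (rscale (scale_factor (a s t) (b s t) t) w, scale_height (a s t) (b s t) t)"
  have "?f (point_of (q (w, t))) = ?f (w, t)"
  proof (rule descend[OF _ assms])
    fix v s' t' assume v: "(v, t') \<in> topspace \<Sigma>" "v = vzero \<xi> (bproj \<xi> v)"
    then have "v \<in> topspace E" by (simp add: topspace_\<Sigma>)
    then have "rscale r v = v" for r using rscale_vzero[OF bproj_in, of v r] v(2) by simp
    then show "?f (v, s') = ?f (v, t')" using q_zero[OF v(2)] by simp
  qed
  then show ?thesis by (simp add: radial_homotopy_def)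
qed

lemma continuous_radial_homotopy:
  assumes a: "continuous_on ({0..1} \<times> {-1..1}) (\<lambda>(s, t). a s t)" and b: "continuous_on ({0..1} \<times> {-1..1}) (\<lambda>(s, t). b s t)"
    and pos: "\<And>s t. \<lbrakk>0 \<le> s; s \<le> 1; -1 \<le> t; t \<le> 1\<rbrakk> \<Longrightarrow> scale_denom (a s t) (b s t) t \<noteq> 0"
  shows "continuous_map (prod_topology (top_of_set {0..1}) P) P (radial_homotopy a b)"
proof -
  let ?I = "top_of_set {0..1::real}" and ?K = "{0..1::real} \<times> {-1..1::real}"
  define H where "H = (\<lambda>(s, w, t). (rscale (scale_factor (a s t) (b s t) t) w, scale_height (a s t) (b s t) t))"
  have fst': "continuous_map (prod_topology ?I \<Sigma>) euclideanreal fst"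
    using continuous_map_fst continuous_map_into_fulltopology by blast
  have w: "continuous_map (prod_topology ?I \<Sigma>) E (\<lambda>x. fst (snd x))"
    using continuous_map_compose[OF continuous_map_snd continuous_\<Sigma>_fst] by (simp add: o_def)
  have t: "continuous_map (prod_topology ?I \<Sigma>) euclideanreal (\<lambda>x. snd (snd x))"
    using continuous_map_compose[OF continuous_map_snd continuous_\<Sigma>_snd] by (simp add: o_def)
  have st: "continuous_map (prod_topology ?I \<Sigma>) (top_of_set ?K) (\<lambda>x. (fst x, snd (snd x)))"
  proof -
    have "continuous_map (prod_topology ?I \<Sigma>) (prod_topology euclideanreal euclideanreal) (\<lambda>x. (fst x, snd (snd x)))"
      using fst' t by (simp add: continuous_map_pairwise o_def del: prod_topology_euclidean)
    moreover have "(fst x, snd (snd x)) \<in> ?K" if "x \<in> topspace (prod_topology ?I \<Sigma>)" for x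
      using that \<Sigma>_bounds by (cases x) auto
    ultimately show ?thesis by (auto simp: continuous_map_in_subtopology)
  qed
  have comp: "continuous_map (prod_topology ?I \<Sigma>) euclideanreal (\<lambda>x. k (fst x) (snd (snd x)))"
    if "continuous_on ?K (\<lambda>(s, t). k s t)" for k
    using continuous_map_compose[OF st, of euclideanreal "\<lambda>(s, t). k s t"] that by (simp add: o_def)
  have a': "continuous_on ?K (\<lambda>p. a (fst p) (snd p))" and b': "continuous_on ?K (\<lambda>p. b (fst p) (snd p))"
    using a b by (simp_all add: split_def)
  have ne: "scale_denom (a (fst p) (snd p)) (b (fst p) (snd p)) (snd p) \<noteq> 0" if "p \<in> ?K" for p
    using pos that by auto
  have den: "continuous_on ?K (\<lambda>p. scale_denom (a (fst p) (snd p)) (b (fst p) (snd p)) (snd p))"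
    unfolding scale_denom_def by (intro continuous_intros a' b')
  have fac: "continuous_on ?K (\<lambda>(s, t). scale_factor (a s t) (b s t) t)"
    unfolding scale_factor_def split_def by (intro continuous_on_divide continuous_on_mult continuous_on_const a' b' den ballI ne)
  have hgt: "continuous_on ?K (\<lambda>(s, t). scale_height (a s t) (b s t) t)"
    unfolding scale_height_def split_def
    by (intro continuous_on_divide continuous_on_mult continuous_on_diff continuous_on_add continuous_on_power continuous_on_const
        continuous_on_snd continuous_on_id a' b' den ballI ne)
  have "continuous_map (prod_topology ?I \<Sigma>) (prod_topology E euclideanreal) H"
    unfolding continuous_map_pairwise
    using continuous_map_rscale[OF comp[OF fac] w] comp[OF hgt] by (simp add: H_def o_def split_def)
  moreover have H\<Sigma>: "H x \<in> topspace \<Sigma>" if "x \<in> topspace (prod_topology ?I \<Sigma>)" for x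
  proof -
    obtain s w t where x: "x = (s, w, t)" "0 \<le> s" "s \<le> 1" "(w, t) \<in> topspace \<Sigma>"
      using \<open>x \<in> topspace (prod_topology ?I \<Sigma>)\<close> by (cases x) auto
    then show ?thesis
      using scaled_in_\<Sigma>[OF x(4), of "a s t" "b s t"] pos[of s t] \<Sigma>_bounds[OF x(4)] by (simp add: H_def)
  qed
  ultimately have "continuous_map (prod_topology ?I \<Sigma>) \<Sigma> H"
    unfolding spherical_compactification_def continuous_map_in_subtopology by auto
  then have "continuous_map (prod_topology ?I \<Sigma>) P (q \<circ> H)"
    by (rule continuous_map_compose[OF _ quotient_imp_continuous_map[OF quotient_q]])
  then have "continuous_map (prod_topology ?I \<Sigma>) P (radial_homotopy a b \<circ> (\<lambda>(s, x). (s, q x)))"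
    by (rule continuous_map_eq) (auto simp: H_def radial_homotopy_q)
  \<comment> \<open>The product of a quotient map with the interval is again a quotient map because
    the interval is locally compact Hausdorff; thus the homotopy descends.\<close>
  moreover have "quotient_map (prod_topology ?I \<Sigma>) (prod_topology ?I P) (\<lambda>(s, x). (s, q x))"
    by (rule quotient_map_prod_right[OF _ _ quotient_q])
      (auto intro!: compact_imp_locally_compact_space Hausdorff_space_subtopology simp: compact_space_subtopology)
  ultimately show ?thesis by (rule continuous_compose_quotient_map[rotated])
qed

text \<open>Falls linearly from 1 at the inner rim, of height -3/5, to 0 at the outer rim, of height
  0. At the final time of \<open>stretch\<close> the scaling ratio is
  \<open>(1 - ramp t) / ramp t\<close>, which runs from 0 to infinity across the annulus.\<close>

definition ramp :: "real \<Rightarrow> real"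
  where "ramp t = max 0 (min 1 (- (5 / 3) * t))"

lemma ramp_bounds: "0 \<le> ramp t" "ramp t \<le> 1" and ramp_low: "t \<le> -3/5 \<Longrightarrow> ramp t = 1" and ramp_high: "0 \<le> t \<Longrightarrow> ramp t = 0"
  by (auto simp: ramp_def)

text \<open>At \<open>s = 1\<close> the annulus covers all of \<open>\<xi>\<close> and its complement is in the zero section.\<close>

definition stretch :: "real \<times> ('e \<times> real) set \<Rightarrow> ('e \<times> real) set"
  where "stretch = radial_homotopy (\<lambda>s t. 1 - s * ramp t) (\<lambda>s t. 1 - s * (1 - ramp t))"

text \<open>The first parameter vanishes only for \<open>s = 1\<close> and
  \<open>t \<le> -3/5\<close>, where the term with \<open>1 - t\<close> is positive; the second only
  for \<open>s = 1\<close> and \<open>t \<ge> 0\<close>, where the term with \<open>1 + t\<close>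
  is.\<close>

lemma stretch_denom_pos:
  assumes "0 \<le> s" "s \<le> 1" "-1 \<le> t" "t \<le> 1"
  shows "scale_denom (1 - s * ramp t) (1 - s * (1 - ramp t)) t > 0"
proof -
  let ?a = "1 - s * ramp t" and ?b = "1 - s * (1 - ramp t)"
  have sr: "s * ramp t \<le> s" "s * (1 - ramp t) \<le> s"
    using assms ramp_bounds[of t] by (auto intro: mult_left_le)
  consider "t \<le> -3/5" | "-3/5 < t" "t < 0" | "0 \<le> t" by linarith
  then show ?thesis
  proof cases
    case 1
    then show ?thesis using assms by (simp add: scale_denom_def ramp_low add_nonneg_pos)
  next
    case 2
    then have r: "0 < ramp t" "ramp t < 1" by (auto simp: ramp_def)
    have *: "1 - s * u > 0" if "0 < u" "u < 1" for u
    proof -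
      have "s * u \<le> 1 * u" using assms that by (intro mult_right_mono) simp_all
      also have "\<dots> < 1" using that by simp
      finally show ?thesis by simp
    qed
    have "?a > 0" "?b > 0" using r by (intro *; simp)+
    then show ?thesis using 2 by (simp add: scale_denom_def add_pos_pos)
  next
    case 3
    then show ?thesis using assms by (simp add: scale_denom_def ramp_high add_pos_nonneg)
  qed
qed

lemma continuous_stretch: "continuous_map (prod_topology (top_of_set {0..1}) P) P stretch"
  unfolding stretch_def
proof (rule continuous_radial_homotopy)
  have "continuous_on UNIV ramp" unfolding ramp_def by (intro continuous_intros)
  then have r: "continuous_on ({0..1} \<times> {-1..1::real}) (\<lambda>p::real \<times> real. ramp (snd p))"
    by (rule continuous_on_compose2) (auto intro: continuous_intros)
  show "continuous_on ({0..1} \<times> {-1..1}) (\<lambda>(s, t). 1 - s * ramp t)"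
    "continuous_on ({0..1} \<times> {-1..1}) (\<lambda>(s, t). 1 - s * (1 - ramp t))"
    unfolding split_def by (intro continuous_on_diff continuous_on_mult continuous_on_const continuous_on_fst continuous_on_id r)+
qed (use stretch_denom_pos in force)

lemma stretch_q:
  assumes "(w, t) \<in> topspace \<Sigma>"
  shows "stretch (s, q (w, t)) = q (rscale (scale_factor (1 - s * ramp t) (1 - s * (1 - ramp t)) t) w,
    scale_height (1 - s * ramp t) (1 - s * (1 - ramp t)) t)"
  unfolding stretch_def by (rule radial_homotopy_q[OF assms])

lemma stretch_in_\<Sigma>:
  assumes "(w, t) \<in> topspace \<Sigma>" "0 \<le> s" "s \<le> 1"
  shows "(rscale (scale_factor (1 - s * ramp t) (1 - s * (1 - ramp t)) t) w,
    scale_height (1 - s * ramp t) (1 - s * (1 - ramp t)) t) \<in> topspace \<Sigma>"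
  using stretch_denom_pos[of s t] \<Sigma>_bounds[OF assms(1)] assms(2,3) by (intro scaled_in_\<Sigma>[OF assms(1)]) simp

lemma stretch_0: "p \<in> topspace P \<Longrightarrow> stretch (0, p) = p"
proof (erule P_cases)
  fix w t assume wt: "(w, t) \<in> topspace \<Sigma>" "p = q (w, t)"
  have "scale_factor 1 1 t = 1" "scale_height 1 1 t = t"
    by (simp_all add: scale_factor_def scale_height_def scale_denom_def)
  then show "stretch (0, p) = p"
    using wt by (simp add: stretch_q[OF wt(1)] rscale_one topspace_\<Sigma>)
qed

text \<open>Short vectors only shrink and long ones only grow, so the annulus is never entered; in
  the limit they reach opposite poles, which pinching has made the same point.\<close>

lemma stretch_W:
  assumes "p \<in> W" "0 \<le> s" "s \<le> 1" shows "stretch (s, p) \<in> W" and "stretch (1, p) \<in> X\<^sub>0"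
proof -
  obtain w t where wt: "(w, t) \<in> topspace \<Sigma>" "p = q (w, t)" using P_cases[OF subsetD[OF W_subset assms(1)]] by blast
  have t: "-1 \<le> t" "t \<le> 1" using \<Sigma>_bounds[OF wt(1)] by auto
  have "t \<le> -3/5 \<or> 0 \<le> t" using assms(1) wt q_in_W_iff by auto
  then have "(scale_height (1 - s * ramp t) (1 - s * (1 - ramp t)) t \<le> -3/5 \<or> scale_height (1 - s * ramp t) (1 - s * (1 - ramp t)) t \<ge> 0) \<and>
      (scale_height (1 - 1 * ramp t) (1 - 1 * (1 - ramp t)) t)\<^sup>2 = 1"
  proof
    assume low: "t \<le> -3/5"
    have pos: "scale_denom (1 - s) 1 t > 0" using stretch_denom_pos[of s t] assms(2,3) t by (simp add: ramp_low[OF low])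
    have "(1 - s)\<^sup>2 \<le> 1" using assms(2,3) by (simp add: power_le_one)
    then have "(1 - s)\<^sup>2 * (1 + t) \<le> 1 * (1 + t)" using t by (intro mult_right_mono) auto
    \<comment> \<open>The factor 4 is the squared ratio of 1 and 1/2: a height
      \<open>(A - B) / (A + B)\<close> is at most -3/5 exactly when
      \<open>4 * A \<le> B\<close>.\<close>
    then have "4 * ((1 - s)\<^sup>2 * (1 + t)) \<le> 4 * (1 * (1 + t))" by (rule mult_left_mono) simp
    also have "4 * (1 * (1 + t)) \<le> 1 - t" using low by simp
    finally have "4 * ((1 - s)\<^sup>2 * (1 + t)) \<le> 1 - t" .
    moreover have "A - B \<le> -3/5 * (A + B)" if "4 * A \<le> B" for A B :: real using that by argo
    ultimately have "(1 - s)\<^sup>2 * (1 + t) - (1 - t) \<le> -3/5 * scale_denom (1 - s) 1 t"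
      by (simp only: scale_denom_def power_one mult_1)
    then have "scale_height (1 - s) 1 t \<le> -3/5" using pos by (simp add: scale_height_def field_simps)
    moreover have "scale_height 0 1 t = -1" using low by (simp add: scale_height_def scale_denom_def field_simps)
    ultimately show ?thesis by (simp add: ramp_low[OF low])
  next
    assume high: "0 \<le> t"
    have pos: "scale_denom 1 (1 - s) t > 0" using stretch_denom_pos[of s t] assms(2,3) t by (simp add: ramp_high[OF high])
    have "(1 - s)\<^sup>2 \<le> 1" using assms(2,3) by (simp add: power_le_one)
    then have "(1 - s)\<^sup>2 * (1 - t) \<le> 1 * (1 - t)" using t by (intro mult_right_mono) auto
    then have "scale_height 1 (1 - s) t \<ge> 0" using pos high by (simp add: scale_height_def)
    moreover have "scale_height 1 0 t = 1" using high by (simp add: scale_height_def scale_denom_def)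
    ultimately show ?thesis by (simp add: ramp_high[OF high])
  qed
  then show "stretch (s, p) \<in> W" "stretch (1, p) \<in> X\<^sub>0"
    using q_in_W_iff[OF stretch_in_\<Sigma>[OF wt(1) assms(2,3)]] q_in_X\<^sub>0_iff[OF stretch_in_\<Sigma>[OF wt(1), of 1]]
    by (simp_all add: wt(2) stretch_q[OF wt(1)])
qed

text \<open>Zero vectors are fixed by scaling, so the homotopy is constant on the zero
  section.\<close>

lemma stretch_X\<^sub>0:
  assumes "p \<in> X\<^sub>0" shows "stretch (s, p) \<in> X\<^sub>0"
proof -
  obtain x where x: "x \<in> topspace X" "p = q (vzero \<xi> x, -1)" using assms by (auto simp: zero_section_eq)
  have v: "(vzero \<xi> x, -1) \<in> topspace \<Sigma>" using x(1) by (simp add: pole_in_\<Sigma>)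
  have "stretch (s, p) = p"
    unfolding x(2) stretch_q[OF v] rscale_vzero[OF x(1)] by (rule q_zero) (simp add: bproj_vzero x(1))
  then show ?thesis using assms by simp
qed

text \<open>The same homotopy is one of self-maps of both pairs, and its end is a homotopy inverse
  to the inclusion.\<close>

lemma enlarge_map_iso: "enlarge_map \<xi> h \<in> iso (rel_homology R P X\<^sub>0) (rel_homology R P W)"
  unfolding enlarge_map_def
proof (rule induced_map_iso_homotopy_equivalence[where g="\<lambda>p. stretch (1, p)" and F=stretch and G=stretch])
  show "pair_map P X\<^sub>0 P W id" using X\<^sub>0_W by (auto simp: pair_map_def)
  have "continuous_map P (prod_topology (top_of_set {0..1::real}) P) (Pair 1)"
    by (rule continuous_map_prism_Pair) auto
  then have "continuous_map P P (\<lambda>p. stretch (1, p))"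
    using continuous_map_compose[OF _ continuous_stretch] by (fastforce simp: o_def)
  then show "pair_map P W P X\<^sub>0 (\<lambda>p. stretch (1, p))"
    using stretch_W(2)[of _ 1] by (auto simp: pair_map_def)
qed (auto simp: continuous_stretch stretch_0 stretch_W(1) stretch_X\<^sub>0 simp del: image_iff)

subsection \<open>Excision of the zero section\<close>

abbreviation "P' \<equiv> subtopology P (topspace P - X\<^sub>0)"
abbreviation "half_open_cylinder \<equiv> prod_topology (top_of_set {0<..}) S"

text \<open>The norm takes the value 0 at both poles, hence descends; the zero section is its zero
  set.\<close>

lemma closed_X\<^sub>0: "closedin P X\<^sub>0"
proof -
  define u where "u = (\<lambda>p. vnorm h (fst (point_of p)))"
  have u: "u (q (w, t)) = vnorm h w" if "(w, t) \<in> topspace \<Sigma>" for w t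
    using descend[where f="\<lambda>x. vnorm h (fst x)", OF _ that] by (simp add: u_def)
  have "continuous_map P euclideanreal u"
  proof (rule continuous_compose_quotient_map[OF quotient_q])
    have "continuous_map \<Sigma> euclideanreal (vnorm h \<circ> fst)"
      by (rule continuous_map_compose[OF continuous_\<Sigma>_fst continuous_vnorm])
    then show "continuous_map \<Sigma> euclideanreal (u \<circ> q)"
      by (rule continuous_map_eq) (auto simp: u)
  qed
  then have "closedin P {p \<in> topspace P. u p \<in> {0}}"
    by (rule closedin_continuous_map_preimage) simp
  moreover have "q (w, t) \<in> X\<^sub>0 \<longleftrightarrow> u (q (w, t)) = 0" if "(w, t) \<in> topspace \<Sigma>" for w t
  proof -
    have "(vnorm h w)\<^sup>2 + t\<^sup>2 = 1" using that by (simp add: topspace_\<Sigma>)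
    then have "t\<^sup>2 = 1 \<longleftrightarrow> vnorm h w = 0" by auto
    then show ?thesis unfolding q_in_X\<^sub>0_iff[OF that] u[OF that] .
  qed
  note iff = this
  have "p \<in> {p \<in> topspace P. u p \<in> {0}} \<longleftrightarrow> p \<in> X\<^sub>0" for p
  proof (cases "p \<in> topspace P")
    case True
    obtain w t where "(w, t) \<in> topspace \<Sigma>" "p = q (w, t)" by (rule P_cases[OF True])
    then show ?thesis using iff True by simp
  next
    case False
    then show ?thesis using X\<^sub>0_subset by blast
  qed
  then have "{p \<in> topspace P. u p \<in> {0}} = X\<^sub>0" by (rule Set.set_eqI)
  ultimately show ?thesis by simp
qed

text \<open>The required neighbourhood is the set where a continuous function of the height is
  positive; the function has to agree at both poles in order to descend.\<close>

lemma X\<^sub>0_interior_W: "X\<^sub>0 \<subseteq> P interior_of W"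
proof -
  \<comment> \<open>The polynomial is positive exactly outside the heights from -3/5 to 0. Its
    values at -1 and 1 are 2/5 and 8/5; the cut-off at 2/5 makes them equal.\<close>
  define k where "k = (\<lambda>t::real. min (2/5) (t * (t + 3/5)))"
  define u where "u = (\<lambda>p. k (snd (point_of p)))"
  have u: "u (q (w, t)) = k t" if wt: "(w, t) \<in> topspace \<Sigma>" for w t
  proof -
    have "k s = k t" if "(v, t) \<in> topspace \<Sigma>" "(v, s) \<in> topspace \<Sigma>" "v = vzero \<xi> (bproj \<xi> v)" for v s t
    proof -
      have "k r = 2/5" if "(v, r) \<in> topspace \<Sigma>" for r
        using that by (rule \<Sigma>_cases) (use \<open>v = vzero \<xi> (bproj \<xi> v)\<close> in \<open>auto simp: k_def power2_eq_1_iff\<close>)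
      from this[OF that(1)] this[OF that(2)] show ?thesis by metis
    qed
    note k_eq = this
    have "k (snd (point_of (q (w, t)))) = k (snd (w, t))"
      by (rule descend[where f="\<lambda>x. k (snd x)", OF _ wt]) (unfold snd_conv, erule (2) k_eq)
    then show ?thesis by (simp add: u_def)
  qed
  have "continuous_map P euclideanreal u"
  proof (rule continuous_compose_quotient_map[OF quotient_q])
    have "continuous_map euclideanreal euclideanreal k" unfolding k_def by (simp add: continuous_intros)
    then have "continuous_map \<Sigma> euclideanreal (k \<circ> snd)"
      by (rule continuous_map_compose[OF continuous_\<Sigma>_snd])
    then show "continuous_map \<Sigma> euclideanreal (u \<circ> q)"
      by (rule continuous_map_eq) (auto simp: u)
  qed
  then have "openin P {p \<in> topspace P. u p \<in> {0<..}}"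
    by (rule openin_continuous_map_preimage) simp
  moreover have "{p \<in> topspace P. u p \<in> {0<..}} \<subseteq> W"
  proof (rule subsetI)
    fix p assume "p \<in> {p \<in> topspace P. u p \<in> {0<..}}"
    then have p: "p \<in> topspace P" "u p > 0" by auto
    obtain w t where wt: "(w, t) \<in> topspace \<Sigma>" "p = q (w, t)" by (rule P_cases[OF p(1)])
    then have "0 < k t" using p(2) u by simp
    then have "0 < t * (t + 3/5)" by (simp add: k_def)
    then have "t \<le> -3/5 \<or> t \<ge> 0" by (auto simp: zero_less_mult_iff)
    then show "p \<in> W" using wt q_in_W_iff by simp
  qed
  ultimately have "{p \<in> topspace P. u p \<in> {0<..}} \<subseteq> P interior_of W"
    by (metis interior_of_maximal)
  moreover have "p \<in> {p \<in> topspace P. u p \<in> {0<..}}" if p: "p \<in> X\<^sub>0" for p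
  proof -
    obtain w t where wt: "(w, t) \<in> topspace \<Sigma>" "p = q (w, t)" using P_cases[OF subsetD[OF X\<^sub>0_subset p]] by blast
    then have "t = 1 \<or> t = -1" using p q_in_X\<^sub>0_iff by (auto simp: power2_eq_1_iff)
    then show ?thesis using wt u[OF wt(1)] p X\<^sub>0_subset by (auto simp: k_def)
  qed
  ultimately show ?thesis by blast
qed

section \<open>Polar coordinates away from the zero section\<close>

lemma continuous_polar: "continuous_map half_open_cylinder P' (q \<circ> polar)"
proof -
  have r: "continuous_map half_open_cylinder euclideanreal fst"
    using continuous_map_fst continuous_map_into_fulltopology by blast
  have v: "continuous_map half_open_cylinder E snd"
    using continuous_map_snd continuous_map_into_fulltopology unfolding sphere_bundle_def by blast
  have f: "continuous_map half_open_cylinder euclideanreal (\<lambda>x. 2 * fst x / ((fst x)\<^sup>2 + 1))"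
    "continuous_map half_open_cylinder euclideanreal (\<lambda>x. ((fst x)\<^sup>2 - 1) / ((fst x)\<^sup>2 + 1))"
    using r2_pos(2)
    by (intro continuous_map_real_divide continuous_map_add continuous_map_diff continuous_map_real_pow continuous_map_real_mult
        continuous_map_const[THEN iffD2] r disjI2; simp)+
  have polar: "continuous_map half_open_cylinder (prod_topology E euclideanreal) polar"
    using continuous_map_rscale[OF f(1) v] f(2) by (simp add: continuous_map_pairwise polar_def o_def split_def)
  have mem: "polar x \<in> {(v, t). (vnorm h v)\<^sup>2 + t\<^sup>2 = 1}" if "x \<in> topspace half_open_cylinder" for x
    using polar_in_\<Sigma>[of "snd x" "fst x"] that by (auto simp: spherical_compactification_def)
  have "continuous_map half_open_cylinder \<Sigma> polar"
    unfolding spherical_compactification_def continuous_map_in_subtopology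
    by (rule conjI[OF polar], rule funcsetI, rule mem)
  then have "continuous_map half_open_cylinder P (q \<circ> polar)"
    by (rule continuous_map_compose[OF _ quotient_imp_continuous_map[OF quotient_q]])
  moreover have "(q \<circ> polar) x \<in> topspace P - X\<^sub>0" if hx: "x \<in> topspace half_open_cylinder" for x
  proof -
    obtain r v where x: "x = (r, v)" "r > 0" "v \<in> topspace S" using hx by (cases x) auto
    have "q (polar (r, v)) \<in> topspace P" using polar_in_\<Sigma>[OF x(3)] by (auto simp: topspace_P)
    moreover have "q (polar (r, v)) \<notin> X\<^sub>0"
      using q_in_X\<^sub>0_iff polar_in_\<Sigma>[OF x(3), of r] polar_t[OF x(2)] by (simp add: polar_def)
    ultimately show ?thesis by (simp add: x)
  qed
  ultimately show ?thesis by (simp only: continuous_map_in_subtopology Pi_iff) simp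
qed

definition coordinates :: "('e \<times> real) set \<Rightarrow> real \<times> 'e"
  where "coordinates p = unpolar (point_of p)"

lemma coordinates_q:
  assumes "(w, t) \<in> topspace \<Sigma>" "t\<^sup>2 \<noteq> 1" shows "coordinates (q (w, t)) = unpolar (w, t)"
  using point_of_q[OF assms(1)] assms(2) unfolding coordinates_def by metis

lemma coordinates_polar:
  assumes "v \<in> topspace S" "r > 0" shows "coordinates (q (polar (r, v))) = (r, v)"
proof -
  have "coordinates (q (polar (r, v))) = unpolar (polar (r, v))"
    unfolding polar_def split_conv
    by (rule coordinates_q) (use polar_in_\<Sigma>[OF assms(1), of r] polar_t[OF assms(2)] in \<open>simp_all add: polar_def\<close>)
  then show ?thesis using unpolar_polar[OF assms] by simp
qed

lemma P'_cases:
  assumes "p \<in> topspace P'" obtains w t where "(w, t) \<in> topspace \<Sigma>" "t\<^sup>2 \<noteq> 1" "p = q (w, t)"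
proof -
  have p: "p \<in> topspace P" "p \<notin> X\<^sub>0" using assms by auto
  obtain w t where "(w, t) \<in> topspace \<Sigma>" "p = q (w, t)" using P_cases[OF p(1)] by blast
  then show thesis using that p(2) q_in_X\<^sub>0_iff by blast
qed

lemma polar_coordinates:
  assumes "p \<in> topspace P'" obtains r v where "r > 0" "v \<in> topspace S" "coordinates p = (r, v)" "p = q (polar (r, v))"
proof -
  obtain w t where wt: "(w, t) \<in> topspace \<Sigma>" "t\<^sup>2 \<noteq> 1" "p = q (w, t)" by (rule P'_cases[OF assms])
  obtain r v where rv: "unpolar (w, t) = (r, v)" by fastforce
  then show thesis
    using that[of r v] unpolar_in[OF wt(1,2)] polar_unpolar[OF wt(1,2)] coordinates_q[OF wt(1,2)] by (simp add: wt(3))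
qed

lemma continuous_coordinates: "continuous_map P' half_open_cylinder coordinates"
proof -
  let ?U = "{x \<in> topspace \<Sigma>. q x \<in> topspace P - X\<^sub>0}"
  let ?\<Sigma> = "subtopology \<Sigma> ?U"
  have "quotient_map ?\<Sigma> P' q"
    \<comment> \<open>The complement of the zero section is open, and a quotient map restricted over
      an open set remains one.\<close>
    by (rule quotient_map_restriction[OF quotient_q refl]) (use closed_X\<^sub>0 in blast)
  moreover have "continuous_map ?\<Sigma> half_open_cylinder (coordinates \<circ> q)"
  proof -
    have U: "x \<in> topspace \<Sigma>" "fst x \<in> topspace E" "vnorm h (fst x) \<noteq> 0" "1 - snd x \<noteq> 0" "(snd x)\<^sup>2 \<noteq> 1" if x: "x \<in> topspace ?\<Sigma>" for x
    proof -
      obtain w t where wt: "x = (w, t)" by (cases x)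
      have "(w, t) \<in> topspace \<Sigma>" "t\<^sup>2 \<noteq> 1" using x q_in_X\<^sub>0_iff[of w t] by (auto simp: wt)
      then show "x \<in> topspace \<Sigma>" "fst x \<in> topspace E" "vnorm h (fst x) \<noteq> 0" "1 - snd x \<noteq> 0" "(snd x)\<^sup>2 \<noteq> 1"
        by (auto simp: wt topspace_\<Sigma>)
    qed
    have w: "continuous_map ?\<Sigma> E fst" and t: "continuous_map ?\<Sigma> euclideanreal snd"
      using continuous_\<Sigma>_fst continuous_\<Sigma>_snd continuous_map_from_subtopology by blast+
    have n: "continuous_map ?\<Sigma> euclideanreal (\<lambda>x. vnorm h (fst x))"
      using continuous_map_compose[OF w continuous_vnorm] by (simp add: o_def)
    have "continuous_map ?\<Sigma> euclideanreal (\<lambda>x. vnorm h (fst x) / (1 - snd x))"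
      using U by (intro continuous_map_real_divide continuous_map_diff continuous_map_const[THEN iffD2] n t disjI2) auto
    moreover have "continuous_map ?\<Sigma> E (\<lambda>x. rscale (inverse (vnorm h (fst x))) (fst x))"
      using U by (intro continuous_map_rscale continuous_map_real_inverse n w) auto
    moreover have "fst (unpolar x) > 0 \<and> snd (unpolar x) \<in> topspace S" if "x \<in> topspace ?\<Sigma>" for x
      using unpolar_in[of "fst x" "snd x"] U[OF that] by simp
    ultimately have "continuous_map ?\<Sigma> half_open_cylinder unpolar"
      unfolding continuous_map_pairwise continuous_map_in_subtopology sphere_bundle_def
      by (auto simp: unpolar_def o_def split_def topspace_S simp flip: sphere_bundle_def)
    then show ?thesis
    proof (rule continuous_map_eq)
      fix x assume x: "x \<in> topspace ?\<Sigma>"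
      show "unpolar x = (coordinates \<circ> q) x" using coordinates_q[of "fst x" "snd x"] U[OF x] by simp
    qed
  qed
  ultimately show ?thesis by (rule continuous_compose_quotient_map)
qed

lemma polar_in_W_iff:
  assumes "v \<in> topspace S" "r > 0" shows "q (polar (r, v)) \<in> W \<longleftrightarrow> r \<le> 1/2 \<or> r \<ge> 1"
proof -
  have "q (polar (r, v)) \<in> W \<longleftrightarrow> (r\<^sup>2 - 1) / (r\<^sup>2 + 1) \<le> -3/5 \<or> (r\<^sup>2 - 1) / (r\<^sup>2 + 1) \<ge> 0"
    using q_in_W_iff polar_in_\<Sigma>[OF assms(1), of r] by (simp add: polar_def)
  also have "\<dots> \<longleftrightarrow> r\<^sup>2 \<le> (1/2)\<^sup>2 \<or> r\<^sup>2 \<ge> 1\<^sup>2"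
    using height_bounds[of "r\<^sup>2"] by (auto simp: not_less[symmetric] power_divide)
  also have "\<dots> \<longleftrightarrow> r \<le> 1/2 \<or> r \<ge> 1"
    using assms(2) by (simp only: power_mono_iff abs_le_square_iff[symmetric]) simp
  finally show ?thesis .
qed

section \<open>Deformation onto the closed annulus\<close>

definition clamp_radius :: "real \<Rightarrow> real"
  where "clamp_radius r = max (1/2) (min 1 r)"

abbreviation cylinder_incl :: "real \<times> 'e \<Rightarrow> ('e \<times> real) set"
  where "cylinder_incl \<equiv> \<lambda>(r, v). pinched_incl \<xi> h (vscale \<xi> (complex_of_real r) v)"

lemma cylinder_incl_polar: "\<lbrakk>v \<in> topspace S; r \<ge> 0\<rbrakk> \<Longrightarrow> cylinder_incl (r, v) = q (polar (r, v))"
  using pinched_incl_polar by (simp add: rscale_def)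

lemma cylinder_cases:
  assumes "x \<in> topspace (cylinder T)" obtains r v where "x = (r, v)" "1/2 \<le> r" "r \<le> 1" "v \<in> topspace T"
  using assms by (cases x) (auto simp: cylinder_def)

lemma continuous_cylinder_incl: "continuous_map (cylinder S) P' cylinder_incl"
proof -
  have "continuous_map (cylinder S) half_open_cylinder id"
    unfolding cylinder_def continuous_map_pairwise continuous_map_in_subtopology
    by (auto simp: continuous_map_snd intro: continuous_map_into_fulltopology[OF continuous_map_fst])
  from continuous_map_compose[OF this continuous_polar] show ?thesis
  proof (rule continuous_map_eq)
    fix x assume "x \<in> topspace (cylinder S)"
    then obtain r v where "x = (r, v)" "1/2 \<le> r" "r \<le> 1" "v \<in> topspace S" by (rule cylinder_cases)
    then show "(q \<circ> polar \<circ> id) x = cylinder_incl x" using cylinder_incl_polar[of v r] by simp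
  qed
qed

definition clamp_coordinates :: "('e \<times> real) set \<Rightarrow> real \<times> 'e"
  where "clamp_coordinates p = (clamp_radius (fst (coordinates p)), snd (coordinates p))"

definition clamp_homotopy :: "real \<times> ('e \<times> real) set \<Rightarrow> ('e \<times> real) set"
  where "clamp_homotopy = (\<lambda>(s, p).
    q (polar ((1 - s) * fst (coordinates p) + s * clamp_radius (fst (coordinates p)), snd (coordinates p))))"

lemma continuous_coordinate_parts:
  "continuous_map P' euclideanreal (\<lambda>p. fst (coordinates p))"
  "continuous_map P' S (\<lambda>p. snd (coordinates p))"
  "continuous_map P' euclideanreal (\<lambda>p. clamp_radius (fst (coordinates p)))"
proof -
  show r: "continuous_map P' euclideanreal (\<lambda>p. fst (coordinates p))" and "continuous_map P' S (\<lambda>p. snd (coordinates p))"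
    using continuous_coordinates continuous_map_into_fulltopology by (auto simp: continuous_map_pairwise o_def)
  show "continuous_map P' euclideanreal (\<lambda>p. clamp_radius (fst (coordinates p)))"
    unfolding clamp_radius_def
    by (intro continuous_map_real_max continuous_map_real_min r continuous_map_const[THEN iffD2] disjI2) auto
qed

lemma pair_map_cylinder_incl_excised: "pair_map (cylinder S) (cylinder_ends S) P' (W - X\<^sub>0) cylinder_incl"
  unfolding pair_map_def
proof (intro conjI continuous_cylinder_incl subsetI)
  fix p assume "p \<in> cylinder_incl ` (topspace (cylinder S) \<inter> cylinder_ends S)"
  then obtain x where x: "x \<in> topspace (cylinder S)" "x \<in> cylinder_ends S" "p = cylinder_incl x" by blast
  obtain r v where rv: "x = (r, v)" "1/2 \<le> r" "r \<le> 1" "v \<in> topspace S" by (rule cylinder_cases[OF x(1)])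
  have "r = 1/2 \<or> r = 1" using x(2) rv(1) by (auto simp: cylinder_ends_def)
  then have "r \<le> 1/2 \<or> r \<ge> 1" by auto
  then have "p \<in> W" using polar_in_W_iff[of v r] rv cylinder_incl_polar[of v r] x(3) by simp
  moreover have "p \<in> topspace P'"
    using continuous_map_image_subset_topspace[OF continuous_cylinder_incl] x by auto
  ultimately show "p \<in> W - X\<^sub>0" by simp
qed

lemma pair_map_clamp_coordinates: "pair_map P' (W - X\<^sub>0) (cylinder S) (cylinder_ends S) clamp_coordinates"
  unfolding pair_map_def
proof (intro conjI subsetI)
  show "continuous_map P' (cylinder S) clamp_coordinates"
    unfolding cylinder_def continuous_map_pairwise continuous_map_in_subtopology clamp_coordinates_def[abs_def]
    using continuous_coordinate_parts(2,3) by (auto simp: o_def clamp_radius_def)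
  fix y assume "y \<in> clamp_coordinates ` (topspace P' \<inter> (W - X\<^sub>0))"
  then obtain p where p: "p \<in> topspace P'" "p \<in> W" "y = clamp_coordinates p" by blast
  obtain r v where rv: "r > 0" "v \<in> topspace S" "coordinates p = (r, v)" "p = q (polar (r, v))"
    by (rule polar_coordinates[OF p(1)])
  have "r \<le> 1/2 \<or> r \<ge> 1" using p(2) polar_in_W_iff[OF rv(2,1)] rv(4) by simp
  then have "clamp_radius r \<in> {1/2, 1}" by (auto simp: clamp_radius_def)
  then show "y \<in> cylinder_ends S" using p(3) rv(2,3) by (simp add: cylinder_ends_def clamp_coordinates_def)
qed

lemma clamp_mix_pos: "\<lbrakk>0 \<le> s; s \<le> 1; r > 0\<rbrakk> \<Longrightarrow> (1 - s) * r + s * clamp_radius r > 0"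
proof -
  assume s: "0 \<le> s" "s \<le> 1" "r > 0"
  have "clamp_radius r > 0" by (simp add: clamp_radius_def)
  then show ?thesis using s by (cases "s = 0") (auto intro: add_nonneg_pos)
qed

lemma continuous_clamp_homotopy: "continuous_map (prod_topology (top_of_set {0..1}) P') P' clamp_homotopy"
proof -
  let ?I = "top_of_set {0..1::real}"
  define k where "k = (\<lambda>x. ((1 - fst x) * fst (coordinates (snd x)) + fst x * clamp_radius (fst (coordinates (snd x))), snd (coordinates (snd x))))"
  have s: "continuous_map (prod_topology ?I P') euclideanreal fst"
    using continuous_map_fst continuous_map_into_fulltopology by blast
  have "continuous_map (prod_topology ?I P') euclideanreal (\<lambda>x. fst (coordinates (snd x)))"
    "continuous_map (prod_topology ?I P') euclideanreal (\<lambda>x. clamp_radius (fst (coordinates (snd x))))"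
    using continuous_map_compose[OF continuous_map_snd continuous_coordinate_parts(1), of ?I]
      continuous_map_compose[OF continuous_map_snd continuous_coordinate_parts(3), of ?I] by (simp_all add: o_def)
  then have r: "continuous_map (prod_topology ?I P') euclideanreal (\<lambda>x. fst (k x))"
    unfolding k_def fst_conv
    by (intro continuous_map_add continuous_map_real_mult continuous_map_diff s continuous_map_const[THEN iffD2] disjI2) auto
  have v: "continuous_map (prod_topology ?I P') S (\<lambda>x. snd (k x))"
    using continuous_map_compose[OF continuous_map_snd continuous_coordinate_parts(2), of ?I] by (simp add: o_def k_def)
  have pos: "fst (k x) > 0" if hx: "x \<in> topspace (prod_topology ?I P')" for x
  proof -
    have x: "snd x \<in> topspace P'" "0 \<le> fst x" "fst x \<le> 1" using hx by (cases x; auto)+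
    obtain r v where "r > 0" "coordinates (snd x) = (r, v)" by (rule polar_coordinates[OF x(1)])
    then show ?thesis using clamp_mix_pos[OF x(2,3)] by (simp add: k_def)
  qed
  have "continuous_map (prod_topology ?I P') half_open_cylinder k"
    using r v pos by (simp add: continuous_map_pairwise continuous_map_in_subtopology o_def Pi_iff)
  from continuous_map_compose[OF this continuous_polar] show ?thesis
    by (simp add: o_def k_def split_def clamp_homotopy_def)
qed

text \<open>Radii up to 1/2 move towards 1/2 and radii from 1 on move towards 1, so no path enters
  the open annulus.\<close>

lemma clamp_homotopy_W:
  assumes s: "0 \<le> s" "s \<le> 1" and p: "p \<in> topspace P'" "p \<in> W - X\<^sub>0"
  shows "clamp_homotopy (s, p) \<in> W - X\<^sub>0"
proof -
  obtain r v where rv: "r > 0" "v \<in> topspace S" "coordinates p = (r, v)" "p = q (polar (r, v))"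
    by (rule polar_coordinates[OF p(1)])
  define r' where "r' = (1 - s) * r + s * clamp_radius r"
  have r': "r' > 0" unfolding r'_def by (rule clamp_mix_pos[OF s rv(1)])
  have "r \<le> 1/2 \<or> r \<ge> 1" using p(2) polar_in_W_iff[OF rv(2,1)] rv(4) by simp
  then have "r' \<le> 1/2 \<or> r' \<ge> 1"
  proof
    assume r: "r \<le> 1/2"
    then have "(1 - s) * r \<le> (1 - s) * (1/2)" using s by (intro mult_left_mono) auto
    moreover have "clamp_radius r = 1/2" using r by (simp add: clamp_radius_def)
    ultimately show ?thesis by (simp add: r'_def field_simps)
  next
    assume r: "r \<ge> 1"
    then have "(1 - s) * 1 \<le> (1 - s) * r" using s by (intro mult_left_mono) auto
    moreover have "clamp_radius r = 1" using r by (simp add: clamp_radius_def)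
    ultimately show ?thesis by (simp add: r'_def)
  qed
  then have "q (polar (r', v)) \<in> W" using polar_in_W_iff[OF rv(2) r'] by simp
  moreover have "(r', v) \<in> topspace half_open_cylinder" using r' rv(2) by simp
  then have "(q \<circ> polar) (r', v) \<in> topspace P'"
    using continuous_map_image_subset_topspace[OF continuous_polar] by blast
  moreover have "clamp_homotopy (s, p) = q (polar (r', v))" by (simp add: clamp_homotopy_def rv(3) r'_def)
  ultimately show ?thesis by simp
qed

lemma clamp_homotopy_ends:
  assumes p: "p \<in> topspace P'"
  shows "clamp_homotopy (0, p) = p" "clamp_homotopy (1, p) = cylinder_incl (clamp_coordinates p)"
proof -
  obtain r v where rv: "r > 0" "v \<in> topspace S" "coordinates p = (r, v)" "p = q (polar (r, v))"
    by (rule polar_coordinates[OF p])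
  have "0 \<le> clamp_radius r" by (simp add: clamp_radius_def)
  then have "cylinder_incl (clamp_radius r, v) = q (polar (clamp_radius r, v))" by (rule cylinder_incl_polar[OF rv(2)])
  moreover have "clamp_coordinates p = (clamp_radius r, v)" by (simp add: clamp_coordinates_def rv(3))
  ultimately show "clamp_homotopy (1, p) = cylinder_incl (clamp_coordinates p)"
    by (simp only:) (simp add: clamp_homotopy_def rv(3))
  show "clamp_homotopy (0, p) = p"
    by (simp add: clamp_homotopy_def rv(3)) (rule rv(4)[symmetric])
qed

lemma clamp_coordinates_incl:
  assumes "x \<in> topspace (cylinder S)" shows "clamp_coordinates (cylinder_incl x) = x"
proof -
  obtain r v where rv: "x = (r, v)" "1/2 \<le> r" "r \<le> 1" "v \<in> topspace S" by (rule cylinder_cases[OF assms])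
  have "cylinder_incl x = q (polar (r, v))" using cylinder_incl_polar[of v r] rv by simp
  moreover have "coordinates (q (polar (r, v))) = (r, v)" using coordinates_polar[of v r] rv by simp
  ultimately show ?thesis using rv by (simp only: clamp_coordinates_def) (simp add: clamp_radius_def)
qed

text \<open>Clamping restores every point of the cylinder exactly, so the homotopy on that side is
  constant, given by the second projection.\<close>

lemma cylinder_incl_iso_excised:
  "induced_map P' (W - X\<^sub>0) cylinder_incl \<in>
    iso (rel_homology R (cylinder S) (cylinder_ends S)) (rel_homology R P' (W - X\<^sub>0))"
proof (rule induced_map_iso_homotopy_equivalence[OF pair_map_cylinder_incl_excised pair_map_clamp_coordinates
      continuous_map_snd _ _ _ continuous_clamp_homotopy clamp_homotopy_W clamp_homotopy_ends])
qed (simp_all add: clamp_coordinates_incl)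

lemma pair_map_cylinder_incl: "pair_map (cylinder S) (cylinder_ends S) P W cylinder_incl"
  using pair_map_cylinder_incl_excised continuous_map_into_fulltopology[OF continuous_cylinder_incl]
  by (simp only: pair_map_def) blast

text \<open>The map factors through the complement of the zero section, where it is a homotopy
  equivalence of pairs, followed by excision. The factorisation is checked on classes, so
  bijectivity is transferred on the carrier.\<close>

lemma cylinder_map_iso:
  "cylinder_map \<xi> h \<in> iso (rel_homology R (cylinder S) (cylinder_ends S)) (rel_homology R P W)"
proof -
  let ?A = "rel_homology R (cylinder S) (cylinder_ends S)" and ?B = "rel_homology R P' (W - X\<^sub>0)" and ?C = "rel_homology R P W"
  have i: "induced_map P' (W - X\<^sub>0) cylinder_incl \<in> iso ?A ?B" by (rule cylinder_incl_iso_excised)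
  have j: "induced_map P W id \<in> iso ?B ?C"
    by (rule induced_map_iso_excision[OF W_subset closed_X\<^sub>0 X\<^sub>0_interior_W])
  have bij: "bij_betw (induced_map P W id \<circ> induced_map P' (W - X\<^sub>0) cylinder_incl) (carrier ?A) (carrier ?C)"
    using i j by (auto simp: iso_def intro: bij_betw_trans)
  have eq: "(induced_map P W id \<circ> induced_map P' (W - X\<^sub>0) cylinder_incl) x = cylinder_map \<xi> h x"
    if hx: "x \<in> carrier ?A" for x
  proof -
    obtain c where c: "c \<in> rel_cycles (cylinder S) (cylinder_ends S)" "x = homology_class (cylinder S) (cylinder_ends S) c"
      using hx by (rule rel_homologyE)
    have p2: "pair_map P' (W - X\<^sub>0) P W id" by (auto simp: pair_map_def)
    show ?thesis
      by (simp add: c(2) cylinder_map_def induced_map_class[OF pair_map_cylinder_incl_excised] induced_map_class[OF p2] induced_map_class[OF pair_map_cylinder_incl] push_push)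
  qed
  have "bij_betw (cylinder_map \<xi> h) (carrier ?A) (carrier ?C)"
    by (rule bij_betw_cong[THEN iffD1, OF eq bij])
  then show ?thesis
    using induced_map_hom[OF pair_map_cylinder_incl] by (simp add: iso_def cylinder_map_def)
qed

end

section \<open>The split exact sequence\<close>

lemma (in left_module) act_hom: "a \<in> carrier A \<Longrightarrow> act a \<in> hom M M"
  by (auto simp: hom_def act_closed act_add_right)

lemma (in left_module) act_inv:
  assumes "a \<in> carrier A" "x \<in> carrier M" shows "act a (inv\<^bsub>M\<^esub> x) = inv\<^bsub>M\<^esub> (act a x)"
proof -
  interpret h: group_hom M M "act a"
    by unfold_locales (rule act_hom[OF assms(1)])
  show ?thesis using assms(2) by simp
qed

text \<open>The map \<open>r\<close> kills the image of \<open>f\<close>, which is the kernel of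
  \<open>g\<close>, so it is constant on the fibres of \<open>g\<close> and descends to
  \<open>N\<close>. The explicit formula is kept because the degree of the splitting is read off
  from it.\<close>

lemma retraction_splits:
  assumes M: "left_module A M actM" and N: "comm_group N" and L: "comm_group L"
    and f: "f \<in> linear_hom A L actL M actM" and g: "g \<in> linear_hom A M actM N actN" and p: "p \<in> linear_hom A M actM L actL"
    and exact: "short_exact L M N f g" and pf: "\<And>x. x \<in> carrier L \<Longrightarrow> p (f x) = x"
  obtains s where "s \<in> linear_hom A N actN M actM" "splits N g s"
    "\<And>m. m \<in> carrier M \<Longrightarrow> s (g m) = m \<otimes>\<^bsub>M\<^esub> inv\<^bsub>M\<^esub> f (p m)"
proof -
  interpret M: left_module A M actM by (rule M)
  interpret N: comm_group N by (rule N)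
  interpret L: comm_group L by (rule L)
  interpret f: group_hom L M f by unfold_locales (use f in \<open>simp add: linear_hom_def\<close>)
  interpret g: group_hom M N g by unfold_locales (use g in \<open>simp add: linear_hom_def\<close>)
  interpret p: group_hom M L p by unfold_locales (use p in \<open>simp add: linear_hom_def\<close>)
  define r where "r m = m \<otimes>\<^bsub>M\<^esub> inv\<^bsub>M\<^esub> f (p m)" for m
  have r_closed: "r m \<in> carrier M" if "m \<in> carrier M" for m using that by (simp add: r_def)
  have r_mult: "r (m \<otimes>\<^bsub>M\<^esub> m') = r m \<otimes>\<^bsub>M\<^esub> r m'" if "m \<in> carrier M" "m' \<in> carrier M" for m m'
    using that by (simp add: r_def M.M.inv_mult M.M.m_ac)
  have r_f: "r (f x) = \<one>\<^bsub>M\<^esub>" if "x \<in> carrier L" for x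
    using that by (simp add: r_def pf)
  have surj: "g ` carrier M = carrier N" and ker: "f ` carrier L = kernel M N g"
    using exact by (auto simp: short_exact_def epi_def)
  have r_eq: "r m = r m'" if m: "m \<in> carrier M" "m' \<in> carrier M" "g m = g m'" for m m'
  proof -
    have "m \<otimes>\<^bsub>M\<^esub> inv\<^bsub>M\<^esub> m' \<in> kernel M N g" using m by (simp add: kernel_def)
    then obtain x where x: "x \<in> carrier L" "m \<otimes>\<^bsub>M\<^esub> inv\<^bsub>M\<^esub> m' = f x" using ker by (metis imageE)
    then have "m = f x \<otimes>\<^bsub>M\<^esub> m'" using m by (metis M.M.inv_closed M.M.inv_solve_right M.M.l_inv M.M.m_assoc M.M.r_one M.M.m_closed)
    then show ?thesis using r_mult[of "f x" m'] r_f[OF x(1)] m(2) x(1) by (simp add: r_closed)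
  qed
  \<comment> \<open>Any preimage may be used, by \<open>r_eq\<close>.\<close>
  define s where "s y = r (inv_into (carrier M) g y)" for y
  have s_g: "s (g m) = r m" if "m \<in> carrier M" for m
    unfolding s_def using that by (intro r_eq) (auto simp: inv_into_into f_inv_into_f)
  have r_act: "r (actM a m) = actM a (r m)" if "a \<in> carrier A" "m \<in> carrier M" for a m
  proof -
    have "p (actM a m) = actL a (p m)" using p that by (simp add: linear_hom_def)
    moreover have "f (actL a (p m)) = actM a (f (p m))" using f that by (simp add: linear_hom_def)
    ultimately show ?thesis using that by (simp add: r_def M.act_add_right M.act_inv)
  qed
  show thesis
  proof
    show "s \<in> linear_hom A N actN M actM"
      unfolding linear_hom_def hom_def
    proof (intro CollectI conjI ballI funcsetI)
      fix y y' assume "y \<in> carrier N" "y' \<in> carrier N"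
      then obtain m m' where m: "m \<in> carrier M" "y = g m" "m' \<in> carrier M" "y' = g m'" using surj by (metis imageE)
      then show "s y \<in> carrier M" by (simp add: s_g r_closed)
      have "y \<otimes>\<^bsub>N\<^esub> y' = g (m \<otimes>\<^bsub>M\<^esub> m')" using m by simp
      then show "s (y \<otimes>\<^bsub>N\<^esub> y') = s y \<otimes>\<^bsub>M\<^esub> s y'" using m by (simp only: s_g r_mult M.M.m_closed)
    next
      fix a y assume a: "a \<in> carrier A" and "y \<in> carrier N"
      then obtain m where m: "m \<in> carrier M" "y = g m" using surj by (metis imageE)
      have "actN a y = g (actM a m)" using g a m by (simp add: linear_hom_def)
      then show "s (actN a y) = actM a (s y)" using m a by (simp add: s_g r_act M.act_closed)
    qed
    show "splits N g s"
      unfolding splits_def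
    proof
      fix y assume "y \<in> carrier N"
      then obtain m where m: "m \<in> carrier M" "y = g m" using surj by (metis imageE)
      have "f (p m) \<in> kernel M N g" using ker m by auto
      then have "g (f (p m)) = \<one>\<^bsub>N\<^esub>" by (simp add: kernel_def)
      then show "g (s y) = y" using m by (simp add: s_g r_def)
    qed
    show "s (g m) = m \<otimes>\<^bsub>M\<^esub> inv\<^bsub>M\<^esub> f (p m)" if "m \<in> carrier M" for m
      using s_g[OF that] by (simp add: r_def)
  qed
qed

lemma rel_homology_iso_injD:
  assumes "f \<in> iso (rel_homology R Y B) (rel_homology R Z C)" "c \<in> rel_cycles Y B"
    and "f (homology_class Y B c) = f (homology_class Y B 0)"
  shows "c \<in> rel_boundaries Y B"
proof -
  have "inj_on f (carrier (rel_homology R Y B))" using assms(1) by (simp add: iso_def bij_betw_def)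
  then have "homology_class Y B c = homology_class Y B 0"
    by (rule inj_onD[where f=f, OF _ assms(3)]) (simp_all add: homology_class_in_carrier assms(2))
  then show ?thesis by (simp add: homology_class_eq_iff)
qed

lemma rel_homology_iso_surjD:
  assumes "f \<in> iso (rel_homology R Y B) (rel_homology R Z C)" "d \<in> rel_cycles Z C"
  obtains c where "c \<in> rel_cycles Y B" "f (homology_class Y B c) = homology_class Z C d"
proof -
  have "homology_class Z C d \<in> f ` carrier (rel_homology R Y B)"
    using assms homology_class_in_carrier[OF assms(2)] by (auto simp: iso_def bij_betw_def)
  then show thesis using that by (auto simp: carrier_rel_homology)
qed

section \<open>Residues, exactness and splitting\<close>

context hermitian_bundle
begin

text \<open>The cylinder thus lies over \<open>X\<close> in one way, and cochains pulled back
  through \<open>\<xi>\<^sup>P\<close> and through the sphere bundle agree on it.\<close>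

lemma proj_cylinder_incl:
  assumes "x \<in> topspace (cylinder S)" shows "pinched_proj \<xi> (cylinder_incl x) = bproj \<xi> (snd x)"
proof -
  obtain r v where rv: "x = (r, v)" "1/2 \<le> r" "r \<le> 1" "v \<in> topspace S" by (rule cylinder_cases[OF assms])
  have "cylinder_incl x = q (polar (r, v))" using cylinder_incl_polar[of v r] rv by simp
  also have "pinched_proj \<xi> \<dots> = bproj \<xi> (fst (polar (r, v)))"
    using pinched_proj_q polar_in_\<Sigma>[OF rv(4), of r] by (simp add: polar_def)
  also have "\<dots> = bproj \<xi> v" using rv(4) by (simp add: polar_def bproj_rscale topspace_S)
  finally show ?thesis by (simp add: rv(1))
qed

lemma push_zero_section_proj:
  assumes "b \<in> chains_of (subtopology P X\<^sub>0)"
  shows "push_chain (zero_section \<xi> h) (push_chain (pinched_proj \<xi>) b) = b"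
  unfolding push_push by (rule push_id[OF assms]) (auto simp: proj_zero_section)

lemma push_zero_section_in_X\<^sub>0: "c \<in> chains_of X \<Longrightarrow> push_chain (zero_section \<xi> h) c \<in> chains_of (subtopology P X\<^sub>0)"
  using continuous_zero_section by (intro push_in_chains_of) (auto simp: continuous_map_in_subtopology)

lemma pair_map_X\<^sub>0: "pair_map P {} P X\<^sub>0 id" and pair_map_X\<^sub>0_W: "pair_map P X\<^sub>0 P W id"
  and pair_map_zero_section: "pair_map X {} P {} (zero_section \<xi> h)" and pair_map_proj: "pair_map P {} X {} (pinched_proj \<xi>)"
  using X\<^sub>0_W continuous_zero_section continuous_pinched_proj by (auto simp: pair_map_def)

lemma push_id_P: "c \<in> chains_of Y \<Longrightarrow> push_chain id c = c"
  by (rule push_id) auto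

lemma enlarge_map_class:
  "c \<in> chains_of P \<Longrightarrow> enlarge_map \<xi> h (homology_class P X\<^sub>0 c) = homology_class P W c"
  by (simp add: enlarge_map_def induced_map_class[OF pair_map_X\<^sub>0_W] push_id_P)

lemma cylinder_map_class:
  "cylinder_map \<xi> h (homology_class (cylinder S) (cylinder_ends S) e) = homology_class P W (push_chain cylinder_incl e)"
  by (simp add: cylinder_map_def induced_map_class[OF pair_map_cylinder_incl])

lemma residue_class:
  fixes c :: "(('e \<times> real) set, 'r::{comm_ring,comm_monoid_mult}) chains"
  assumes c: "c \<in> rel_cycles P {}" and e: "e \<in> rel_cycles (cylinder S) (cylinder_ends S)"
    and ce: "push_chain cylinder_incl e - c \<in> rel_boundaries P W"
  shows "residue_map \<xi> h X (homology_class P {} c) = homology_class S {} (end_part 1 (boundary e))"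
proof -
  let ?A = "carrier (rel_homology TYPE('r) (cylinder S) (cylinder_ends S))"
  have cP: "c \<in> chains_of P" using c by (simp add: rel_cycles_def)
  have "cylinder_map \<xi> h (homology_class (cylinder S) (cylinder_ends S) e) = homology_class P W c"
    by (simp only: cylinder_map_class homology_class_eqI[OF ce])
  moreover have "inj_on (cylinder_map \<xi> h) ?A"
    using cylinder_map_iso[of "TYPE('r)"] by (simp add: iso_def bij_betw_def)
  ultimately have "inv_into ?A (cylinder_map \<xi> h) (homology_class P W c) = homology_class (cylinder S) (cylinder_ends S) e"
    using homology_class_in_carrier[OF e] by (metis inv_into_f_f)
  moreover have "induced_map P X\<^sub>0 id (homology_class P {} c) = homology_class P X\<^sub>0 c"
    by (simp add: induced_map_class[OF pair_map_X\<^sub>0] push_id_P[OF cP])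
  ultimately show ?thesis
    by (simp only: residue_map_def o_apply enlarge_map_class[OF cP] theta_map_class[OF e])
qed

lemma cycle_in_cylinder:
  assumes "c \<in> rel_cycles P W"
  obtains e where "e \<in> rel_cycles (cylinder S) (cylinder_ends S)" "push_chain cylinder_incl e - c \<in> rel_boundaries P W"
  using rel_homology_iso_surjD[OF cylinder_map_iso assms] unfolding cylinder_map_class homology_class_eq_iff by blast

lemma absolute_cycle: "c \<in> rel_cycles Y {} \<Longrightarrow> c \<in> rel_cycles Y B"
  by (auto simp: rel_cycles_def)

lemma residue_obtain:
  assumes "c \<in> rel_cycles P {}"
  obtains e where "e \<in> rel_cycles (cylinder S) (cylinder_ends S)" "push_chain cylinder_incl e - c \<in> rel_boundaries P W"
    "residue_map \<xi> h X (homology_class P {} c) = homology_class S {} (end_part 1 (boundary e))"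
    "end_part 1 (boundary e) \<in> rel_cycles S {}"
proof -
  obtain e where e: "e \<in> rel_cycles (cylinder S) (cylinder_ends S)" "push_chain cylinder_incl e - c \<in> rel_boundaries P W"
    by (rule cycle_in_cylinder[OF absolute_cycle[OF assms]])
  show thesis
    by (rule that[OF e residue_class[OF assms e] end_part_boundary_cycle[OF e(1)]]) simp
qed

lemma residue_hom: "residue_map \<xi> h X \<in> hom (homology R P) (homology R S)"
  unfolding hom_def
proof (intro CollectI conjI ballI funcsetI)
  fix x y assume x: "x \<in> carrier (homology R P)" and y: "y \<in> carrier (homology R P)"
  obtain c where c: "c \<in> rel_cycles P {}" "x = homology_class P {} c" using x by (rule rel_homologyE)
  obtain d where d: "d \<in> rel_cycles P {}" "y = homology_class P {} d" using y by (rule rel_homologyE)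
  obtain e where e: "e \<in> rel_cycles (cylinder S) (cylinder_ends S)" "push_chain cylinder_incl e - c \<in> rel_boundaries P W"
    "residue_map \<xi> h X (homology_class P {} c) = homology_class S {} (end_part 1 (boundary e))"
    "end_part 1 (boundary e) \<in> rel_cycles S {}" by (rule residue_obtain[OF c(1)])
  obtain e' where e': "e' \<in> rel_cycles (cylinder S) (cylinder_ends S)" "push_chain cylinder_incl e' - d \<in> rel_boundaries P W"
    "residue_map \<xi> h X (homology_class P {} d) = homology_class S {} (end_part 1 (boundary e'))"
    "end_part 1 (boundary e') \<in> rel_cycles S {}" by (rule residue_obtain[OF d(1)])
  show "residue_map \<xi> h X x \<in> carrier (homology R S)"
    unfolding c(2) e(3) by (rule homology_class_in_carrier[OF e(4)])
  have "push_chain cylinder_incl (e + e') - (c + d) = (push_chain cylinder_incl e - c) + (push_chain cylinder_incl e' - d)"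
    by (simp add: push_add)
  also have "\<dots> \<in> rel_boundaries P W" by (rule rel_boundaries_add[OF e(2) e'(2)])
  finally have "residue_map \<xi> h X (homology_class P {} (c + d)) = homology_class S {} (end_part 1 (boundary (e + e')))"
    by (rule residue_class[OF rel_cycles_add[OF c(1) d(1)] rel_cycles_add[OF e(1) e'(1)]])
  then show "residue_map \<xi> h X (x \<otimes>\<^bsub>homology R P\<^esub> y) = residue_map \<xi> h X x \<otimes>\<^bsub>homology R S\<^esub> residue_map \<xi> h X y"
    by (simp add: c(2) d(2) mult_rel_homology c(1) d(1) e(3,4) e'(3,4) boundary_add end_part_add)
qed

lemma residue_linear:
  "residue_map \<xi> h X \<in> linear_hom (cohomology R X) (homology R P) (homology_action P (pinched_proj \<xi>))
     (homology R S) (homology_action S (bproj \<xi>))"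
  unfolding linear_hom_def
proof (intro CollectI conjI ballI residue_hom)
  fix a x assume a: "a \<in> carrier (cohomology R X)" and x: "x \<in> carrier (homology R P)"
  obtain \<phi> where \<phi>: "\<phi> \<in> carrier (cocycle_ring R X)" "a = cohomology_class X \<phi>" using a by (rule cohomologyE)
  obtain c where c: "c \<in> rel_cycles P {}" "x = homology_class P {} c" using x by (rule rel_homologyE)
  obtain e where e: "e \<in> rel_cycles (cylinder S) (cylinder_ends S)" "push_chain cylinder_incl e - c \<in> rel_boundaries P W"
    "residue_map \<xi> h X (homology_class P {} c) = homology_class S {} (end_part 1 (boundary e))"
    "end_part 1 (boundary e) \<in> rel_cycles S {}" by (rule residue_obtain[OF c(1)])
  have S: "continuous_map S X (bproj \<xi>)"
    unfolding sphere_bundle_def by (rule continuous_map_from_subtopology[OF continuous_bproj])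
  have C: "continuous_map (cylinder S) X (bproj \<xi> \<circ> snd)"
    by (rule continuous_map_compose[OF continuous_map_cylinder_snd S])
  define \<phi>P where "\<phi>P = pull_cochain P (pinched_proj \<xi>) \<phi>"
  define \<phi>S where "\<phi>S = pull_cochain S (bproj \<xi>) \<phi>"
  \<comment> \<open>Mediates between the two ends of the zig-zag: it is the pullback of both
    \<open>\<phi>P\<close> and \<open>\<phi>S\<close>.\<close>
  define \<phi>C where "\<phi>C = pull_cochain (cylinder S) (bproj \<xi> \<circ> snd) \<phi>"
  have coc: "\<phi>P \<in> carrier (cocycle_ring R P)" "\<phi>S \<in> carrier (cocycle_ring R S)" "\<phi>C \<in> carrier (cocycle_ring R (cylinder S))"
    unfolding \<phi>P_def \<phi>S_def \<phi>C_def using pull_in_cocycles[OF _ \<phi>(1)] continuous_pinched_proj S C by blast+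
  have incl: "continuous_map (cylinder S) P cylinder_incl"
    using pair_map_cylinder_incl by (simp add: pair_map_def)
  have CP: "\<phi>C = pull_cochain (cylinder S) cylinder_incl \<phi>P"
    unfolding \<phi>C_def \<phi>P_def by (rule pull_pull[symmetric, OF incl]) (simp add: proj_cylinder_incl)
  have CS: "\<phi>C = pull_cochain (cylinder S) snd \<phi>S"
    unfolding \<phi>C_def \<phi>S_def by (rule pull_pull[symmetric, OF continuous_map_cylinder_snd]) simp
  have eC: "e \<in> chains_of (cylinder S)" "boundary e \<in> chains_of (cylinder_boundary S)"
    using e(1) by (auto simp: rel_cycles_def)
  have "push_chain cylinder_incl (cap \<phi>C e) - cap \<phi>P c = cap \<phi>P (push_chain cylinder_incl e - c)"
    unfolding CP push_cap_pull[OF eC(1)] by (simp add: cap_diff)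
  also have "\<dots> \<in> rel_boundaries P W" by (rule cap_rel_boundaries[OF coc(1) e(2)])
  finally have "residue_map \<xi> h X (homology_class P {} (cap \<phi>P c)) = homology_class S {} (end_part 1 (boundary (cap \<phi>C e)))"
    by (rule residue_class[OF cap_rel_cycles[OF coc(1) c(1)] cap_rel_cycles[OF coc(3) e(1)]])
  \<comment> \<open>This is where the connecting map is linear without a sign.\<close>
  also have "boundary (cap \<phi>C e) = cap \<phi>C (boundary e)"
    using coc(3) by (intro cap_cocycle_boundary[OF _ eC(1)]) (simp add: cocycle_ring_simps)
  also have "end_part 1 (cap \<phi>C (boundary e)) = cap \<phi>S (end_part 1 (boundary e))"
    unfolding CS using coc(2) by (intro cap_end_part[OF eC(2)]) (simp_all add: cocycle_ring_simps)
  finally show "residue_map \<xi> h X (homology_action P (pinched_proj \<xi>) a x) = homology_action S (bproj \<xi>) a (residue_map \<xi> h X x)"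
    using homology_action_class[OF continuous_pinched_proj \<phi>(1) c(1)] homology_action_class[OF S \<phi>(1) e(4)]
    by (simp only: \<phi>(2) c(2) e(3) \<phi>P_def[symmetric] \<phi>S_def[symmetric])
qed

text \<open>Projecting both \<open>c\<close> and its companion \<open>e\<close> to degree
  \<open>Suc n\<close> keeps them related, and the boundary of \<open>e\<close> then has degree
  \<open>n\<close>. In degree 0 that boundary is zero.\<close>

lemma residue_degree:
  assumes c: "c \<in> rel_cycles P {}" and y: "y \<in> rel_cycles S {}"
    and "residue_map \<xi> h X (homology_class P {} c) = homology_class S {} y"
  shows "residue_map \<xi> h X (homology_class P {} (degree_part (Suc n) c)) = homology_class S {} (degree_part n y)"
    and "residue_map \<xi> h X (homology_class P {} (degree_part 0 c)) = homology_class S {} 0"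
proof -
  obtain e where e: "e \<in> rel_cycles (cylinder S) (cylinder_ends S)" "push_chain cylinder_incl e - c \<in> rel_boundaries P W"
    "residue_map \<xi> h X (homology_class P {} c) = homology_class S {} (end_part 1 (boundary e))"
    "end_part 1 (boundary e) \<in> rel_cycles S {}" by (rule residue_obtain[OF c])
  have eC: "e \<in> chains_of (cylinder S)" "boundary e \<in> chains_of (cylinder_boundary S)"
    using e(1) by (auto simp: rel_cycles_def)
  have "end_part 1 (boundary e) - y \<in> rel_boundaries S {}"
    using assms(3) e(3) by (simp add: homology_class_eq_iff)
  then have ey: "degree_part n (end_part 1 (boundary e)) - degree_part n y \<in> rel_boundaries S {}" for n
    using degree_part_rel_boundaries by (fastforce simp flip: degree_part_diff)
  have res: "residue_map \<xi> h X (homology_class P {} (degree_part k c)) = homology_class S {} (end_part 1 (boundary (degree_part k e)))" for k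
  proof (rule residue_class[OF degree_part_rel_cycles[OF c] degree_part_rel_cycles[OF e(1)]])
    have "push_chain cylinder_incl (degree_part k e) - degree_part k c = degree_part k (push_chain cylinder_incl e - c)"
      by (simp add: push_degree_part[OF eC(1)] degree_part_diff)
    then show "push_chain cylinder_incl (degree_part k e) - degree_part k c \<in> rel_boundaries P W"
      using degree_part_rel_boundaries[OF e(2)] by simp
  qed
  show "residue_map \<xi> h X (homology_class P {} (degree_part (Suc n) c)) = homology_class S {} (degree_part n y)"
    unfolding res boundary_degree_part_Suc[OF eC(1)] using degree_part_end_part[OF eC(2), of 1 n] ey[of n]
    by (simp add: homology_class_eq_iff)
  show "residue_map \<xi> h X (homology_class P {} (degree_part 0 c)) = homology_class S {} 0"
    unfolding res boundary_degree_part_0[OF eC(1)] by simp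
qed

lemma residue_homology_degree:
  "residue_map \<xi> h X ` homology_degree R P (Suc n) \<subseteq> homology_degree R S n"
  "residue_map \<xi> h X ` homology_degree R P 0 \<subseteq> {\<one>\<^bsub>homology R S\<^esub>}"
proof -
  have *: "residue_map \<xi> h X (homology_class P {} c) \<in> homology_degree R S n"
    if c: "c \<in> rel_cycles P {}" "degree_part (Suc n) c = c" for c
  proof -
    obtain e where e: "residue_map \<xi> h X (homology_class P {} c) = homology_class S {} (end_part 1 (boundary e))"
      "end_part 1 (boundary e) \<in> rel_cycles S {}" using residue_obtain[OF c(1)] by metis
    have "residue_map \<xi> h X (homology_class P {} c) = homology_class S {} (degree_part n (end_part 1 (boundary e)))"
      using residue_degree(1)[OF c(1) e(2,1), of n] c(2) by simp
    then show ?thesis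
      using degree_part_rel_cycles[OF e(2), of n] unfolding homology_degree_eq by (auto intro: image_eqI)
  qed
  then show "residue_map \<xi> h X ` homology_degree R P (Suc n) \<subseteq> homology_degree R S n"
    unfolding homology_degree_eq[of R P] by blast
  have "residue_map \<xi> h X (homology_class P {} c) = \<one>\<^bsub>homology R S\<^esub>"
    if c: "c \<in> rel_cycles P {}" "degree_part 0 c = c" for c
  proof -
    obtain e where e: "residue_map \<xi> h X (homology_class P {} c) = homology_class S {} (end_part 1 (boundary e))"
      "end_part 1 (boundary e) \<in> rel_cycles S {}" using residue_obtain[OF c(1)] by metis
    show ?thesis using residue_degree(2)[OF c(1) e(2,1)] c(2) by (simp add: one_rel_homology)
  qed
  then show "residue_map \<xi> h X ` homology_degree R P 0 \<subseteq> {\<one>\<^bsub>homology R S\<^esub>}"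
    unfolding homology_degree_eq[of R P] by blast
qed

lemma short_exact_residue:
  "short_exact (homology R X) (homology R P) (homology R S) (zero_section_map \<xi> h) (residue_map \<xi> h X)"
proof -
  note z = pair_map_zero_section and \<pi> = pair_map_proj
  have z_class: "zero_section_map \<xi> h (homology_class X {} c) = homology_class P {} (push_chain (zero_section \<xi> h) c)" for c :: "('a, 'b) chains"
    by (simp add: zero_section_map_def induced_map_class[OF z])
  have \<pi>z: "push_chain (pinched_proj \<xi>) (push_chain (zero_section \<xi> h) c) = c" if "c \<in> chains_of X" for c :: "('a, 'b) chains"
    unfolding push_push by (rule push_id[OF that]) (simp add: proj_zero_section)
  have "zero_section_map \<xi> h \<in> hom (homology R X) (homology R P)"
    unfolding zero_section_map_def by (rule induced_map_hom[OF z])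
  moreover have "inj_on (zero_section_map \<xi> h) (carrier (homology R X))"
  proof (rule inj_onI)
    fix x y assume "x \<in> carrier (homology R X)" "y \<in> carrier (homology R X)" and eq: "zero_section_map \<xi> h x = zero_section_map \<xi> h y"
    then obtain c d where cd: "c \<in> rel_cycles X {}" "x = homology_class X {} c" "d \<in> rel_cycles X {}" "y = homology_class X {} d"
      by (meson rel_homologyE)
    then have "push_chain (zero_section \<xi> h) (c - d) \<in> rel_boundaries P {}"
      using eq by (simp add: z_class homology_class_eq_iff push_diff)
    \<comment> \<open>Injectivity comes from the projection, which undoes the zero section already
      on chains.\<close>
    from push_rel_boundaries[OF \<pi> this] have "c - d \<in> rel_boundaries X {}"
      using cd by (simp add: \<pi>z rel_cycles_def chains_of_diff)
    then show "x = y" using cd by (simp add: homology_class_eq_iff)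
  qed
  ultimately have mon: "zero_section_map \<xi> h \<in> mon (homology R X) (homology R P)"
    by (simp add: mon_def)
  have surj: "y \<in> residue_map \<xi> h X ` carrier (homology R P)" if "y \<in> carrier (homology R S)" for y
  proof -
    obtain u where u: "u \<in> rel_cycles S {}" "y = homology_class S {} u" using \<open>y \<in> carrier (homology R S)\<close> by (rule rel_homologyE)
    obtain e where e: "e \<in> rel_cycles (cylinder S) (cylinder_ends S)"
      "theta_map S (homology_class (cylinder S) (cylinder_ends S) e) = homology_class S {} u"
      by (rule rel_homology_iso_surjD[OF theta_map_iso u(1)])
    obtain c0 where c0: "c0 \<in> rel_cycles P X\<^sub>0" "enlarge_map \<xi> h (homology_class P X\<^sub>0 c0) = homology_class P W (push_chain cylinder_incl e)"
      by (rule rel_homology_iso_surjD[OF enlarge_map_iso push_rel_cycles[OF pair_map_cylinder_incl e(1)]])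
    have c0P: "c0 \<in> chains_of P" "boundary c0 \<in> chains_of (subtopology P X\<^sub>0)" using c0(1) by (auto simp: rel_cycles_def)
    \<comment> \<open>Lifting through the zig-zag gives only a cycle modulo the zero section. Its
      image under projection and zero section lies in the zero section and has the same boundary, so
      the difference is an absolute cycle.\<close>
    let ?zp = "\<lambda>c :: (('e \<times> real) set, 'b) chains. push_chain (zero_section \<xi> h) (push_chain (pinched_proj \<xi>) c)"
    have pX: "push_chain (pinched_proj \<xi>) c0 \<in> chains_of X" by (rule push_in_chains_of[OF continuous_pinched_proj c0P(1)])
    have zp: "?zp c0 \<in> chains_of (subtopology P X\<^sub>0)" by (rule push_zero_section_in_X\<^sub>0[OF pX])
    have "boundary (?zp c0) = boundary c0"
      by (simp add: boundary_push[OF pX] boundary_push[OF c0P(1)] push_zero_section_proj[OF c0P(2)])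
    then have c: "c0 - ?zp c0 \<in> rel_cycles P {}"
      using c0P(1) chains_of_subtopology_subset[OF zp] by (simp add: rel_cycles_empty_iff chains_of_diff boundary_diff)
    have "?zp c0 \<in> rel_boundaries P W"
      by (rule rel_boundariesI[of 0, OF _ chains_of_subtopology_mono[OF zp X\<^sub>0_W]]) simp_all
    moreover have "c0 - push_chain cylinder_incl e \<in> rel_boundaries P W"
      using c0(2) by (simp add: enlarge_map_class[OF c0P(1)] homology_class_eq_iff)
    ultimately have "?zp c0 - (c0 - push_chain cylinder_incl e) \<in> rel_boundaries P W" by (rule rel_boundaries_diff)
    then have "push_chain cylinder_incl e - (c0 - ?zp c0) \<in> rel_boundaries P W" by (simp add: algebra_simps)
    then have "residue_map \<xi> h X (homology_class P {} (c0 - ?zp c0)) = y"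
      using residue_class[OF c e(1)] e(2) theta_map_class[OF e(1)] u(2) by simp
    then show ?thesis using homology_class_in_carrier[OF c, of R] by blast
  qed
  have "residue_map \<xi> h X ` carrier (homology R P) = carrier (homology R S)"
    using surj hom_carrier[OF residue_hom[of R]] by blast
  then have epi: "residue_map \<xi> h X \<in> epi (homology R P) (homology R S)"
    using residue_hom by (simp add: epi_def)
  have "zero_section_map \<xi> h x \<in> kernel (homology R P) (homology R S) (residue_map \<xi> h X)" if "x \<in> carrier (homology R X)" for x
  proof -
    obtain c where c: "c \<in> rel_cycles X {}" "x = homology_class X {} c" using \<open>x \<in> carrier (homology R X)\<close> by (rule rel_homologyE)
    have zc: "push_chain (zero_section \<xi> h) c \<in> rel_cycles P {}" by (rule push_rel_cycles[OF z c(1)])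
    have "push_chain (zero_section \<xi> h) c \<in> chains_of (subtopology P X\<^sub>0)"
      using c(1) by (simp add: push_zero_section_in_X\<^sub>0 rel_cycles_def)
    then have "push_chain (zero_section \<xi> h) c \<in> rel_boundaries P W"
      by (intro rel_boundariesI[of 0, OF _ chains_of_subtopology_mono[OF _ X\<^sub>0_W]]) simp_all
    \<comment> \<open>A cycle on the zero section is zero modulo the complement of the annulus, so
      the zero chain of the cylinder computes its residue.\<close>
    then have "push_chain cylinder_incl 0 - push_chain (zero_section \<xi> h) c \<in> rel_boundaries P W"
      by (simp add: rel_boundaries_uminus)
    then have "residue_map \<xi> h X (homology_class P {} (push_chain (zero_section \<xi> h) c)) = homology_class S {} (end_part 1 (boundary 0))"
      by (rule residue_class[OF zc rel_cycles_0])
    then show ?thesis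
      using homology_class_in_carrier[OF zc, of R] by (simp add: c(2) z_class kernel_def one_rel_homology)
  qed
  moreover have "x \<in> zero_section_map \<xi> h ` carrier (homology R X)"
    if x: "x \<in> kernel (homology R P) (homology R S) (residue_map \<xi> h X)" for x
  proof -
    have "x \<in> carrier (homology R P)" and res: "residue_map \<xi> h X x = \<one>\<^bsub>homology R S\<^esub>" using x by (auto simp: kernel_def)
    then obtain c where c: "c \<in> rel_cycles P {}" "x = homology_class P {} c" by (meson rel_homologyE)
    have cP: "c \<in> chains_of P" "boundary c = 0" using c(1) by (auto simp: rel_cycles_empty_iff)
    obtain e where e: "e \<in> rel_cycles (cylinder S) (cylinder_ends S)" "push_chain cylinder_incl e - c \<in> rel_boundaries P W"
      "residue_map \<xi> h X (homology_class P {} c) = homology_class S {} (end_part 1 (boundary e))"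
      using residue_obtain[OF c(1)] by metis
    \<comment> \<open>Injectivity of \<Theta> makes \<open>e\<close> bound relative to the ends, so
      \<open>c\<close> bounds modulo the complement of the annulus; injectivity of
      \<open>enlarge_map\<close> improves this to the zero section.\<close>
    have "theta_map S (homology_class (cylinder S) (cylinder_ends S) e) = theta_map S (homology_class (cylinder S) (cylinder_ends S) 0)"
      using res e(3) by (simp add: theta_map_class[OF e(1)] theta_map_class[OF rel_cycles_0] c(2) one_rel_homology)
    then have "e \<in> rel_boundaries (cylinder S) (cylinder_ends S)"
      by (rule rel_homology_iso_injD[OF theta_map_iso[of _ "TYPE('b)"] e(1)])
    then have "push_chain cylinder_incl e \<in> rel_boundaries P W" by (rule push_rel_boundaries[OF pair_map_cylinder_incl])
    then have "c \<in> rel_boundaries P W" using rel_boundaries_diff[OF _ e(2)] by fastforce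
    then have "enlarge_map \<xi> h (homology_class P X\<^sub>0 c) = enlarge_map \<xi> h (homology_class P X\<^sub>0 0)"
      by (simp add: enlarge_map_class cP homology_class_eq_iff)
    then have "c \<in> rel_boundaries P X\<^sub>0"
      by (rule rel_homology_iso_injD[OF enlarge_map_iso[of "TYPE('b)"] absolute_cycle[OF c(1)]])
    then obtain d b where db: "d \<in> chains_of P" "b \<in> chains_of (subtopology P X\<^sub>0)" "c = boundary d + b" by (rule rel_boundariesE)
    have bP: "b \<in> chains_of P" by (rule chains_of_subtopology_subset[OF db(2)])
    \<comment> \<open>The remainder \<open>b\<close> in the zero section is a cycle, and such chains
      are recovered from their projection to \<open>X\<close>.\<close>
    have "boundary b = 0" using cP(2) by (simp add: db(3) boundary_add boundary_boundary[OF db(1)])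
    then have "b \<in> rel_cycles P {}" using bP by (simp add: rel_cycles_empty_iff)
    from push_rel_cycles[OF \<pi> this] have pb: "push_chain (pinched_proj \<xi>) b \<in> rel_cycles X {}" .
    have "c - b \<in> rel_boundaries P {}" using db by (auto simp: rel_boundaries_empty_iff)
    then have "x = zero_section_map \<xi> h (homology_class X {} (push_chain (pinched_proj \<xi>) b))"
      by (simp add: z_class push_zero_section_proj[OF db(2)] c(2) homology_class_eq_iff)
    then show ?thesis using homology_class_in_carrier[OF pb, of R] by blast
  qed
  ultimately have "zero_section_map \<xi> h ` carrier (homology R X) = kernel (homology R P) (homology R S) (residue_map \<xi> h X)"
    by blast
  then show ?thesis using mon epi by (simp add: short_exact_def)
qed

lemma zero_section_linear:
  "zero_section_map \<xi> h \<in> linear_hom (cohomology R X) (homology R X) (homology_action X id)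
     (homology R P) (homology_action P (pinched_proj \<xi>))"
  unfolding zero_section_map_def
  by (rule induced_map_linear[OF continuous_zero_section continuous_pinched_proj]) (simp add: proj_zero_section)

lemma sphere_bundle_module: "left_module (cohomology R X) (homology R S) (homology_action S (bproj \<xi>))"
  unfolding sphere_bundle_def
  by (rule left_module_homology[OF continuous_map_from_subtopology[OF continuous_bproj]])

lemma linear_splitting:
  obtains s where "s \<in> linear_hom (cohomology R X) (homology R S) (homology_action S (bproj \<xi>))
      (homology R P) (homology_action P (pinched_proj \<xi>))"
    "splits (homology R S) (residue_map \<xi> h X) s"
    "\<And>n. s ` homology_degree R S n \<subseteq> homology_degree R P (Suc n)"
proof -
  let ?z = "zero_section_map \<xi> h :: ('a, 'b) chains set \<Rightarrow> _" and ?p = "induced_map X {} (pinched_proj \<xi>) :: (_, 'b) chains set \<Rightarrow> _"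
  have p_lin: "?p \<in> linear_hom (cohomology R X) (homology R P) (homology_action P (pinched_proj \<xi>)) (homology R X) (homology_action X id)"
    by (rule induced_map_linear[OF continuous_pinched_proj continuous_map_id]) simp
  have pz: "?p (?z x) = x" if "x \<in> carrier (homology R X)" for x
  proof -
    obtain c where c: "c \<in> rel_cycles X {}" "x = homology_class X {} c" using \<open>x \<in> carrier (homology R X)\<close> by (rule rel_homologyE)
    have "push_chain (pinched_proj \<xi> \<circ> zero_section \<xi> h) c = c"
      using c(1) by (intro push_id[of c X]) (auto simp: rel_cycles_def proj_zero_section)
    then show ?thesis
      by (simp add: c(2) zero_section_map_def induced_map_class[OF pair_map_zero_section] induced_map_class[OF pair_map_proj] push_push)
  qed
  obtain s where s: "s \<in> linear_hom (cohomology R X) (homology R S) (homology_action S (bproj \<xi>))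
      (homology R P) (homology_action P (pinched_proj \<xi>))" "splits (homology R S) (residue_map \<xi> h X) s"
    "\<And>m. m \<in> carrier (homology R P) \<Longrightarrow> s (residue_map \<xi> h X m) = m \<otimes>\<^bsub>homology R P\<^esub> inv\<^bsub>homology R P\<^esub> (?z (?p m))"
    by (rule retraction_splits[OF left_module_homology[OF continuous_pinched_proj] comm_group_rel_homology comm_group_rel_homology
        zero_section_linear residue_linear p_lin short_exact_residue pz]) blast+
  have "s y \<in> homology_degree R P (Suc n)" if "y \<in> homology_degree R S n" for y n
  proof -
    obtain u where u: "u \<in> rel_cycles S {}" "degree_part n u = u" "y = homology_class S {} u"
      using \<open>y \<in> homology_degree R S n\<close> by (auto simp: homology_degree_eq)
    have "y \<in> carrier (homology R S)" unfolding u(3) by (rule homology_class_in_carrier[OF u(1)])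
    then have "y \<in> residue_map \<xi> h X ` carrier (homology R P)"
      using short_exact_residue[of R] by (simp add: short_exact_def epi_def)
    then obtain x where "x \<in> carrier (homology R P)" "y = residue_map \<xi> h X x" by blast
    then obtain c where c: "c \<in> rel_cycles P {}" "residue_map \<xi> h X (homology_class P {} c) = homology_class S {} u"
      using u(3) by (metis rel_homologyE)
    \<comment> \<open>A preimage may have mixed degree. Its component in degree \<open>Suc n\<close>
      has the same residue, since \<open>u\<close> is homogeneous of degree \<open>n\<close>, and
      the formula for \<open>s\<close> preserves the degree of \<open>c1\<close>.\<close>
    define c1 where "c1 = degree_part (Suc n) c"
    have c1: "c1 \<in> rel_cycles P {}" "degree_part (Suc n) c1 = c1"
      by (simp_all add: c1_def degree_part_rel_cycles[OF c(1)])
    have c1P: "c1 \<in> chains_of P" using c1(1) by (simp add: rel_cycles_def)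
    let ?zp = "push_chain (zero_section \<xi> h) (push_chain (pinched_proj \<xi>) c1)"
    have zp: "?zp \<in> rel_cycles P {}"
      by (rule push_rel_cycles[OF pair_map_zero_section push_rel_cycles[OF pair_map_proj c1(1)]])
    have "y = residue_map \<xi> h X (homology_class P {} c1)"
      using residue_degree(1)[OF c(1) u(1) c(2), of n] u(2,3) by (simp add: c1_def)
    then have "s y = homology_class P {} c1 \<otimes>\<^bsub>homology R P\<^esub> inv\<^bsub>homology R P\<^esub> (homology_class P {} ?zp)"
      using s(3)[OF homology_class_in_carrier[OF c1(1)]]
      by (simp add: zero_section_map_def induced_map_class[OF pair_map_zero_section] induced_map_class[OF pair_map_proj])
    also have "\<dots> = homology_class P {} (c1 - ?zp)"
      by (simp add: inv_rel_homology[OF zp] mult_rel_homology[OF c1(1) rel_cycles_uminus[OF zp]])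
    finally have sy: "s y = homology_class P {} (c1 - ?zp)" .
    have "degree_part (Suc n) ?zp = ?zp"
      using push_degree_part[OF push_in_chains_of[OF continuous_pinched_proj c1P], of "zero_section \<xi> h" "Suc n"]
        push_degree_part[OF c1P, of "pinched_proj \<xi>" "Suc n"] c1(2) by simp
    then have "degree_part (Suc n) (c1 - ?zp) = c1 - ?zp" by (simp add: degree_part_diff c1(2))
    then show ?thesis
      unfolding sy homology_degree_eq using rel_cycles_diff[OF c1(1) zp] by blast
  qed
  then show thesis using that s(1,2) by blast
qed

end

theorem proposition3p5:
  fixes R :: "'r::{comm_ring,comm_monoid_mult} itself"
    and X :: "'a topology"
    and \<xi> :: "('a, 'e) vbundle"
    and h :: "'e \<Rightarrow> 'e \<Rightarrow> complex"
  assumes "complex_vector_bundle X \<xi>"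
    and "hermitian_metric \<xi> h"
  shows
    "\<comment> \<open>the arrows of the zig-zag are isomorphisms, so the second map of the sequence makes sense\<close>
     enlarge_map \<xi> h \<in> iso (rel_homology R (pinched \<xi> h) (zero_section \<xi> h ` topspace X))
                          (rel_homology R (pinched \<xi> h) (annulus_compl \<xi> h)) \<and>
     cylinder_map \<xi> h \<in> iso (rel_homology R (cylinder (sphere_bundle \<xi> h))
                                              (cylinder_ends (sphere_bundle \<xi> h)))
                           (rel_homology R (pinched \<xi> h) (annulus_compl \<xi> h)) \<and>
     theta_map (sphere_bundle \<xi> h) \<in> iso (rel_homology R (cylinder (sphere_bundle \<xi> h))
                                                        (cylinder_ends (sphere_bundle \<xi> h)))
                                      (homology R (sphere_bundle \<xi> h)) \<and>
     \<comment> \<open>the maps of the sequence have degrees 0 and -1\<close>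
     (\<forall>n. zero_section_map \<xi> h ` homology_degree R X n \<subseteq> homology_degree R (pinched \<xi> h) n) \<and>
     (\<forall>n. residue_map \<xi> h X ` homology_degree R (pinched \<xi> h) (Suc n)
            \<subseteq> homology_degree R (sphere_bundle \<xi> h) n) \<and>
     residue_map \<xi> h X ` homology_degree R (pinched \<xi> h) 0
       \<subseteq> {\<one>\<^bsub>homology R (sphere_bundle \<xi> h)\<^esub>} \<and>
     \<comment> \<open>the split short exact sequence of abelian groups\<close>
     comm_group (homology R X) \<and> comm_group (homology R (pinched \<xi> h)) \<and>
     comm_group (homology R (sphere_bundle \<xi> h)) \<and>
     short_exact (homology R X) (homology R (pinched \<xi> h)) (homology R (sphere_bundle \<xi> h))
       (zero_section_map \<xi> h) (residue_map \<xi> h X) \<and>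
     (\<exists>s\<in>hom (homology R (sphere_bundle \<xi> h)) (homology R (pinched \<xi> h)).
        splits (homology R (sphere_bundle \<xi> h)) (residue_map \<xi> h X) s \<and>
        (\<forall>n. s ` homology_degree R (sphere_bundle \<xi> h) n
               \<subseteq> homology_degree R (pinched \<xi> h) (Suc n))) \<and>
     \<comment> \<open>the module structures, and the splitting as a sequence of modules\<close>
     left_module (cohomology R X) (homology R X) (homology_action X id) \<and>
     left_module (cohomology R X) (homology R (pinched \<xi> h))
       (homology_action (pinched \<xi> h) (pinched_proj \<xi>)) \<and>
     left_module (cohomology R X) (homology R (sphere_bundle \<xi> h))
       (homology_action (sphere_bundle \<xi> h) (bproj \<xi>)) \<and>
     zero_section_map \<xi> h \<in> linear_hom (cohomology R X)
       (homology R X) (homology_action X id)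
       (homology R (pinched \<xi> h)) (homology_action (pinched \<xi> h) (pinched_proj \<xi>)) \<and>
     residue_map \<xi> h X \<in> linear_hom (cohomology R X)
       (homology R (pinched \<xi> h)) (homology_action (pinched \<xi> h) (pinched_proj \<xi>))
       (homology R (sphere_bundle \<xi> h)) (homology_action (sphere_bundle \<xi> h) (bproj \<xi>)) \<and>
     (\<exists>s\<in>linear_hom (cohomology R X)
           (homology R (sphere_bundle \<xi> h)) (homology_action (sphere_bundle \<xi> h) (bproj \<xi>))
           (homology R (pinched \<xi> h)) (homology_action (pinched \<xi> h) (pinched_proj \<xi>)).
        splits (homology R (sphere_bundle \<xi> h)) (residue_map \<xi> h X) s \<and>
        (\<forall>n. s ` homology_degree R (sphere_bundle \<xi> h) n
               \<subseteq> homology_degree R (pinched \<xi> h) (Suc n)))"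
proof -
  interpret hermitian_bundle X \<xi> h
    using assms by unfold_locales
  obtain s where s: "s \<in> linear_hom (cohomology R X) (homology R S) (homology_action S (bproj \<xi>))
      (homology R P) (homology_action P (pinched_proj \<xi>))"
    "splits (homology R S) (residue_map \<xi> h X) s"
    "\<And>n. s ` homology_degree R S n \<subseteq> homology_degree R P (Suc n)"
    by (rule linear_splitting[of R]) blast
  \<comment> \<open>The module splitting also serves as the splitting of abelian groups.\<close>
  have s_hom: "s \<in> hom (homology R S) (homology R P)"
    using s(1) by (simp add: linear_hom_def)
  show ?thesis
    by (intro conjI allI enlarge_map_iso cylinder_map_iso theta_map_iso
        homology_degree_induced[OF continuous_zero_section, folded zero_section_map_def]
        residue_homology_degree comm_group_rel_homology short_exact_residue
        bexI[OF _ s_hom] bexI[OF _ s(1)] s(2,3)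
        left_module_homology[OF continuous_map_id] left_module_homology[OF continuous_pinched_proj]
        sphere_bundle_module zero_section_linear residue_linear)
qed

end
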